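(* Let $q$ be a prime power and $\ell$ a prime with $\ell\nmid q$. Let $P(x)\in\mathbb{Z}_\ell[x]$ be monic with $\ell\nmid P(0)$, and let $\mathcal{E}$ and the probability measures $\mu_g$ on $\mathcal{E}$ be as in the context. Fix $(H,F_H,\omega_H)\in\mathcal{E}$. There is an integer $g_0$, depending only on $(H,\omega_H)$, with the following property. Consider the $\mu_g$-expected number of surjective homomorphisms $T:G\twoheadrightarrow H$ satisfying $T\circ F_G=F_H\circ T$ and $(\wedge^2T)(\omega_G)=\omega_H$, where $(G,F_G,\omega_G)$ is $\mu_g$-random. This expected number is $0$ for $g\leq g_0$ and $1$ for all $g>g_0$.
   Context: $\mathcal{E}$ is the set of isomorphism classes of triples $(G,F_G,\omega_G)$ with the following properties: $G$ is a finite abelian $\ell$-group; $\omega_G\in\wedge^2G$; $F_G$ is an endomorphism of $G$ with $P(F_G)=0$ and $(\wedge^2F_G)(\omega_G)=q\,\omega_G$. Let $\omega=\sum_{i=1}^g e_i\wedge e_{g+i}\in\wedge^2\mathbb{Z}_\ell^{2g}$. Let $\mathrm{GSp}^{(q)}_{2g}(\mathbb{Z}_\ell)$ be the coset of $\mathrm{Sp}(\mathbb{Z}_\ell^{2g},\omega)$ in $\mathrm{GSp}_{2g}(\mathbb{Z}_\ell)$ of elements scaling the symplectic structure by $q$, i.e. $F\in\mathrm{GL}_{2g}(\mathbb{Z}_\ell)$ with $(\wedge^2F)(\omega)=q\omega$. The measure $\mu_g$ is the pushforward of the Haar probability measure on this coset under $F\mapsto(\mathrm{Coker}\,P(F),\overline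 F,\overline\omega)$. Here $\overline F$ is the endomorphism induced on $\mathrm{Coker}\,P(F)$ and $\overline\omega$ is the image of $\omega$ in $\wedge^2\mathrm{Coker}\,P(F)$. *)

theory Defs
  imports "HOL-Algebra.Group" "HOL-Algebra.FiniteProduct" "HOL-Probability.Probability"
begin

text \<open>An l-adic integer is a compatible system of residues x k in [0, l^k)
  with x k = x (k+1) mod l^k, i.e. an element of the inverse limit of Z/l^k.
  All ring operations are computed level-wise and reduced mod l^k.\<close>

definition padic :: "nat \<Rightarrow> (nat \<Rightarrow> int) set" where
  "padic l = {x. \<forall>k. 0 \<le> x k \<and> x k < int l ^ k \<and> x k = x (Suc k) mod int l ^ k}"

definition zl_const :: "nat \<Rightarrow> int \<Rightarrow> nat \<Rightarrow> int" where
  "zl_const l a = (\<lambda>k. a mod int l ^ k)"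

definition zl_vec :: "nat \<Rightarrow> nat \<Rightarrow> (nat \<Rightarrow> nat \<Rightarrow> int) set" where
  "zl_vec l n = {v. (\<forall>i<n. (\<lambda>k. v k i) \<in> padic l) \<and> (\<forall>k i. n \<le> i \<longrightarrow> v k i = 0)}"

definition zl_mat :: "nat \<Rightarrow> nat \<Rightarrow> (nat \<Rightarrow> nat \<Rightarrow> nat \<Rightarrow> int) set" where
  "zl_mat l n = {A. (\<forall>i<n. \<forall>j<n. (\<lambda>k. A k i j) \<in> padic l) \<and>
                    (\<forall>k i j. \<not> (i < n \<and> j < n) \<longrightarrow> A k i j = 0)}"

definition zl_mmul :: "nat \<Rightarrow> nat \<Rightarrow> (nat \<Rightarrow> nat \<Rightarrow> nat \<Rightarrow> int) \<Rightarrow> (nat \<Rightarrow> nat \<Rightarrow> nat \<Rightarrow> int)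
    \<Rightarrow> (nat \<Rightarrow> nat \<Rightarrow> nat \<Rightarrow> int)" where
  "zl_mmul l n A B = (\<lambda>k i j. if i < n \<and> j < n then (\<Sum>r<n. A k i r * B k r j) mod int l ^ k else 0)"

definition zl_mvec :: "nat \<Rightarrow> nat \<Rightarrow> (nat \<Rightarrow> nat \<Rightarrow> nat \<Rightarrow> int) \<Rightarrow> (nat \<Rightarrow> nat \<Rightarrow> int)
    \<Rightarrow> (nat \<Rightarrow> nat \<Rightarrow> int)" where
  "zl_mvec l n A v = (\<lambda>k i. if i < n then (\<Sum>r<n. A k i r * v k r) mod int l ^ k else 0)"

definition zl_vadd :: "nat \<Rightarrow> nat \<Rightarrow> (nat \<Rightarrow> nat \<Rightarrow> int) \<Rightarrow> (nat \<Rightarrow> nat \<Rightarrow> int) \<Rightarrow> (nat \<Rightarrow> nat \<Rightarrow> int)" where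
  "zl_vadd l n v w = (\<lambda>k i. if i < n then (v k i + w k i) mod int l ^ k else 0)"

definition zl_vzero :: "nat \<Rightarrow> nat \<Rightarrow> int" where
  "zl_vzero = (\<lambda>k i. 0)"

definition zl_basis :: "nat \<Rightarrow> nat \<Rightarrow> nat \<Rightarrow> (nat \<Rightarrow> nat \<Rightarrow> int)" where
  "zl_basis l n i = (\<lambda>k j. if j = i \<and> i < n then 1 mod int l ^ k else 0)"

definition zl_idmat :: "nat \<Rightarrow> nat \<Rightarrow> (nat \<Rightarrow> nat \<Rightarrow> nat \<Rightarrow> int)" where
  "zl_idmat l n = (\<lambda>k i j. if i < n \<and> j < n \<and> i = j then 1 mod int l ^ k else 0)"

definition zl_transpose :: "(nat \<Rightarrow> nat \<Rightarrow> nat \<Rightarrow> int) \<Rightarrow> (nat \<Rightarrow> nat \<Rightarrow> nat \<Rightarrow> int)" where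
  "zl_transpose A = (\<lambda>k i j. A k j i)"

definition zl_msmul :: "nat \<Rightarrow> int \<Rightarrow> (nat \<Rightarrow> nat \<Rightarrow> nat \<Rightarrow> int) \<Rightarrow> (nat \<Rightarrow> nat \<Rightarrow> nat \<Rightarrow> int)" where
  "zl_msmul l c A = (\<lambda>k i j. (c * A k i j) mod int l ^ k)"

text \<open>Gram matrix of omega = sum_{i<g} e_i /\ e_{g+i}: J_{i,g+i} = 1, J_{g+i,i} = -1.\<close>
definition zl_J :: "nat \<Rightarrow> nat \<Rightarrow> (nat \<Rightarrow> nat \<Rightarrow> nat \<Rightarrow> int)" where
  "zl_J l g = (\<lambda>k i j. if i < g \<and> j = i + g then 1 mod int l ^ k
                       else if j < g \<and> i = j + g then (-1) mod int l ^ k else 0)"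

text \<open>The coset GSp^(q)_{2g}(Z_l): F in GL_{2g}(Z_l) with (wedge^2 F)(omega) = q omega.
  In the basis e_a /\ e_b (a<b) of wedge^2 Z_l^{2g}, the coefficient of
  (wedge^2 F)(omega) = sum_i F e_i /\ F e_{g+i} at e_a /\ e_b is (F J F^T)_{ab},
  so the condition reads F J F^T = q J.\<close>
definition gsp_coset :: "nat \<Rightarrow> nat \<Rightarrow> nat \<Rightarrow> (nat \<Rightarrow> nat \<Rightarrow> nat \<Rightarrow> int) set" where
  "gsp_coset l g q = {F \<in> zl_mat l (2*g).
      (\<exists>N \<in> zl_mat l (2*g). zl_mmul l (2*g) F N = zl_idmat l (2*g)) \<and>
      zl_mmul l (2*g) (zl_mmul l (2*g) F (zl_J l g)) (zl_transpose F)
        = zl_msmul l (int q) (zl_J l g)}"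

definition imat_mul :: "nat \<Rightarrow> (nat \<Rightarrow> nat \<Rightarrow> int) \<Rightarrow> (nat \<Rightarrow> nat \<Rightarrow> int) \<Rightarrow> (nat \<Rightarrow> nat \<Rightarrow> int)" where
  "imat_mul n A B = (\<lambda>i j. \<Sum>r<n. A i r * B r j)"

fun imat_pow :: "nat \<Rightarrow> (nat \<Rightarrow> nat \<Rightarrow> int) \<Rightarrow> nat \<Rightarrow> (nat \<Rightarrow> nat \<Rightarrow> int)" where
  "imat_pow n A 0 = (\<lambda>i j. if i = j then 1 else 0)"
| "imat_pow n A (Suc m) = imat_mul n A (imat_pow n A m)"

definition zl_poly_mat :: "nat \<Rightarrow> nat \<Rightarrow> (nat \<Rightarrow> nat \<Rightarrow> int) \<Rightarrow> nat
    \<Rightarrow> (nat \<Rightarrow> nat \<Rightarrow> nat \<Rightarrow> int) \<Rightarrow> (nat \<Rightarrow> nat \<Rightarrow> nat \<Rightarrow> int)" where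
  "zl_poly_mat l n c d F = (\<lambda>k i j. if i < n \<and> j < n then
       (\<Sum>e\<le>d. c e k * imat_pow n (F k) e i j) mod int l ^ k else 0)"

definition coker_rel :: "nat \<Rightarrow> nat \<Rightarrow> (nat \<Rightarrow> nat \<Rightarrow> nat \<Rightarrow> int)
    \<Rightarrow> ((nat \<Rightarrow> nat \<Rightarrow> int) \<times> (nat \<Rightarrow> nat \<Rightarrow> int)) set" where
  "coker_rel l n B = {(v, w). v \<in> zl_vec l n \<and> w \<in> zl_vec l n \<and>
       (\<exists>u \<in> zl_vec l n. v = zl_vadd l n w (zl_mvec l n B u))}"

definition coker_proj :: "nat \<Rightarrow> nat \<Rightarrow> (nat \<Rightarrow> nat \<Rightarrow> nat \<Rightarrow> int) \<Rightarrow> (nat \<Rightarrow> nat \<Rightarrow> int)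
    \<Rightarrow> (nat \<Rightarrow> nat \<Rightarrow> int) set" where
  "coker_proj l n B v = coker_rel l n B `` {v}"

definition coker :: "nat \<Rightarrow> nat \<Rightarrow> (nat \<Rightarrow> nat \<Rightarrow> nat \<Rightarrow> int) \<Rightarrow> (nat \<Rightarrow> nat \<Rightarrow> int) set monoid" where
  "coker l n B = \<lparr> carrier = zl_vec l n // coker_rel l n B,
      monoid.mult = (\<lambda>X Y. coker_proj l n B (zl_vadd l n (SOME x. x \<in> X) (SOME y. y \<in> Y))),
      monoid.one = coker_proj l n B zl_vzero \<rparr>"

text \<open>The endomorphism of Coker B induced by F (when F commutes with B).\<close>
definition coker_endo :: "nat \<Rightarrow> nat \<Rightarrow> (nat \<Rightarrow> nat \<Rightarrow> nat \<Rightarrow> int) \<Rightarrow> (nat \<Rightarrow> nat \<Rightarrow> nat \<Rightarrow> int)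
    \<Rightarrow> (nat \<Rightarrow> nat \<Rightarrow> int) set \<Rightarrow> (nat \<Rightarrow> nat \<Rightarrow> int) set" where
  "coker_endo l n B F X = coker_proj l n B (zl_mvec l n F (SOME x. x \<in> X))"

text \<open>wedge^2 H = Z[H x H] / (bilinearity and x /\ x relations).
  Formal sums are finitely supported integer functions on carrier H x carrier H.\<close>

definition fsums :: "('a, 'b) monoid_scheme \<Rightarrow> ('a \<times> 'a \<Rightarrow> int) set" where
  "fsums H = {f. finite {p. f p \<noteq> 0} \<and> (\<forall>p. f p \<noteq> 0 \<longrightarrow> p \<in> carrier H \<times> carrier H)}"

definition fs_single :: "'a \<Rightarrow> 'a \<Rightarrow> ('a \<times> 'a \<Rightarrow> int)" where
  "fs_single x y = (\<lambda>p. if p = (x, y) then 1 else 0)"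

inductive_set wedge_rel :: "('a, 'b) monoid_scheme \<Rightarrow> ('a \<times> 'a \<Rightarrow> int) set" for H where
  wr_zero: "(\<lambda>_. 0) \<in> wedge_rel H"
| wr_left: "\<lbrakk>x \<in> carrier H; y \<in> carrier H; z \<in> carrier H\<rbrakk> \<Longrightarrow>
    (\<lambda>p. fs_single (monoid.mult H x y) z p - fs_single x z p - fs_single y z p) \<in> wedge_rel H"
| wr_right: "\<lbrakk>x \<in> carrier H; y \<in> carrier H; z \<in> carrier H\<rbrakk> \<Longrightarrow>
    (\<lambda>p. fs_single x (monoid.mult H y z) p - fs_single x y p - fs_single x z p) \<in> wedge_rel H"
| wr_alt: "x \<in> carrier H \<Longrightarrow> fs_single x x \<in> wedge_rel H"
| wr_add: "\<lbrakk>f \<in> wedge_rel H; h \<in> wedge_rel H\<rbrakk> \<Longrightarrow> (\<lambda>p. f p + h p) \<in> wedge_rel H"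
| wr_neg: "f \<in> wedge_rel H \<Longrightarrow> (\<lambda>p. - f p) \<in> wedge_rel H"

definition wedge_class :: "('a, 'b) monoid_scheme \<Rightarrow> ('a \<times> 'a \<Rightarrow> int) \<Rightarrow> ('a \<times> 'a \<Rightarrow> int) set" where
  "wedge_class H f = {f' \<in> fsums H. (\<lambda>p. f' p - f p) \<in> wedge_rel H}"

definition wedge2 :: "('a, 'b) monoid_scheme \<Rightarrow> ('a \<times> 'a \<Rightarrow> int) set set" where
  "wedge2 H = wedge_class H ` fsums H"

definition fs_map :: "('a \<Rightarrow> 'c) \<Rightarrow> ('a \<times> 'a \<Rightarrow> int) \<Rightarrow> ('c \<times> 'c \<Rightarrow> int)" where
  "fs_map \<phi> f = (\<lambda>p. \<Sum>s \<in> {s. f s \<noteq> 0 \<and> (\<phi> (fst s), \<phi> (snd s)) = p}. f s)"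

definition wedge_map :: "('a, 'b) monoid_scheme \<Rightarrow> ('c, 'd) monoid_scheme \<Rightarrow> ('a \<Rightarrow> 'c)
    \<Rightarrow> ('a \<times> 'a \<Rightarrow> int) set \<Rightarrow> ('c \<times> 'c \<Rightarrow> int) set" where
  "wedge_map G H \<phi> W = wedge_class H (fs_map \<phi> (SOME f. f \<in> W))"

definition wedge_scale :: "('a, 'b) monoid_scheme \<Rightarrow> int \<Rightarrow> ('a \<times> 'a \<Rightarrow> int) set
    \<Rightarrow> ('a \<times> 'a \<Rightarrow> int) set" where
  "wedge_scale H c W = wedge_class H (\<lambda>p. c * (SOME f. f \<in> W) p)"

text \<open>c . h = h^(c mod l^N) for N = |H| (l^N kills H when |H| is a power of l).\<close>
definition zl_act :: "('a, 'b) monoid_scheme \<Rightarrow> (nat \<Rightarrow> int) \<Rightarrow> 'a \<Rightarrow> 'a" where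
  "zl_act H c h = h [^]\<^bsub>H\<^esub> (nat (c (card (carrier H))))"

definition poly_endo_zero :: "('a, 'b) monoid_scheme \<Rightarrow> (nat \<Rightarrow> nat \<Rightarrow> int) \<Rightarrow> nat \<Rightarrow> ('a \<Rightarrow> 'a) \<Rightarrow> bool" where
  "poly_endo_zero H c d \<phi> \<longleftrightarrow>
     (\<forall>h \<in> carrier H. finprod H (\<lambda>e. zl_act H (c e) ((\<phi> ^^ e) h)) {..d} = \<one>\<^bsub>H\<^esub>)"

definition omega_bar_rep :: "nat \<Rightarrow> nat \<Rightarrow> (nat \<Rightarrow> nat \<Rightarrow> nat \<Rightarrow> int)
    \<Rightarrow> ((nat \<Rightarrow> nat \<Rightarrow> int) set \<times> (nat \<Rightarrow> nat \<Rightarrow> int) set \<Rightarrow> int)" where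
  "omega_bar_rep l g B = (\<lambda>p. \<Sum>i<g. fs_single (coker_proj l (2*g) B (zl_basis l (2*g) i))
                                        (coker_proj l (2*g) B (zl_basis l (2*g) (g + i))) p)"

definition sur_count :: "nat \<Rightarrow> nat \<Rightarrow> (nat \<Rightarrow> nat \<Rightarrow> int) \<Rightarrow> nat \<Rightarrow> ('a, 'b) monoid_scheme
    \<Rightarrow> ('a \<Rightarrow> 'a) \<Rightarrow> ('a \<times> 'a \<Rightarrow> int) set \<Rightarrow> (nat \<Rightarrow> nat \<Rightarrow> nat \<Rightarrow> int) \<Rightarrow> nat" where
  "sur_count l g c d H FH \<omega>H F =
     (let n = 2 * g; B = zl_poly_mat l n c d F; G = coker l n B in
      card {T. T \<in> epi G H \<and> T \<in> extensional (carrier G) \<and>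
               (\<forall>X \<in> carrier G. T (coker_endo l n B F X) = FH (T X)) \<and>
               wedge_map G H T (wedge_class G (omega_bar_rep l g B)) = \<omega>H})"

text \<open>Sigma algebra on a set of Z_l-matrices generated by the level-k cylinder sets
  (= Borel sigma algebra of the profinite topology), and Haar probability measure
  on the coset C of the compact group Sp, i.e. the Sp-left-invariant probability measure.\<close>
definition zl_cyl_sets :: "(nat \<Rightarrow> nat \<Rightarrow> nat \<Rightarrow> int) set \<Rightarrow> (nat \<Rightarrow> nat \<Rightarrow> nat \<Rightarrow> int) set set" where
  "zl_cyl_sets C = sigma_sets C {{A \<in> C. A k = M} | k M. True}"

definition haar_coset :: "nat \<Rightarrow> nat \<Rightarrow> (nat \<Rightarrow> nat \<Rightarrow> nat \<Rightarrow> int) measure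
    \<Rightarrow> (nat \<Rightarrow> nat \<Rightarrow> nat \<Rightarrow> int) set \<Rightarrow> (nat \<Rightarrow> nat \<Rightarrow> nat \<Rightarrow> int) set \<Rightarrow> bool" where
  "haar_coset l n \<mu> C Sp \<longleftrightarrow> prob_space \<mu> \<and> space \<mu> = C \<and> sets \<mu> = zl_cyl_sets C \<and>
      (\<forall>S \<in> Sp. distr \<mu> \<mu> (zl_mmul l n S) = \<mu>)"

end

theory Submission
  imports Defs "HOL-Number_Theory.Cong" "HOL-Computational_Algebra.Primes"
    "HOL-Algebra.Multiplicative_Group" "HOL-Library.Function_Algebras"
begin

text \<open>A surjection T as in the theorem is the same as a tuple t in H^(2g) that generates H, satisfies
  sum t_i /\ t_(g+i) = \<open>\<omega>H\<close> (call this set S) and tF = FH t, where t is regarded as a row vector. For F in the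
  coset, tF lies in the set S' of generating tuples with wedge sum q \<open>\<omega>H\<close>, and FH, being an automorphism
  of H because P(0) is a unit, maps S bijectively onto S'. Integral symplectic transvections act transitively
  on S, so by left invariance of the measure the probability p(u) of tF = u does not depend on t in S. Hence the
  expected number of surjections is the sum of p(FH t) over t in S, that is, the sum of p(u) over u in S',
  which is 1 unless S is empty. Padding a tuple by trivial pairs shows that S is nonempty exactly for large g.\<close>

text \<open>No condition for factoring through the cokernel is imposed on t, because tF = FH t gives
  t P(F) = P(FH) t, which is trivial. Nor is continuity imposed: an additive map from Z_l^(2g) to a
  finite l-group factors through a finite level by itself. Everything is therefore read off the
  residue of F at the single level |H|, the level at which \<open>zl_act\<close> reads the
  coefficients of P. Transitivity is the hard step. Equality of wedge sums is used only through
  pairs of characters with values in Z/N, which turn it into congruences between integer symplectic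
  products; for generating tuples this already determines the orbit. The transvections have integer
  coefficients, so they define elements of Sp(Z_l) and nothing has to be lifted from a finite ring.
  The delicate case is a quotient of exponent l: there a correction by two transvections can be
  blocked by a congruence mod l, and the fact that the target tuple generates has to be
  used.\<close>

section \<open>Characters of finite abelian groups\<close>

text \<open>Finite abelian groups are written as quotients of the additive group of a commutative ring by an additive
  subgroup L. The multiplication of the ring only serves to express integer multiples as of_int n * a.\<close>
definition zsub :: "'a::comm_ring_1 set \<Rightarrow> bool" where
  "zsub L \<longleftrightarrow> 0 \<in> L \<and> (\<forall>a\<in>L. \<forall>b\<in>L. a - b \<in> L)"

lemma zsub_zero: "zsub L \<Longrightarrow> 0 \<in> L"
  by (simp add: zsub_def)

lemma zsub_diff: "zsub L \<Longrightarrow> a \<in> L \<Longrightarrow> b \<in> L \<Longrightarrow> a - b \<in> L"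
  by (simp add: zsub_def)

lemma zsub_uminus: "zsub L \<Longrightarrow> a \<in> L \<Longrightarrow> - a \<in> L"
  using zsub_diff[of L 0 a] zsub_zero[of L] by simp

lemma zsub_add: "zsub L \<Longrightarrow> a \<in> L \<Longrightarrow> b \<in> L \<Longrightarrow> a + b \<in> L"
  using zsub_diff[of L a "- b"] zsub_uminus[of L b] by simp

lemma zsub_of_int:
  assumes "zsub L" "a \<in> L" shows "of_int n * a \<in> L"
proof -
  have *: "of_nat k * a \<in> L" for k
    by (induction k) (use assms zsub_zero zsub_add in \<open>auto simp: distrib_right\<close>)
  show ?thesis
  proof (cases n)
    case (nonneg k) then show ?thesis using *[of k] by simp
  next
    case (neg k)
    then have "of_int n * a = - (of_nat (Suc k) * a)"
      by (metis minus_mult_left of_int_minus of_int_of_nat_eq)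
    then show ?thesis using *[of "Suc k"] zsub_uminus[OF assms(1)] by metis
  qed
qed

lemmas zsub_intros = zsub_zero zsub_diff zsub_add zsub_uminus zsub_of_int

lemma zsub_sum: "zsub L \<Longrightarrow> (\<And>i. i \<in> I \<Longrightarrow> f i \<in> L) \<Longrightarrow> sum f I \<in> L"
  by (induction I rule: infinite_finite_induct) (auto intro: zsub_intros)

definition zspan1 :: "'a::comm_ring_1 set \<Rightarrow> 'a \<Rightarrow> 'a set" where
  "zspan1 K h = {k + of_int n * h | k n. k \<in> K}"

lemma zsub_zspan1: assumes "zsub K" shows "zsub (zspan1 K h)"
  unfolding zsub_def
proof (intro conjI ballI)
  show "0 \<in> zspan1 K h"
    unfolding zspan1_def using zsub_zero[OF assms] by (auto intro!: exI[of _ 0])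
  fix a b assume "a \<in> zspan1 K h" "b \<in> zspan1 K h"
  then obtain k n k' n' where "a = k + of_int n * h" "b = k' + of_int n' * h" "k \<in> K" "k' \<in> K"
    by (auto simp: zspan1_def)
  then have "a - b = (k - k') + of_int (n - n') * h" "k - k' \<in> K"
    using zsub_diff[OF assms] by (auto simp: algebra_simps)
  then show "a - b \<in> zspan1 K h" unfolding zspan1_def by blast
qed

lemma zspan1_base: "k \<in> K \<Longrightarrow> k \<in> zspan1 K h"
  unfolding zspan1_def by (auto intro!: exI[of _ k] exI[of _ "0::int"])

lemma zspan1_gen: "zsub K \<Longrightarrow> h \<in> zspan1 K h"
  unfolding zspan1_def using zsub_zero by (auto intro!: exI[of _ 0] exI[of _ "1::int"])

text \<open>Homomorphisms from K to Z/N that vanish on L, lifted to integer-valued functions.\<close>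
definition zchar_on :: "int \<Rightarrow> 'a::comm_ring_1 set \<Rightarrow> 'a set \<Rightarrow> ('a \<Rightarrow> int) \<Rightarrow> bool" where
  "zchar_on N K L \<psi> \<longleftrightarrow> (\<forall>a\<in>K. \<forall>b\<in>K. [\<psi> (a + b) = \<psi> a + \<psi> b] (mod N)) \<and> (\<forall>a\<in>L. [\<psi> a = 0] (mod N))"

lemma zchar_on_add: "zchar_on N K L \<psi> \<Longrightarrow> a \<in> K \<Longrightarrow> b \<in> K \<Longrightarrow> [\<psi> (a + b) = \<psi> a + \<psi> b] (mod N)"
  and zchar_on_vanish: "zchar_on N K L \<psi> \<Longrightarrow> a \<in> L \<Longrightarrow> [\<psi> a = 0] (mod N)"
  by (auto simp: zchar_on_def)

lemma zchar_on_zero: assumes "zsub K" "zchar_on N K L \<psi>" shows "[\<psi> 0 = 0] (mod N)"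
proof -
  have "[\<psi> (0 + 0) = \<psi> 0 + \<psi> 0] (mod N)"
    using assms zchar_on_add zsub_zero by blast
  then show ?thesis by (simp add: cong_iff_dvd_diff)
qed

lemma zchar_on_of_int:
  assumes K: "zsub K" and ch: "zchar_on N K L \<psi>" and a: "a \<in> K"
  shows "[\<psi> (of_int n * a) = n * \<psi> a] (mod N)"
proof -
  have *: "[\<psi> (of_int (int k) * a) = int k * \<psi> a] (mod N)" for k
  proof (induction k)
    case 0 then show ?case using zchar_on_zero[OF K ch] by simp
  next
    case (Suc k)
    have "[\<psi> (of_int (int k) * a + a) = \<psi> (of_int (int k) * a) + \<psi> a] (mod N)"
      by (rule zchar_on_add[OF ch zsub_of_int[OF K a] a])
    also have "[\<psi> (of_int (int k) * a) + \<psi> a = int k * \<psi> a + \<psi> a] (mod N)"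
      by (intro cong_add Suc cong_refl)
    finally show ?case by (simp add: algebra_simps)
  qed
  show ?thesis
  proof (cases n)
    case (nonneg k) then show ?thesis using * by simp
  next
    case (neg k)
    have "[\<psi> (of_int n * a + of_int (- n) * a) = \<psi> (of_int n * a) + \<psi> (of_int (- n) * a)] (mod N)"
      by (rule zchar_on_add[OF ch zsub_of_int[OF K a] zsub_of_int[OF K a]])
    moreover have "of_int n * a + of_int (- n) * a = 0" by simp
    moreover have "[\<psi> (of_int (- n) * a) = (- n) * \<psi> a] (mod N)"
      using *[of "Suc k"] neg by (simp add: add.commute)
    ultimately have d: "N dvd \<psi> 0 - (\<psi> (of_int n * a) + \<psi> (of_int (- n) * a))"
      "N dvd \<psi> (of_int (- n) * a) - (- n) * \<psi> a" "N dvd \<psi> 0"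
      using zchar_on_zero[OF K ch] by (auto simp: cong_iff_dvd_diff)
    from dvd_diff[OF dvd_diff[OF d(3) d(1)] d(2)]
    show ?thesis by (simp add: cong_iff_dvd_diff algebra_simps)
  qed
qed

text \<open>All relations between h and K follow from m h being in K, so a value s at h is
  admissible as soon as it respects that one relation. The values of the extension are picked by
  SOME and are determined only mod N, hence the congruences in the conclusion.\<close>

lemma zchar_on_extend1:
  assumes K: "zsub K" and LK: "L \<subseteq> K" and ch: "zchar_on N K L \<psi>"
    and mh: "of_int m * h \<in> K" and mdvd: "\<And>n. of_int n * h \<in> K \<Longrightarrow> m dvd n"
    and s: "[\<psi> (of_int m * h) = m * s] (mod N)"
  obtains \<psi>' where "zchar_on N (zspan1 K h) L \<psi>'" "\<And>a. a \<in> K \<Longrightarrow> [\<psi>' a = \<psi> a] (mod N)"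
    "[\<psi>' h = s] (mod N)"
proof -
  have wd: "[\<psi> k + n * s = \<psi> k' + n' * s] (mod N)"
    if "k \<in> K" "k' \<in> K" and eq: "k + of_int n * h = k' + of_int n' * h" for k k' n n'
  proof -
    have e: "of_int (n - n') * h = k' - k"
      using eq by (simp add: algebra_simps)
    then have "m dvd n - n'" using mdvd that zsub_diff[OF K] by metis
    then obtain j where j: "n - n' = m * j" by blast
    have k': "k' = k + of_int j * (of_int m * h)"
      using e j by (simp add: algebra_simps)
    have "[\<psi> k' = \<psi> k + \<psi> (of_int j * (of_int m * h))] (mod N)"
      unfolding k' by (rule zchar_on_add[OF ch]) (auto intro: that zsub_of_int K mh)
    also have "[\<psi> k + \<psi> (of_int j * (of_int m * h)) = \<psi> k + j * \<psi> (of_int m * h)] (mod N)"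
      by (intro cong_add cong_refl zchar_on_of_int[OF K ch] mh)
    also have "[\<psi> k + j * \<psi> (of_int m * h) = \<psi> k + j * (m * s)] (mod N)"
      by (intro cong_add cong_mult cong_refl s)
    finally have "[\<psi> k' + n' * s = \<psi> k + j * (m * s) + n' * s] (mod N)"
      by (intro cong_add cong_refl)
    moreover have "\<psi> k + j * (m * s) + n' * s = \<psi> k + n * s"
    proof -
      have "n = n' + m * j" using j by simp
      then show ?thesis by (simp add: algebra_simps)
    qed
    ultimately show ?thesis by (simp add: cong_sym)
  qed
  define \<psi>' where "\<psi>' a = (SOME z. \<exists>k\<in>K. \<exists>n. a = k + of_int n * h \<and> z = \<psi> k + n * s)" for a
  have val: "[\<psi>' (k + of_int n * h) = \<psi> k + n * s] (mod N)" if "k \<in> K" for k n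
  proof -
    have "\<exists>k'\<in>K. \<exists>n'. k + of_int n * h = k' + of_int n' * h \<and> \<psi>' (k + of_int n * h) = \<psi> k' + n' * s"
      unfolding \<psi>'_def by (rule someI_ex) (use that in blast)
    then show ?thesis using wd that by metis
  qed
  have valK: "[\<psi>' k = \<psi> k] (mod N)" if "k \<in> K" for k
    using val[OF that, of 0] by simp
  show thesis
  proof (rule that[of \<psi>'])
    show "zchar_on N (zspan1 K h) L \<psi>'"
      unfolding zchar_on_def
    proof (intro conjI ballI)
      fix a b assume "a \<in> zspan1 K h" "b \<in> zspan1 K h"
      then obtain k n k' n' where e: "a = k + of_int n * h" "b = k' + of_int n' * h" "k \<in> K" "k' \<in> K"
        by (auto simp: zspan1_def)
      have ab: "a + b = (k + k') + of_int (n + n') * h" using e by (simp add: algebra_simps)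
      have "[\<psi>' (a + b) = \<psi> (k + k') + (n + n') * s] (mod N)"
        unfolding ab by (rule val) (auto intro: zsub_add K e)
      also have "[\<psi> (k + k') + (n + n') * s = \<psi> k + \<psi> k' + (n + n') * s] (mod N)"
        by (intro cong_add cong_refl zchar_on_add[OF ch] e)
      also have "\<psi> k + \<psi> k' + (n + n') * s = (\<psi> k + n * s) + (\<psi> k' + n' * s)"
        by (simp add: algebra_simps)
      also have "[\<dots> = \<psi>' a + \<psi>' b] (mod N)"
        unfolding e by (intro cong_add cong_sym[OF val] e)
      finally show "[\<psi>' (a + b) = \<psi>' a + \<psi>' b] (mod N)" .
    next
      fix a assume "a \<in> L"
      then show "[\<psi>' a = 0] (mod N)"
        using valK[of a] LK zchar_on_vanish[OF ch] cong_trans by blast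
    qed
    show "[\<psi>' a = \<psi> a] (mod N)" if "a \<in> K" for a by (rule valK[OF that])
    show "[\<psi>' h = s] (mod N)"
    proof -
      have "[\<psi>' h = \<psi> 0 + s] (mod N)" using val[OF zsub_zero[OF K], of 1] by simp
      also have "[\<psi> 0 + s = 0 + s] (mod N)" by (intro cong_add cong_refl zchar_on_zero[OF K ch])
      finally show ?thesis by simp
    qed
  qed
qed

text \<open>m is the order of h modulo K: the positive generator of the ideal of all n with n h in
  K, hence a divisor of N.\<close>

lemma zsub_order:
  assumes K: "zsub K" and N: "of_int N * h \<in> K" "N > 0"
  obtains m :: int where "m > 0" "m dvd N" "of_int m * h \<in> K" "\<And>n. of_int n * h \<in> K \<Longrightarrow> m dvd n"
proof -
  define P where "P k \<longleftrightarrow> k > 0 \<and> of_int (int k) * h \<in> K" for k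
  have "P (nat N)" using N by (simp add: P_def)
  define m where "m = (LEAST k. P k)"
  have m: "P m" unfolding m_def by (rule LeastI[of P, OF \<open>P (nat N)\<close>])
  have d: "int m dvd n" if "of_int n * h \<in> K" for n
  proof (rule ccontr)
    assume "\<not> int m dvd n"
    then have r: "n mod int m > 0" "n mod int m < int m"
      using m pos_mod_sign[of "int m" n] pos_mod_bound[of "int m" n]
      by (auto simp: P_def dvd_eq_mod_eq_0 simp del: pos_mod_sign pos_mod_bound)
    have "of_int (n mod int m) * h = of_int n * h - of_int (n div int m) * (of_int (int m) * h)"
      by (simp add: minus_div_mult_eq_mod[symmetric] algebra_simps)
    then have "of_int (n mod int m) * h \<in> K"
      using m that by (auto simp: P_def intro: zsub_intros K)
    then have "P (nat (n mod int m))" using r by (simp add: P_def)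
    then have "m \<le> nat (n mod int m)" unfolding m_def by (rule Least_le)
    then show False using r by simp
  qed
  show thesis by (rule that[of "int m"]) (use m d N in \<open>auto simp: P_def\<close>)
qed

text \<open>Z/N is injective among abelian groups killed by N. One element h is adjoined at a time:
  with N = m j, the character vanishes at N h, so m divides its value at m h, and the quotient is a
  possible value at h. The induction counts the representatives in R that lie outside K.\<close>

lemma zchar_on_extend:
  assumes "finite R" and R: "\<And>a. \<exists>r\<in>R. a - r \<in> L" and L: "zsub L"
    and N: "\<And>a. of_int N * a \<in> L" "N > 0"
  shows "zsub K \<Longrightarrow> L \<subseteq> K \<Longrightarrow> zchar_on N K L \<psi> \<Longrightarrow>
    \<exists>\<psi>'. zchar_on N UNIV L \<psi>' \<and> (\<forall>a\<in>K. [\<psi>' a = \<psi> a] (mod N))"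
proof (induction "card (R - K)" arbitrary: K \<psi> rule: less_induct)
  case less
  note K = less.prems(1) and LK = less.prems(2) and ch = less.prems(3)
  show ?case
  proof (cases "K = UNIV")
    case True then show ?thesis using ch by (intro exI[of _ \<psi>]) auto
  next
    case False
    then obtain h where h: "h \<notin> K" by blast
    obtain m where m: "m > 0" "m dvd N" "of_int m * h \<in> K" "\<And>n. of_int n * h \<in> K \<Longrightarrow> m dvd n"
      using zsub_order[OF K _ N(2)] N(1) LK by (metis subsetD)
    obtain j where j: "N = m * j" using m(2) by blast
    have "[\<psi> (of_int j * (of_int m * h)) = j * \<psi> (of_int m * h)] (mod N)"
      by (rule zchar_on_of_int[OF K ch m(3)])
    moreover have "[\<psi> (of_int j * (of_int m * h)) = 0] (mod N)"
      using N(1)[of h] j by (intro zchar_on_vanish[OF ch]) (simp add: algebra_simps)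
    ultimately have "m * j dvd j * \<psi> (of_int m * h)"
      by (metis cong_0_iff cong_sym cong_trans j)
    moreover have "j \<noteq> 0" using j N(2) by auto
    ultimately have "m dvd \<psi> (of_int m * h)" by (simp add: mult.commute)
    then obtain s where s: "\<psi> (of_int m * h) = m * s" by blast
    obtain \<psi>1 where c1: "zchar_on N (zspan1 K h) L \<psi>1" "\<And>a. a \<in> K \<Longrightarrow> [\<psi>1 a = \<psi> a] (mod N)"
      using zchar_on_extend1[OF K LK ch m(3,4), of s] s by auto
    obtain r where r: "r \<in> R" "h - r \<in> L" using R by blast
    have rK: "r \<notin> K"
    proof
      assume "r \<in> K"
      then have "(h - r) + r \<in> K" using r LK zsub_add[OF K, of "h - r" r] by blast
      then show False using h by simp
    qed
    have "h - (h - r) \<in> zspan1 K h"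
      using r LK zsub_diff[OF zsub_zspan1[OF K] zspan1_gen[OF K] zspan1_base, of "h - r" h] by blast
    then have rs: "r \<in> zspan1 K h" by simp
    have "card (R - zspan1 K h) < card (R - K)"
      by (rule psubset_card_mono) (use rs rK r zspan1_base[of _ K h] \<open>finite R\<close> in auto)
    from less.hyps[OF this zsub_zspan1[OF K] _ c1(1)]
    obtain \<psi>' where "zchar_on N UNIV L \<psi>'" "\<forall>a\<in>zspan1 K h. [\<psi>' a = \<psi>1 a] (mod N)"
      using LK zspan1_base by blast
    then show ?thesis using c1(2) zspan1_base cong_trans by blast
  qed
qed

abbreviation zchar :: "int \<Rightarrow> 'a::comm_ring_1 set \<Rightarrow> ('a \<Rightarrow> int) \<Rightarrow> bool" where
  "zchar N L \<equiv> zchar_on N UNIV L"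

lemma zsub_UNIV: "zsub UNIV" by (simp add: zsub_def)

text \<open>h has order m modulo L, so it may take any value in Z/N that m kills. The character is
  set on L + Z h, starting from 0 on L, and then extended. It is used to separate points of the
  quotient by L.\<close>

lemma zchar_exists:
  assumes "finite R" and R: "\<And>a. \<exists>r\<in>R. a - r \<in> L" and L: "zsub L"
    and N: "\<And>a. of_int N * a \<in> L" "N > 0"
    and m: "of_int m * h \<in> L" "\<And>n. of_int n * h \<in> L \<Longrightarrow> m dvd n" "N dvd m * s"
  obtains \<psi> where "zchar N L \<psi>" "[\<psi> h = s] (mod N)"
proof -
  have ch0: "zchar_on N L L (\<lambda>_. 0)" by (simp add: zchar_on_def)
  obtain \<psi>1 where c1: "zchar_on N (zspan1 L h) L \<psi>1" "[\<psi>1 h = s] (mod N)"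
    using zchar_on_extend1[OF L order_refl ch0 m(1,2), of s] m(3)
    by (metis cong_0_iff cong_sym)
  obtain \<psi> where "zchar N L \<psi>" "\<forall>a\<in>zspan1 L h. [\<psi> a = \<psi>1 a] (mod N)"
    using zchar_on_extend[OF assms(1) R L N zsub_zspan1[OF L, of h] _ c1(1)] zspan1_base by blast
  then show thesis using that c1(2) zspan1_gen[OF L] cong_trans by blast
qed

section \<open>Symplectic transvections\<close>

definition sympl_dual :: "nat \<Rightarrow> (nat \<Rightarrow> int) \<Rightarrow> nat \<Rightarrow> int" where
  "sympl_dual g u = (\<lambda>j. if j < g then u (g + j) else - u (j - g))"

definition sympl :: "nat \<Rightarrow> (nat \<Rightarrow> int) \<Rightarrow> (nat \<Rightarrow> int) \<Rightarrow> int" where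
  "sympl g p r = (\<Sum>i<g. p i * r (g + i) - p (g + i) * r i)"

definition lincomb :: "nat \<Rightarrow> (nat \<Rightarrow> int) \<Rightarrow> (nat \<Rightarrow> 'a::comm_ring_1) \<Rightarrow> 'a" where
  "lincomb n u t = (\<Sum>i<n. of_int (u i) * t i)"

text \<open>With Ju = sympl_dual g u, F = 1 + c u (Ju)^T and t regarded as a row vector, this is t F.\<close>
definition transv :: "nat \<Rightarrow> int \<Rightarrow> (nat \<Rightarrow> int) \<Rightarrow> (nat \<Rightarrow> 'a::comm_ring_1) \<Rightarrow> nat \<Rightarrow> 'a" where
  "transv g c u t = (\<lambda>j. t j + of_int (c * sympl_dual g u j) * lincomb (2 * g) u t)"

text \<open>A product of transvections is kept as a reachability relation on tuples, so that no
  product matrix has to be formed.\<close>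

definition transv_reach :: "nat \<Rightarrow> (nat \<Rightarrow> 'a::comm_ring_1) \<Rightarrow> (nat \<Rightarrow> 'a) \<Rightarrow> bool" where
  "transv_reach g = (\<lambda>t t'. \<exists>c u. t' = transv g c u t)\<^sup>*\<^sup>*"

lemma sum_halves: "(\<Sum>i<2*g. f i) = (\<Sum>i<g. f i + f (g + i))" for f :: "nat \<Rightarrow> 'a::comm_monoid_add"
proof -
  have "{..<2*g} = {..<g} \<union> {g..<g+g}" by auto
  moreover have "sum f ({..<g} \<union> {g..<g+g}) = (\<Sum>i<g. f i) + (\<Sum>i=g..<g+g. f i)"
    by (rule sum.union_disjoint) auto
  ultimately have "(\<Sum>i<2*g. f i) = (\<Sum>i<g. f i) + (\<Sum>i=g..<g+g. f i)" by simp
  also have "(\<Sum>i=g..<g+g. f i) = (\<Sum>i<g. f (g + i))"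
    using sum.shift_bounds_nat_ivl[of f 0 g g] by (simp add: add.commute lessThan_atLeast0)
  finally show ?thesis by (simp add: sum.distrib)
qed

lemma lincomb_add: "lincomb n (\<lambda>i. u i + w i) t = lincomb n u t + lincomb n w t"
  by (simp add: lincomb_def sum.distrib algebra_simps)

lemma lincomb_scale: "lincomb n (\<lambda>i. c * u i) t = of_int c * lincomb n u t"
  by (simp add: lincomb_def sum_distrib_left algebra_simps)

lemma lincomb_int: "lincomb n u t = (\<Sum>i<n. u i * t i)" for t :: "nat \<Rightarrow> int"
  by (simp add: lincomb_def)

lemma lincomb_dual_self: "lincomb (2 * g) u (sympl_dual g u) = 0"
  unfolding lincomb_int sum_halves sympl_def
  by (rule sum.neutral) (auto simp: sympl_dual_def algebra_simps)

lemma lincomb_dual: "lincomb (2 * g) w (sympl_dual g u) = - sympl g u w"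
  unfolding lincomb_int sum_halves sympl_def sum_negf[symmetric]
  by (rule sum.cong) (auto simp: sympl_dual_def algebra_simps)

lemma sympl_dual_right: "sympl g p (sympl_dual g u) = - lincomb (2 * g) u p"
  unfolding lincomb_int sum_halves sympl_def sum_negf[symmetric]
  by (rule sum.cong) (auto simp: sympl_dual_def algebra_simps)

lemma sympl_dual_left: "sympl g (sympl_dual g u) p = lincomb (2 * g) u p"
  unfolding lincomb_int sum_halves sympl_def sum_negf[symmetric]
  by (rule sum.cong) (auto simp: sympl_dual_def algebra_simps)

lemma sympl_add_left: "sympl g (\<lambda>i. p i + p' i) r = sympl g p r + sympl g p' r"
  by (simp add: sympl_def sum.distrib[symmetric] algebra_simps)

lemma sympl_add_right: "sympl g p (\<lambda>i. r i + r' i) = sympl g p r + sympl g p r'"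
  by (simp add: sympl_def sum.distrib[symmetric] algebra_simps)

lemma sympl_scale_left: "sympl g (\<lambda>i. c * p i) r = c * sympl g p r"
  by (simp add: sympl_def sum_distrib_left algebra_simps)

lemma sympl_scale_right: "sympl g p (\<lambda>i. c * r i) = c * sympl g p r"
  by (simp add: sympl_def sum_distrib_left algebra_simps)

lemma sympl_self: "sympl g p p = 0"
  by (simp add: sympl_def)

lemma sympl_cong:
  assumes "\<And>i. i < 2 * g \<Longrightarrow> [p i = p' i] (mod N)" "\<And>i. i < 2 * g \<Longrightarrow> [r i = r' i] (mod N)"
  shows "[sympl g p r = sympl g p' r'] (mod N)"
  unfolding sympl_def by (intro cong_sum cong_diff cong_mult assms) auto

text \<open>The two cross terms are c (u.p)(u.r) with opposite signs, and Ju is isotropic.\<close>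

lemma sympl_transv: "sympl g (transv g c u p) (transv g c u r) = sympl g p r"
proof -
  have "transv g c u p = (\<lambda>j. p j + (c * lincomb (2*g) u p) * sympl_dual g u j)" for p :: "nat \<Rightarrow> int"
    by (auto simp: transv_def)
  then show ?thesis
    by (simp only: sympl_add_left sympl_add_right sympl_scale_left sympl_scale_right
        sympl_dual_left sympl_dual_right sympl_self) (simp add: algebra_simps)
qed

lemma lincomb_transv: "lincomb (2*g) w (transv g c u t)
    = lincomb (2*g) w t - of_int (c * sympl g u w) * lincomb (2*g) u t"
proof -
  have "lincomb (2*g) w (transv g c u t)
      = lincomb (2*g) w t + (\<Sum>i<2*g. of_int (w i) * of_int (c * sympl_dual g u i)) * lincomb (2*g) u t"
    unfolding transv_def lincomb_def[of "2*g" w] by (simp add: algebra_simps sum.distrib sum_distrib_left)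
  also have "(\<Sum>i<2*g. of_int (w i) * of_int (c * sympl_dual g u i)) = (of_int (c * lincomb (2*g) w (sympl_dual g u)) :: 'a)"
    by (simp add: lincomb_int sum_distrib_left algebra_simps)
  finally show ?thesis by (simp add: lincomb_dual)
qed

section \<open>Generating tuples and their invariants under transvections\<close>

definition generates :: "nat \<Rightarrow> 'a::comm_ring_1 set \<Rightarrow> (nat \<Rightarrow> 'a) \<Rightarrow> bool" where
  "generates n L t \<longleftrightarrow> (\<forall>a. \<exists>u. a - lincomb n u t \<in> L)"

definition sympl_equiv :: "nat \<Rightarrow> 'a::comm_ring_1 set \<Rightarrow> (nat \<Rightarrow> 'a) \<Rightarrow> (nat \<Rightarrow> 'a) \<Rightarrow> bool" where
  "sympl_equiv g L t t' \<longleftrightarrow> (\<forall>N \<psi>1 \<psi>2. zchar N L \<psi>1 \<longrightarrow> zchar N L \<psi>2 \<longrightarrow>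
     [sympl g (\<lambda>i. \<psi>1 (t i)) (\<lambda>i. \<psi>2 (t i)) = sympl g (\<lambda>i. \<psi>1 (t' i)) (\<lambda>i. \<psi>2 (t' i))] (mod N))"

lemma generates_mono: "generates n L t \<Longrightarrow> L \<subseteq> L' \<Longrightarrow> generates n L' t"
  unfolding generates_def by blast

lemma sympl_equiv_mono: "sympl_equiv g L t t' \<Longrightarrow> L \<subseteq> L' \<Longrightarrow> sympl_equiv g L' t t'"
  unfolding sympl_equiv_def zchar_on_def by blast

lemma sympl_equiv_trans:
  "sympl_equiv g L t t' \<Longrightarrow> sympl_equiv g L t' t'' \<Longrightarrow> sympl_equiv g L t t''"
  unfolding sympl_equiv_def using cong_trans by blast

lemma sympl_equiv_sym: "sympl_equiv g L t t' \<Longrightarrow> sympl_equiv g L t' t"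
  unfolding sympl_equiv_def using cong_sym by blast

text \<open>The coefficient vector w of the old tuple becomes w + c <u,w> u for the new one, which
  is the inverse transvection applied to w; <u,u> = 0 makes the two corrections cancel.\<close>

lemma generates_transv:
  assumes "generates (2*g) L t" shows "generates (2*g) L (transv g c u t)"
  unfolding generates_def
proof
  fix a
  obtain w where w: "a - lincomb (2*g) w t \<in> L" using assms by (auto simp: generates_def)
  let ?w = "\<lambda>i. w i + (c * sympl g u w) * u i"
  have "sympl g u ?w = sympl g u w"
    by (simp add: sympl_add_right sympl_scale_right sympl_self)
  then have "lincomb (2*g) ?w (transv g c u t) = lincomb (2*g) w t"
    by (simp add: lincomb_transv lincomb_add lincomb_scale sympl_self)
  then show "\<exists>w. a - lincomb (2*g) w (transv g c u t) \<in> L" using w by metis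
qed

lemma zchar_add: "zchar N L \<psi> \<Longrightarrow> [\<psi> (a + b) = \<psi> a + \<psi> b] (mod N)" for \<psi> :: "'a::comm_ring_1 \<Rightarrow> int"
  by (simp add: zchar_on_add)

lemma zchar_of_int: "zchar N L \<psi> \<Longrightarrow> [\<psi> (of_int n * a) = n * \<psi> a] (mod N)" for \<psi> :: "'a::comm_ring_1 \<Rightarrow> int"
  using zchar_on_of_int[OF zsub_UNIV] by blast

lemma zchar_lincomb:
  fixes \<psi> :: "'a::comm_ring_1 \<Rightarrow> int"
  assumes ch: "zchar N L \<psi>" shows "[\<psi> (lincomb n u t) = lincomb n u (\<lambda>i. \<psi> (t i))] (mod N)"
proof (induction n)
  case 0 then show ?case using zchar_on_zero[OF zsub_UNIV ch] by (simp add: lincomb_def)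
next
  case (Suc n)
  have "[\<psi> (lincomb n u t + of_int (u n) * t n) = \<psi> (lincomb n u t) + \<psi> (of_int (u n) * t n)] (mod N)"
    by (rule zchar_add[OF ch])
  also have "[\<psi> (lincomb n u t) + \<psi> (of_int (u n) * t n)
      = lincomb n u (\<lambda>i. \<psi> (t i)) + u n * \<psi> (t n)] (mod N)"
    by (intro cong_add Suc zchar_of_int[OF ch])
  finally show ?case by (simp add: lincomb_def)
qed

lemma zchar_transv:
  fixes \<psi> :: "'a::comm_ring_1 \<Rightarrow> int"
  assumes ch: "zchar N L \<psi>"
  shows "[\<psi> (transv g c u t j) = transv g c u (\<lambda>i. \<psi> (t i)) j] (mod N)"
proof -
  have "[\<psi> (transv g c u t j) = \<psi> (t j) + \<psi> (of_int (c * sympl_dual g u j) * lincomb (2*g) u t)] (mod N)"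
    unfolding transv_def by (rule zchar_add[OF ch])
  also have "[\<psi> (t j) + \<psi> (of_int (c * sympl_dual g u j) * lincomb (2*g) u t) =
      \<psi> (t j) + c * sympl_dual g u j * \<psi> (lincomb (2*g) u t)] (mod N)"
    by (intro cong_add cong_refl zchar_of_int[OF ch])
  also have "[\<psi> (t j) + c * sympl_dual g u j * \<psi> (lincomb (2*g) u t)
     = \<psi> (t j) + c * sympl_dual g u j * lincomb (2*g) u (\<lambda>i. \<psi> (t i))] (mod N)"
    by (intro cong_add cong_mult cong_refl zchar_lincomb[OF ch])
  finally show ?thesis by (simp add: transv_def)
qed

lemma sympl_equiv_transv: "sympl_equiv g L (transv g c u t) t"
  unfolding sympl_equiv_def
proof (intro allI impI)
  fix N \<psi>1 \<psi>2 assume c1: "zchar N L \<psi>1" and c2: "zchar N L \<psi>2"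
  have "[sympl g (\<lambda>i. \<psi>1 (transv g c u t i)) (\<lambda>i. \<psi>2 (transv g c u t i)) =
     sympl g (transv g c u (\<lambda>i. \<psi>1 (t i))) (transv g c u (\<lambda>i. \<psi>2 (t i)))] (mod N)"
    by (rule sympl_cong) (auto intro: zchar_transv c1 c2)
  then show "[sympl g (\<lambda>i. \<psi>1 (transv g c u t i)) (\<lambda>i. \<psi>2 (transv g c u t i)) =
     sympl g (\<lambda>i. \<psi>1 (t i)) (\<lambda>i. \<psi>2 (t i))] (mod N)"
    by (simp add: sympl_transv)
qed

lemma transv_reach_invariant:
  assumes "transv_reach g t t'" "generates (2*g) L t"
  shows "generates (2*g) L t' \<and> sympl_equiv g L t' t"
  using assms(1) unfolding transv_reach_def
proof (induction rule: rtranclp_induct)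
  case base then show ?case using assms(2) by (simp add: sympl_equiv_def)
next
  case (step y z) then show ?case using generates_transv sympl_equiv_transv sympl_equiv_trans by blast
qed

lemma transv_reach_step: "transv_reach g t t' \<Longrightarrow> transv_reach g t (transv g c u t')"
  unfolding transv_reach_def by (rule rtranclp.rtrancl_into_rtrancl) auto

lemma sympl_dual_surj: "\<exists>f. \<forall>j<2*g. sympl_dual g f j = a j"
proof -
  have "\<forall>j<2*g. sympl_dual g (\<lambda>i. if i < g then - a (i + g) else a (i - g)) j = a j"
    by (auto simp: sympl_dual_def)
  then show ?thesis by blast
qed


text \<open>Put x = c v and N = c l. As x is not in L, v has order exactly N, so some \<psi>2 is 1
  at v and hence c at x. This suggests \<alpha> = \<psi>2 y. If z = c y - \<alpha> x had order m > 1
  modulo L, a \<psi>1 with value N/m at z would contradict the assumed identity, which forces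
  \<psi>1 z = 0 mod N.\<close>

lemma sympl_char_kernel:
  fixes L :: "'a::comm_ring_1 set" and l :: nat and c :: int
  assumes l: "prime l" and "finite R" and R: "\<And>a. \<exists>r\<in>R. a - r \<in> L" and L: "zsub L"
    and c: "c = int l ^ k" and N: "\<And>a. of_int (c * int l) * a \<in> L"
    and v: "of_int c * v \<notin> L"
    and eq: "\<And>\<psi>1 \<psi>2. zchar (c * int l) L \<psi>1 \<Longrightarrow> zchar (c * int l) L \<psi>2 \<Longrightarrow>
       [\<psi>1 (of_int c * v) * \<psi>2 y = \<psi>2 (of_int c * v) * \<psi>1 y] (mod (c * int l))"
  shows "\<exists>\<alpha>. of_int c * y - of_int \<alpha> * (of_int c * v) \<in> L"
proof -
  define N where "N = c * int l"
  have Npos: "N > 0" using l prime_gt_0_nat[OF l] by (simp add: N_def c)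
  have NL: "of_int N * a \<in> L" for a using N by (simp add: N_def)
  obtain m where m: "m > 0" "m dvd N" "of_int m * v \<in> L" "\<And>n. of_int n * v \<in> L \<Longrightarrow> m dvd n"
    using zsub_order[OF L NL Npos] by blast
  have "m = N"
  proof -
    have "nat m dvd l ^ Suc k"
    proof -
      have "int (nat m) dvd int (l ^ Suc k)" using m(1,2) by (simp add: N_def c mult.commute)
      then show ?thesis by (simp only: int_dvd_int_iff)
    qed
    then obtain i where i: "i \<le> Suc k" "nat m = l ^ i" using divides_primepow_nat[OF l] by blast
    have mi: "m = int l ^ i" using i(2) m(1) by (metis int_nat_eq less_imp_le of_nat_power)
    have "i = Suc k"
    proof (rule ccontr)
      assume "i \<noteq> Suc k"
      then have "m dvd c" unfolding c mi using i(1) by (intro le_imp_power_dvd) simp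
      then obtain j where "c = m * j" by blast
      then have "of_int c * v = of_int j * (of_int m * v)" by (simp add: algebra_simps)
      then show False using v m(3) zsub_of_int[OF L] by metis
    qed
    then show ?thesis using mi by (simp add: N_def c)
  qed
  then have mN: "of_int N * v \<in> L" "\<And>n. of_int n * v \<in> L \<Longrightarrow> N dvd n" using m by auto
  obtain \<psi>2 where c2: "zchar N L \<psi>2" "[\<psi>2 v = 1] (mod N)"
    using zchar_exists[OF \<open>finite R\<close> R L NL Npos mN, of 1] by auto
  let ?z = "of_int c * y - of_int (\<psi>2 y) * (of_int c * v)"
  have "?z \<in> L"
  proof (rule ccontr)
    assume z: "?z \<notin> L"
    obtain m where m: "m > 0" "m dvd N" "of_int m * ?z \<in> L" "\<And>n. of_int n * ?z \<in> L \<Longrightarrow> m dvd n"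
      using zsub_order[OF L NL Npos] by blast
    obtain s where s: "N = m * s" using m(2) by blast
    obtain \<psi>1 where c1: "zchar N L \<psi>1" "[\<psi>1 ?z = s] (mod N)"
      using zchar_exists[OF \<open>finite R\<close> R L NL Npos m(3,4), of s] s by auto
    have x1: "[\<psi>1 (of_int c * v) = c * \<psi>1 v] (mod N)" and x2: "[\<psi>2 (of_int c * v) = c * \<psi>2 v] (mod N)"
      by (rule zchar_of_int[OF c1(1)], rule zchar_of_int[OF c2(1)])
    have "[c * \<psi>1 v * \<psi>2 y = \<psi>1 (of_int c * v) * \<psi>2 y] (mod N)"
      by (intro cong_mult cong_refl cong_sym[OF x1])
    also have "[\<psi>1 (of_int c * v) * \<psi>2 y = \<psi>2 (of_int c * v) * \<psi>1 y] (mod N)"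
      using eq c1(1) c2(1) by (simp add: N_def)
    also have "[\<psi>2 (of_int c * v) * \<psi>1 y = c * \<psi>2 v * \<psi>1 y] (mod N)"
      by (intro cong_mult cong_refl x2)
    also have "[c * \<psi>2 v * \<psi>1 y = c * 1 * \<psi>1 y] (mod N)"
      by (intro cong_mult cong_refl c2(2))
    finally have e: "[c * \<psi>1 v * \<psi>2 y = c * \<psi>1 y] (mod N)" by simp
    have zz: "?z = of_int c * y + of_int (- \<psi>2 y * c) * v" by (simp add: algebra_simps)
    have "[\<psi>1 ?z = \<psi>1 (of_int c * y) + \<psi>1 (of_int (- \<psi>2 y * c) * v)] (mod N)"
      unfolding zz by (rule zchar_add[OF c1(1)])
    also have "[\<psi>1 (of_int c * y) + \<psi>1 (of_int (- \<psi>2 y * c) * v) = c * \<psi>1 y + (- \<psi>2 y * c) * \<psi>1 v] (mod N)"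
      by (intro cong_add zchar_of_int[OF c1(1)])
    also have "[c * \<psi>1 y + (- \<psi>2 y * c) * \<psi>1 v = c * \<psi>1 v * \<psi>2 y + (- \<psi>2 y * c) * \<psi>1 v] (mod N)"
      by (intro cong_add cong_sym[OF e] cong_refl)
    finally have "[\<psi>1 ?z = 0] (mod N)" by (simp add: algebra_simps)
    with c1(2) have "N dvd s" by (metis cong_0_iff cong_sym cong_trans)
    then have "m dvd 1" using s Npos by auto
    then have "m = 1" using m(1) by simp
    then show False using m(3) z by simp
  qed
  then show ?thesis by blast
qed

section \<open>Producing a prescribed correction by one or two transvections\<close>

lemma prime_inverse_mod:
  fixes l :: nat and a :: int
  assumes "prime l" "\<not> int l dvd a"
  obtains d k where "a * d - 1 = int l * k"
proof -
  have "coprime a (int l)"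
    using assms by (metis coprime_commute prime_imp_coprime prime_nat_int_transfer)
  then obtain d where "[a * d = 1] (mod int l)" using cong_solve_coprime_int by blast
  then show thesis using that by (auto simp: cong_iff_dvd_diff)
qed

text \<open>A transvection along f changes t by a multiple of f.t in the direction Jf. With
  coefficient c d, where d inverts \<alpha> mod l, that multiple is x modulo L, because l x lies in
  L.\<close>

lemma adjust_one_transv:
  fixes L :: "'a::comm_ring_1 set" and l :: nat
  assumes l: "prime l" and L: "zsub L" and lx: "of_int (int l) * x \<in> L"
    and y: "of_int c * lincomb (2*g) f t - of_int \<alpha> * x \<in> L" and \<alpha>: "\<not> int l dvd \<alpha>"
  shows "\<exists>c'. \<forall>j. transv g c' f t j - t j - of_int (sympl_dual g f j) * x \<in> L"
proof -
  obtain d k where k: "\<alpha> * d - 1 = int l * k" using prime_inverse_mod[OF l \<alpha>] by blast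
  have "transv g (c * d) f t j - t j - of_int (sympl_dual g f j) * x \<in> L" for j
  proof -
    let ?a = "sympl_dual g f j"
    have "transv g (c * d) f t j - t j - of_int ?a * x
      = of_int (d * ?a) * (of_int c * lincomb (2*g) f t - of_int \<alpha> * x) + of_int ?a * (of_int (\<alpha> * d - 1) * x)"
      by (simp add: transv_def algebra_simps)
    also have "of_int (\<alpha> * d - 1) * x = of_int k * (of_int (int l) * x)"
      unfolding k by (simp add: algebra_simps)
    finally have "transv g (c * d) f t j - t j - of_int ?a * x
      = of_int (d * ?a) * (of_int c * lincomb (2*g) f t - of_int \<alpha> * x) + of_int (?a * k) * (of_int (int l) * x)"
      by (simp add: algebra_simps)
    then show ?thesis by (simp only: zsub_add[OF L zsub_of_int[OF L y] zsub_of_int[OF L lx]])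
  qed
  then show ?thesis by blast
qed

text \<open>Since c (f.t) is in L, a transvection along f with coefficient divisible by c changes
  nothing modulo L. So x is brought in by a vector w with c (w.t) = x: the transvection along w + f
  adds J(w + f) x, and one along w removes Jw x again. After the first step c (w.t) has become (1 -
  c <f,w>) x, which is why this factor has to be invertible mod l.\<close>

lemma adjust_two_transv:
  fixes L :: "'a::comm_ring_1 set" and l :: nat
  assumes l: "prime l" and L: "zsub L" and lx: "of_int (int l) * x \<in> L"
    and y: "of_int c * lincomb (2*g) f t \<in> L" and w: "of_int c * lincomb (2*g) w t - x \<in> L"
    and u: "\<not> int l dvd 1 - c * sympl g f w"
  shows "\<exists>c1 c2 u1 u2. \<forall>j. transv g c2 u2 (transv g c1 u1 t) j - t j - of_int (sympl_dual g f j) * x \<in> L"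
proof -
  define s where "s = - sympl g f w"
  have "\<not> int l dvd 1 + c * s" using u by (simp add: s_def)
  then obtain d k where k: "(1 + c * s) * d - 1 = int l * k" using prime_inverse_mod[OF l] by blast
  define \<epsilon> where "\<epsilon> = of_int c * lincomb (2*g) w t - x"
  define \<eta> where "\<eta> = of_int c * lincomb (2*g) f t"
  have \<epsilon>: "\<epsilon> \<in> L" and \<eta>: "\<eta> \<in> L" using y w by (auto simp: \<epsilon>_def \<eta>_def)
  define t2 where "t2 = transv g c (\<lambda>i. w i + f i) t"
  have sd: "sympl_dual g (\<lambda>i. w i + f i) j = sympl_dual g w j + sympl_dual g f j" for j
    by (simp add: sympl_dual_def)
  have t2: "t2 j = t j + of_int (sympl_dual g w j + sympl_dual g f j) * (x + \<epsilon> + \<eta>)" for j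
    unfolding t2_def transv_def sd lincomb_add \<epsilon>_def \<eta>_def by (simp add: algebra_simps)
  have "lincomb (2*g) w t2 = lincomb (2*g) w t + of_int (c * s) * (lincomb (2*g) w t + lincomb (2*g) f t)"
    unfolding t2_def lincomb_transv sympl_add_left sympl_self lincomb_add s_def by simp
  then have "of_int c * lincomb (2*g) w t2 = of_int c * lincomb (2*g) w t
      + of_int (c * s) * (of_int c * lincomb (2*g) w t + of_int c * lincomb (2*g) f t)"
    by (simp add: algebra_simps)
  also have "of_int c * lincomb (2*g) w t = x + \<epsilon>" by (simp add: \<epsilon>_def)
  finally have lw: "of_int c * lincomb (2*g) w t2 = (x + \<epsilon>) + of_int (c * s) * (x + \<epsilon> + \<eta>)"
    by (simp add: \<eta>_def)
  have "transv g (- c * d) w t2 j - t j - of_int (sympl_dual g f j) * x \<in> L" for j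
  proof -
    let ?w = "sympl_dual g w j" and ?f = "sympl_dual g f j"
    have "transv g (- c * d) w t2 j = t2 j - of_int (d * ?w) * (of_int c * lincomb (2*g) w t2)"
      by (simp add: transv_def algebra_simps)
    also have "\<dots> - t j - of_int ?f * x = of_int (?w + ?f) * (\<epsilon> + \<eta>)
       - of_int (d * ?w) * (\<epsilon> + of_int (c * s) * (\<epsilon> + \<eta>)) - of_int (?w * ((1 + c * s) * d - 1)) * x"
      unfolding t2 lw by (simp add: algebra_simps)
    also have "of_int (?w * ((1 + c * s) * d - 1)) * x = of_int (?w * k) * (of_int (int l) * x)"
      unfolding k by (simp add: algebra_simps)
    also have "of_int (?w + ?f) * (\<epsilon> + \<eta>) - of_int (d * ?w) * (\<epsilon> + of_int (c * s) * (\<epsilon> + \<eta>)) - \<dots> \<in> L"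
      by (rule zsub_diff[OF L _ zsub_of_int[OF L lx]]) (intro zsub_diff[OF L] zsub_of_int[OF L] zsub_add[OF L] \<epsilon> \<eta>)
    finally show ?thesis .
  qed
  then show ?thesis unfolding t2_def by blast
qed

text \<open>If l divides c, any w with c (w.t) = x modulo L works. For c = 1 the first choice w0 may
  be blocked. Then generation by t' supplies z with z.t' = x, and since t' is t + x Jf, this means
  z.t = (1 - \<tau>) x with \<tau> = -<f,z>. Either a multiple of z or w0 + z avoids the forbidden
  congruence.\<close>

lemma adjust_choice:
  fixes L :: "'a::comm_ring_1 set" and l :: nat
  assumes l: "prime l" and L: "zsub L" and lx: "of_int (int l) * x \<in> L" and x: "x = of_int c * v"
    and c: "c = 1 \<or> int l dvd c" and t: "generates (2*g) L t" and t': "generates (2*g) L t'"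
    and tt': "\<And>j. j < 2*g \<Longrightarrow> t' j - t j - of_int (sympl_dual g f j) * x \<in> L"
  shows "\<exists>w. of_int c * lincomb (2*g) w t - x \<in> L \<and> \<not> int l dvd 1 - c * sympl g f w"
proof -
  have l1: "\<not> int l dvd 1" using l by (simp add: prime_nat_iff)
  obtain w0 where w0: "v - lincomb (2*g) w0 t \<in> L" using t by (auto simp: generates_def)
  have "of_int c * lincomb (2*g) w0 t - x = - (of_int c * (v - lincomb (2*g) w0 t))"
    by (simp add: x algebra_simps)
  then have w0c: "of_int c * lincomb (2*g) w0 t - x \<in> L"
    using zsub_uminus[OF L zsub_of_int[OF L w0, of c]] by simp
  show ?thesis
  proof (cases "int l dvd 1 - c * sympl g f w0")
    case False then show ?thesis using w0c by blast
  next
    case True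
    have c1: "c = 1"
    proof (rule ccontr)
      assume "c \<noteq> 1"
      then have "int l dvd c * sympl g f w0" using c by auto
      with True have "int l dvd (1 - c * sympl g f w0) + c * sympl g f w0" by (rule dvd_add)
      then show False using l1 by simp
    qed
    obtain z where z: "x - lincomb (2*g) z t' \<in> L" using t' by (auto simp: generates_def)
    define \<tau> where "\<tau> = - sympl g f z"
    have \<tau>: "\<tau> = lincomb (2*g) z (sympl_dual g f)" by (simp add: \<tau>_def lincomb_dual)
    have "lincomb (2*g) z t' - lincomb (2*g) z t - of_int \<tau> * x
        = (\<Sum>j<2*g. of_int (z j) * (t' j - t j - of_int (sympl_dual g f j) * x))"
      unfolding \<tau> lincomb_int by (simp add: lincomb_def sum_subtractf right_diff_distrib sum_distrib_right mult.assoc)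
    also have "\<dots> \<in> L" by (intro zsub_sum[OF L] zsub_of_int[OF L] tt') auto
    finally have "lincomb (2*g) z t' - lincomb (2*g) z t - of_int \<tau> * x \<in> L" .
    from zsub_uminus[OF L zsub_add[OF L z this]]
    have zt: "lincomb (2*g) z t - of_int (1 - \<tau>) * x \<in> L" by (simp add: algebra_simps)
    show ?thesis
    proof (cases "int l dvd 1 - \<tau>")
      case False
      then obtain r k where k: "(1 - \<tau>) * r - 1 = int l * k" using prime_inverse_mod[OF l] by blast
      have "lincomb (2*g) (\<lambda>i. r * z i) t - x = of_int r * (lincomb (2*g) z t - of_int (1 - \<tau>) * x)
         + of_int ((1 - \<tau>) * r - 1) * x" by (simp add: lincomb_scale algebra_simps)
      also have "of_int ((1 - \<tau>) * r - 1) * x = of_int k * (of_int (int l) * x)"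
        unfolding k by (simp add: algebra_simps)
      also have "of_int r * (lincomb (2*g) z t - of_int (1 - \<tau>) * x) + \<dots> \<in> L"
        by (rule zsub_add[OF L zsub_of_int[OF L zt] zsub_of_int[OF L lx]])
      finally have A: "lincomb (2*g) (\<lambda>i. r * z i) t - x \<in> L" .
      \<comment> \<open>From (1 - \<tau>) r = 1 mod l it follows that 1 + r \<tau> = r mod l, and r
        is a unit.\<close>
      have "\<not> int l dvd 1 + r * \<tau>"
      proof
        assume "int l dvd 1 + r * \<tau>"
        moreover have "r = (1 + r * \<tau>) + int l * k" using k by (simp add: algebra_simps)
        ultimately have "int l dvd r" by (metis dvd_add dvd_triv_left)
        then have "int l dvd (1 - \<tau>) * r - int l * k" by simp
        then show False using k l1 by (metis add_diff_cancel_left' diff_add_cancel)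
      qed
      then show ?thesis using A c1 by (intro exI[of _ "\<lambda>i. r * z i"]) (simp add: sympl_scale_right \<tau>_def)
    next
      case True': True
      then obtain k where k: "1 - \<tau> = int l * k" by blast
      have "lincomb (2*g) (\<lambda>i. w0 i + z i) t - x
        = (of_int c * lincomb (2*g) w0 t - x) + (lincomb (2*g) z t - of_int (1 - \<tau>) * x) + of_int k * (of_int (int l) * x)"
        unfolding k c1 by (simp add: lincomb_add algebra_simps)
      also have "\<dots> \<in> L" by (rule zsub_add[OF L zsub_add[OF L w0c zt] zsub_of_int[OF L lx]])
      finally have A: "lincomb (2*g) (\<lambda>i. w0 i + z i) t - x \<in> L" .
      \<comment> \<open>Modulo l, 1 - <f,w0> is 0 and \<tau> is 1, so the expression is 1.\<close>
      have "\<not> int l dvd 1 - sympl g f w0 + \<tau>"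
      proof
        assume a: "int l dvd 1 - sympl g f w0 + \<tau>"
        have "int l dvd (1 - sympl g f w0 + \<tau>) - (1 - sympl g f w0) + (1 - \<tau>)"
          by (rule dvd_add[OF dvd_diff[OF a] True']) (use True c1 in simp)
        then show False using l1 by simp
      qed
      then show ?thesis using A c1
        by (intro exI[of _ "\<lambda>i. w0 i + z i"]) (simp add: sympl_add_right \<tau>_def algebra_simps)
    qed
  qed
qed

text \<open>Induction over the index of L. If L' is obtained from L by adjoining an element x = c v of order l,
  where v has maximal order modulo L, two tuples agreeing modulo L' differ by multiples a_j x. Writing
  a = Jf, equality of the symplectic invariants forces c (sum f_i t_i) to be a multiple of x modulo L, and then
  one or two transvections produce the difference.\<close>
lemma transv_transitive:
  fixes l :: nat and t t' :: "nat \<Rightarrow> 'a::comm_ring_1"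
  assumes l: "prime l" and fin: "finite R"
  shows "zsub L \<Longrightarrow> (\<And>a. \<exists>r\<in>R. a - r \<in> L) \<Longrightarrow> \<exists>b. \<forall>a. of_int (int l ^ b) * a \<in> L \<Longrightarrow>
    generates (2*g) L t \<Longrightarrow> generates (2*g) L t' \<Longrightarrow> sympl_equiv g L t t' \<Longrightarrow>
    \<exists>t''. transv_reach g t t'' \<and> (\<forall>j<2*g. t'' j - t' j \<in> L)"
proof (induction "card (R - L)" arbitrary: L rule: less_induct)
  case less
  note L = less.prems(1) and R = less.prems(2) and gt = less.prems(4) and gt' = less.prems(5)
    and eqv = less.prems(6)
  show ?case
  proof (cases "L = UNIV")
    case True then show ?thesis by (intro exI[of _ t]) (simp add: transv_reach_def)
  next
    case False
    define b where "b = (LEAST b. \<forall>a. of_int (int l ^ b) * a \<in> L)"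
    have b: "\<forall>a. of_int (int l ^ b) * a \<in> L"
      unfolding b_def using less.prems(3) by (rule LeastI_ex)
    have "b \<noteq> 0"
    proof
      assume "b = 0"
      then have "a \<in> L" for a using b[rule_format, of a] by simp
      then show False using False by blast
    qed
    then obtain k where k: "b = Suc k" using not0_implies_Suc by blast
    have "\<not> (\<forall>a. of_int (int l ^ k) * a \<in> L)"
      using not_less_Least[of k "\<lambda>b. \<forall>a. of_int (int l ^ b) * a \<in> L"] k b_def by simp
    then obtain v where v: "of_int (int l ^ k) * v \<notin> L" by blast
    define c where "c = int l ^ k"
    define x where "x = of_int c * v"
    have xL: "x \<notin> L" using v by (simp add: x_def c_def)
    have N: "of_int (c * int l) * a \<in> L" for a using b by (simp add: k c_def mult.commute)
    have lx: "of_int (int l) * x \<in> L" using N[of v] by (simp add: x_def algebra_simps)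
    let ?L' = "zspan1 L x"
    have LL': "L \<subseteq> ?L'" using zspan1_base by blast
    \<comment> \<open>The representative r of x lies outside L but inside the enlarged subgroup, so
      the induction measure drops.\<close>
    obtain r where r: "r \<in> R" "x - r \<in> L" using R by blast
    have rL: "r \<notin> L" using r(2) xL zsub_add[OF L, of "x - r" r] by auto
    have rL': "r \<in> ?L'"
      using r LL' zsub_diff[OF zsub_zspan1[OF L, of x] zspan1_gen[OF L, of x], of "x - r"] by auto
    have "card (R - ?L') < card (R - L)"
      by (rule psubset_card_mono) (use rL rL' r LL' fin in auto)
    then have "\<exists>t1. transv_reach g t t1 \<and> (\<forall>j<2*g. t1 j - t' j \<in> ?L')"
    proof (rule less.hyps)
      show "zsub ?L'" by (rule zsub_zspan1[OF L])
      show "\<exists>r\<in>R. a - r \<in> ?L'" for a using R[of a] LL' by blast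
      show "\<exists>b. \<forall>a. of_int (int l ^ b) * a \<in> ?L'" using less.prems(3) LL' by blast
      show "generates (2*g) ?L' t" "generates (2*g) ?L' t'" "sympl_equiv g ?L' t t'"
        using generates_mono[OF gt LL'] generates_mono[OF gt' LL'] sympl_equiv_mono[OF eqv LL'] by auto
    qed
    then obtain t1 where t1: "transv_reach g t t1" "\<forall>j<2*g. t1 j - t' j \<in> ?L'" by blast
    have gt1: "generates (2*g) L t1" and eq1: "sympl_equiv g L t' t1"
      using transv_reach_invariant[OF t1(1) gt] eqv sympl_equiv_trans sympl_equiv_sym by blast+
    have "\<forall>j. \<exists>a. j < 2*g \<longrightarrow> t' j - t1 j - of_int a * x \<in> L"
    proof
      fix j show "\<exists>a. j < 2*g \<longrightarrow> t' j - t1 j - of_int a * x \<in> L"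
      proof (cases "j < 2*g")
        case True
        then obtain k n where "t1 j - t' j = k + of_int n * x" "k \<in> L"
          using t1(2) by (auto simp: zspan1_def)
        then have "t' j - t1 j - of_int (- n) * x = - k" by (simp add: algebra_simps)
        then show ?thesis using zsub_uminus[OF L \<open>k \<in> L\<close>] by metis
      qed auto
    qed
    then obtain a where a: "\<And>j. j < 2*g \<Longrightarrow> t' j - t1 j - of_int (a j) * x \<in> L" by metis
    obtain f where f: "\<And>j. j < 2*g \<Longrightarrow> sympl_dual g f j = a j" using sympl_dual_surj[of g a] by blast
    have t': "t' j - t1 j - of_int (sympl_dual g f j) * x \<in> L" if "j < 2*g" for j
      using a f that by simp
    define y where "y = lincomb (2*g) f t1"
    have "\<exists>\<alpha>. of_int c * y - of_int \<alpha> * (of_int c * v) \<in> L"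
    proof (rule sympl_char_kernel[OF l fin R L c_def N])
      show "of_int c * v \<notin> L" using xL by (simp add: x_def)
      fix \<psi>1 \<psi>2 assume c1: "zchar (c * int l) L \<psi>1" and c2: "zchar (c * int l) L \<psi>2"
      let ?N = "c * int l"
      let ?f = "sympl_dual g f"
      have tj: "[\<psi> (t' j) = \<psi> (t1 j) + \<psi> x * ?f j] (mod ?N)" if ch: "zchar ?N L \<psi>" and j: "j < 2*g" for \<psi> j
      proof -
        have e: "t' j = (t1 j + of_int (?f j) * x) + (t' j - t1 j - of_int (?f j) * x)" by simp
        have "[\<psi> (t' j) = \<psi> (t1 j + of_int (?f j) * x) + \<psi> (t' j - t1 j - of_int (?f j) * x)] (mod ?N)"
          by (subst e) (rule zchar_add[OF ch])
        also have "[\<psi> (t1 j + of_int (?f j) * x) + \<psi> (t' j - t1 j - of_int (?f j) * x) =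
            (\<psi> (t1 j) + \<psi> (of_int (?f j) * x)) + 0] (mod ?N)"
          by (intro cong_add zchar_add[OF ch] zchar_on_vanish[OF ch] t' j)
        also have "[(\<psi> (t1 j) + \<psi> (of_int (?f j) * x)) + 0 = (\<psi> (t1 j) + ?f j * \<psi> x) + 0] (mod ?N)"
          by (intro cong_add cong_refl zchar_of_int[OF ch])
        finally show ?thesis by (simp add: mult.commute)
      qed
      let ?p = "\<lambda>i. \<psi>1 (t1 i)" and ?r = "\<lambda>i. \<psi>2 (t1 i)"
      have "[sympl g (\<lambda>i. \<psi>1 (t' i)) (\<lambda>i. \<psi>2 (t' i))
         = sympl g (\<lambda>i. ?p i + \<psi>1 x * ?f i) (\<lambda>i. ?r i + \<psi>2 x * ?f i)] (mod ?N)"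
        by (intro sympl_cong tj c1 c2)
      \<comment> \<open>Both image tuples move by multiples of Jf. As Jf is isotropic, the form
        changes by the 2 by 2 determinant of the values of \<psi>1 and \<psi>2 at x and at y = f.t1,
        up to congruence. Equality of the invariants makes this determinant vanish mod c l.\<close>
      also have "sympl g (\<lambda>i. ?p i + \<psi>1 x * ?f i) (\<lambda>i. ?r i + \<psi>2 x * ?f i)
         = sympl g ?p ?r + (\<psi>1 x * lincomb (2*g) f ?r - \<psi>2 x * lincomb (2*g) f ?p)"
        by (simp add: sympl_add_left sympl_add_right sympl_scale_left sympl_scale_right
            sympl_dual_left sympl_dual_right sympl_self)
      finally have "[sympl g (\<lambda>i. \<psi>1 (t' i)) (\<lambda>i. \<psi>2 (t' i)) =
        sympl g ?p ?r + (\<psi>1 x * lincomb (2*g) f ?r - \<psi>2 x * lincomb (2*g) f ?p)] (mod ?N)" .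
      moreover have "[sympl g ?p ?r = sympl g (\<lambda>i. \<psi>1 (t' i)) (\<lambda>i. \<psi>2 (t' i))] (mod ?N)"
        by (rule cong_sym) (use eq1 c1 c2 in \<open>auto simp: sympl_equiv_def\<close>)
      ultimately have "[sympl g ?p ?r = sympl g ?p ?r + (\<psi>1 x * lincomb (2*g) f ?r - \<psi>2 x * lincomb (2*g) f ?p)] (mod ?N)"
        by (rule cong_trans[rotated])
      then have "[sympl g ?p ?r + 0 = sympl g ?p ?r + (\<psi>1 x * lincomb (2*g) f ?r - \<psi>2 x * lincomb (2*g) f ?p)] (mod ?N)"
        by simp
      then have "[0 = \<psi>1 x * lincomb (2*g) f ?r - \<psi>2 x * lincomb (2*g) f ?p] (mod ?N)"
        by (simp only: cong_add_lcancel)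
      then have e: "[\<psi>1 x * lincomb (2*g) f ?r = \<psi>2 x * lincomb (2*g) f ?p] (mod ?N)"
        by (metis cong_diff_iff_cong_0 cong_sym)
      have "[\<psi>1 x * \<psi>2 y = \<psi>1 x * lincomb (2*g) f ?r] (mod ?N)"
        unfolding y_def by (intro cong_mult cong_refl zchar_lincomb[OF c2])
      also note e
      also have "[\<psi>2 x * lincomb (2*g) f ?p = \<psi>2 x * \<psi>1 y] (mod ?N)"
        unfolding y_def by (intro cong_mult cong_refl cong_sym[OF zchar_lincomb[OF c1]])
      finally show "[\<psi>1 (of_int c * v) * \<psi>2 y = \<psi>2 (of_int c * v) * \<psi>1 y] (mod ?N)"
        by (simp add: x_def)
    qed
    then obtain \<alpha> where \<alpha>: "of_int c * y - of_int \<alpha> * x \<in> L" by (auto simp: x_def)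
    have "\<exists>t2. transv_reach g t t2 \<and> (\<forall>j. t2 j - t1 j - of_int (sympl_dual g f j) * x \<in> L)"
    proof (cases "int l dvd \<alpha>")
      case False
      then show ?thesis
        using adjust_one_transv[OF l L lx \<alpha>[unfolded y_def]] transv_reach_step[OF t1(1)] by blast
    next
      case True
      then obtain j where "\<alpha> = int l * j" by blast
      then have "of_int c * y = (of_int c * y - of_int \<alpha> * x) + of_int j * (of_int (int l) * x)"
        by (simp add: algebra_simps)
      then have cy: "of_int c * lincomb (2*g) f t1 \<in> L"
        unfolding y_def[symmetric] using \<alpha> lx by (metis zsub_add[OF L] zsub_of_int[OF L])
      \<comment> \<open>c = 1 means that the quotient by L has exponent l.\<close>
      have "c = 1 \<or> int l dvd c" by (cases k) (auto simp: c_def)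
      from adjust_choice[OF l L lx x_def this gt1 gt' t'] obtain w where
        "of_int c * lincomb (2*g) w t1 - x \<in> L" "\<not> int l dvd 1 - c * sympl g f w" by blast
      from adjust_two_transv[OF l L lx cy this] show ?thesis
        using transv_reach_step[OF transv_reach_step[OF t1(1)]] by blast
    qed
    then obtain t2 where t2: "transv_reach g t t2"
      "\<And>j. t2 j - t1 j - of_int (sympl_dual g f j) * x \<in> L" by blast
    have "t2 j - t' j \<in> L" if "j < 2*g" for j
      using zsub_diff[OF L t2(2)[of j] t'[OF that]] by simp
    then show ?thesis using t2(1) by blast
  qed
qed

section \<open>The exterior square\<close>

text \<open>Integer-valued functions form a commutative ring pointwise, so the calculus of
  \<open>zsub\<close> applies to \<open>fsums\<close> and \<open>wedge_rel\<close>; integer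
  multiples then appear as products with constant functions, which this rule evaluates.\<close>

lemma of_int_fun_apply [simp]: "(of_int c :: 'a \<Rightarrow> 'b::ring_1) x = of_int c"
proof -
  have *: "(of_nat n :: 'a \<Rightarrow> 'b) x = of_nat n" for n
    by (induction n) auto
  show ?thesis by (cases c) (simp_all add: * del: of_nat_Suc)
qed

lemma sum_fun_apply: "sum f A x = (\<Sum>a\<in>A. f a x)" for f :: "'i \<Rightarrow> 'a \<Rightarrow> 'b::comm_monoid_add"
  by (induction A rule: infinite_finite_induct) auto

text \<open>Multiplicative counterpart of \<open>lincomb\<close>: a row t of group elements times an
  integer column v. An l-adic column enters through its residues at one level.\<close>

primrec gcomb :: "('a, 'b) monoid_scheme \<Rightarrow> nat \<Rightarrow> (nat \<Rightarrow> 'a) \<Rightarrow> (nat \<Rightarrow> int) \<Rightarrow> 'a" where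
  "gcomb H 0 t v = \<one>\<^bsub>H\<^esub>"
| "gcomb H (Suc n) t v = gcomb H n t v \<otimes>\<^bsub>H\<^esub> t n [^]\<^bsub>H\<^esub> v n"

lemma gcomb_cong:
  "(\<And>i. i < n \<Longrightarrow> t i = t' i) \<Longrightarrow> (\<And>i. i < n \<Longrightarrow> v i = v' i) \<Longrightarrow> gcomb H n t v = gcomb H n t' v'"
  by (induction n) auto

context comm_group
begin

lemma gcomb_closed: "(\<And>i. i < n \<Longrightarrow> t i \<in> carrier G) \<Longrightarrow> gcomb G n t v \<in> carrier G"
  by (induction n) auto

lemma gcomb_add: "(\<And>i. i < n \<Longrightarrow> t i \<in> carrier G) \<Longrightarrow>
    gcomb G n t (\<lambda>i. v i + w i) = gcomb G n t v \<otimes> gcomb G n t w"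
proof (induction n)
  case (Suc n)
  have c: "gcomb G n t v \<in> carrier G" "gcomb G n t w \<in> carrier G" "t n [^] v n \<in> carrier G" "t n [^] w n \<in> carrier G"
    using Suc.prems by (auto intro: gcomb_closed)
  show ?case using Suc c by (simp add: int_pow_mult m_ac)
qed simp

lemma gcomb_scale: "(\<And>i. i < n \<Longrightarrow> t i \<in> carrier G) \<Longrightarrow>
    gcomb G n t (\<lambda>i. c * v i) = gcomb G n t v [^] c"
proof (induction n)
  case (Suc n)
  then show ?case by (simp add: int_pow_distrib gcomb_closed int_pow_pow mult.commute)
qed simp

lemma gcomb_zero: "gcomb G n t (\<lambda>_. 0) = \<one>"
  by (induction n) auto

lemma gcomb_delta: "(\<And>i. i < n \<Longrightarrow> t i \<in> carrier G) \<Longrightarrow> j < n \<Longrightarrow>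
    gcomb G n t (\<lambda>i. if i = j then a else 0) = t j [^] a"
proof (induction n)
  case (Suc n)
  show ?case
  proof (cases "j = n")
    case True
    have "gcomb G n t (\<lambda>i. if i = j then a else 0) = gcomb G n t (\<lambda>_. 0)"
      using True by (intro gcomb_cong) auto
    then show ?thesis using True Suc.prems by (simp add: gcomb_zero)
  next
    case False
    then show ?thesis using Suc by simp
  qed
qed simp

text \<open>Associativity t (A v) = (t A) v of the action on rows, where t A is formed from the
  columns of A. All later computations with matrices acting on tuples rest on it.\<close>

lemma gcomb_compose:
  assumes t: "\<And>i. i < n \<Longrightarrow> t i \<in> carrier G"
  shows "gcomb G n t (\<lambda>i. \<Sum>r<m. A i r * v r) = gcomb G m (\<lambda>r. gcomb G n t (\<lambda>i. A i r)) v"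
proof (induction m)
  case 0 then show ?case by (simp add: gcomb_zero)
next
  case (Suc m)
  have "gcomb G n t (\<lambda>i. \<Sum>r<Suc m. A i r * v r) =
     gcomb G n t (\<lambda>i. \<Sum>r<m. A i r * v r) \<otimes> gcomb G n t (\<lambda>i. v m * A i m)"
    using t by (subst gcomb_add[symmetric]) (auto simp: mult.commute)
  then show ?case using Suc t by (simp add: gcomb_scale)
qed

lemma gcomb_hom:
  assumes "h \<in> hom G H" "group H" "\<And>i. i < n \<Longrightarrow> t i \<in> carrier G"
  shows "h (gcomb G n t v) = gcomb H n (\<lambda>i. h (t i)) v"
  using assms(3)
proof (induction n)
  case 0 then show ?case using hom_one[OF assms(1) is_group assms(2)] by simp
next
  case (Suc n)
  then show ?case using hom_mult[OF assms(1)] hom_int_pow[OF assms(1) _ is_group assms(2)]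
    by (simp add: gcomb_closed)
qed

lemma int_pow_cong_mod:
  assumes "x \<in> carrier G" "x [^] (N::int) = \<one>" "[a = b] (mod N)"
  shows "x [^] a = x [^] b"
proof -
  obtain k where k: "a = b + N * k" using assms(3) by (metis cong_iff_lin cong_sym)
  then show ?thesis using assms by (simp add: int_pow_mult int_pow_pow[symmetric])
qed

text \<open>As N kills the group, exponents matter only mod N. This lets matrices and vectors given
  by residues mod l^k act on tuples.\<close>

lemma gcomb_cong_mod:
  assumes "\<And>x. x \<in> carrier G \<Longrightarrow> x [^] (N::int) = \<one>"
    and "\<And>i. i < n \<Longrightarrow> t i \<in> carrier G" "\<And>i. i < n \<Longrightarrow> [v i = w i] (mod N)"
  shows "gcomb G n t v = gcomb G n t w"
  using assms(2,3)
proof (induction n)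
  case (Suc n)
  then have "t n [^] v n = t n [^] w n"
    by (intro int_pow_cong_mod[OF _ assms(1)]) auto
  then show ?case using Suc by simp
qed simp

end

definition gtransv :: "('a, 'b) monoid_scheme \<Rightarrow> nat \<Rightarrow> int \<Rightarrow> (nat \<Rightarrow> int) \<Rightarrow> (nat \<Rightarrow> 'a) \<Rightarrow> nat \<Rightarrow> 'a" where
  "gtransv H g c u t = (\<lambda>j. t j \<otimes>\<^bsub>H\<^esub> gcomb H (2*g) t u [^]\<^bsub>H\<^esub> (c * sympl_dual g u j))"

section \<open>Formal sums, wedge relations and functoriality of the exterior square\<close>

abbreviation tup_wedge :: "nat \<Rightarrow> (nat \<Rightarrow> 'a) \<Rightarrow> 'a \<times> 'a \<Rightarrow> int" where
  "tup_wedge g t \<equiv> \<Sum>i<g. fs_single (t i) (t (g + i))"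

lemma wedge_rel_zsub: "zsub (wedge_rel H)"
proof -
  have "a - b \<in> wedge_rel H" if "a \<in> wedge_rel H" "b \<in> wedge_rel H" for a b
    using wr_add[OF that(1) wr_neg[OF that(2)]] by (simp add: fun_diff_def)
  then show ?thesis using wr_zero[of H] by (simp add: zsub_def zero_fun_def)
qed

lemma fsums_zsub: "zsub (fsums H)"
proof -
  have "a - b \<in> fsums H" if "a \<in> fsums H" "b \<in> fsums H" for a b
  proof -
    have "{p. (a - b) p \<noteq> 0} \<subseteq> {p. a p \<noteq> 0} \<union> {p. b p \<noteq> 0}" by auto
    then have "finite {p. (a - b) p \<noteq> 0}"
      using that by (auto simp: fsums_def intro: finite_subset)
    moreover have "p \<in> carrier H \<times> carrier H" if "(a - b) p \<noteq> 0" for p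
    proof -
      have "a p \<noteq> 0 \<or> b p \<noteq> 0" using that by auto
      then show ?thesis using \<open>a \<in> fsums H\<close> \<open>b \<in> fsums H\<close> unfolding fsums_def by blast
    qed
    ultimately show ?thesis unfolding fsums_def by blast
  qed
  moreover have "0 \<in> fsums H" by (simp add: fsums_def)
  ultimately show ?thesis by (simp add: zsub_def)
qed

lemma fs_single_fsums: "x \<in> carrier H \<Longrightarrow> y \<in> carrier H \<Longrightarrow> fs_single x y \<in> fsums H"
  by (auto simp: fsums_def fs_single_def split: if_splits)

lemma tup_wedge_fsums:
  assumes "\<And>i. i < 2*g \<Longrightarrow> t i \<in> carrier H" shows "tup_wedge g t \<in> fsums H"
  by (rule zsub_sum[OF fsums_zsub]) (use assms in \<open>auto intro!: fs_single_fsums\<close>)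

lemma wedge_left: "x \<in> carrier H \<Longrightarrow> y \<in> carrier H \<Longrightarrow> z \<in> carrier H \<Longrightarrow>
    fs_single (x \<otimes>\<^bsub>H\<^esub> y) z - fs_single x z - fs_single y z \<in> wedge_rel H"
  using wr_left[of x H y z] by (simp add: fun_diff_def)

lemma wedge_right: "x \<in> carrier H \<Longrightarrow> y \<in> carrier H \<Longrightarrow> z \<in> carrier H \<Longrightarrow>
    fs_single x (y \<otimes>\<^bsub>H\<^esub> z) - fs_single x y - fs_single x z \<in> wedge_rel H"
  using wr_right[of x H y z] by (simp add: fun_diff_def)

text \<open>The induction rule in terms of pointwise ring operations, the form in which
  \<open>zsub\<close> and additivity of \<open>fs_map\<close> can be applied.\<close>

lemma wedge_rel_induct [consumes 1, case_names zero left right alt add neg]: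
  assumes "f \<in> wedge_rel H"
    and "P 0"
    and "\<And>x y z. x \<in> carrier H \<Longrightarrow> y \<in> carrier H \<Longrightarrow> z \<in> carrier H \<Longrightarrow>
      P (fs_single (x \<otimes>\<^bsub>H\<^esub> y) z - fs_single x z - fs_single y z)"
    and "\<And>x y z. x \<in> carrier H \<Longrightarrow> y \<in> carrier H \<Longrightarrow> z \<in> carrier H \<Longrightarrow>
      P (fs_single x (y \<otimes>\<^bsub>H\<^esub> z) - fs_single x y - fs_single x z)"
    and "\<And>x. x \<in> carrier H \<Longrightarrow> P (fs_single x x)"
    and "\<And>f h. P f \<Longrightarrow> P h \<Longrightarrow> P (f + h)"
    and "\<And>f. P f \<Longrightarrow> P (- f)"
  shows "P f"
  using assms(1)
proof (induction rule: wedge_rel.induct)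
  case wr_zero then show ?case using assms(2) by (simp add: zero_fun_def)
next
  case wr_left then show ?case using assms(3) by (simp add: fun_diff_def)
next
  case wr_right then show ?case using assms(4) by (simp add: fun_diff_def)
next
  case wr_alt then show ?case by (rule assms(5))
next
  case (wr_add f h) then show ?case using assms(6)[of f h] by (simp add: plus_fun_def)
next
  case (wr_neg f) then show ?case using assms(7)[of f] by (simp add: fun_Compl_def)
qed

text \<open>Rewriting the fibrewise sums as one sum over a finite set containing the support makes
  additivity visible. An infinite fibre sum would default to 0, hence the restriction of the next
  lemmas to \<open>fsums\<close>.\<close>

lemma fs_map_eq:
  assumes "finite A" "\<And>s. f s \<noteq> 0 \<Longrightarrow> s \<in> A"
  shows "fs_map \<phi> f = (\<Sum>s\<in>A. of_int (f s) * fs_single (\<phi> (fst s)) (\<phi> (snd s)))"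
proof
  fix p
  have "fs_map \<phi> f p = (\<Sum>s\<in>{s \<in> A. (\<phi> (fst s), \<phi> (snd s)) = p}. f s)"
    unfolding fs_map_def using assms by (intro sum.mono_neutral_left) auto
  also have "\<dots> = (\<Sum>s\<in>A. if (\<phi> (fst s), \<phi> (snd s)) = p then f s else 0)"
    using assms(1) by (simp add: sum.inter_filter)
  also have "\<dots> = (\<Sum>s\<in>A. of_int (f s) * fs_single (\<phi> (fst s)) (\<phi> (snd s))) p"
    by (auto simp: sum_fun_apply fs_single_def intro!: sum.cong)
  finally show "fs_map \<phi> f p = \<dots>" .
qed

lemma fs_map_add:
  assumes "f \<in> fsums H" "h \<in> fsums H" shows "fs_map \<phi> (f + h) = fs_map \<phi> f + fs_map \<phi> h"
proof -
  let ?A = "{p. f p \<noteq> 0} \<union> {p. h p \<noteq> 0}"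
  have "finite ?A" using assms by (auto simp: fsums_def)
  then show ?thesis
    by (subst (1 2 3) fs_map_eq[of ?A]) (auto simp: sum.distrib[symmetric] algebra_simps)
qed

lemma fs_map_scale:
  assumes "f \<in> fsums H" shows "fs_map \<phi> (of_int c * f) = of_int c * fs_map \<phi> f"
proof -
  let ?A = "{p. f p \<noteq> 0}"
  have "finite ?A" using assms by (auto simp: fsums_def)
  then show ?thesis
    by (subst (1 2) fs_map_eq[of ?A]) (auto simp: sum_distrib_left algebra_simps)
qed

lemma fs_map_diff:
  assumes "f \<in> fsums H" "h \<in> fsums H" shows "fs_map \<phi> (f - h) = fs_map \<phi> f - fs_map \<phi> h"
proof -
  have "fs_map \<phi> (f + of_int (-1) * h) = fs_map \<phi> f + of_int (-1) * fs_map \<phi> h"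
    using assms by (simp only: fs_map_add[OF _ zsub_of_int[OF fsums_zsub]] fs_map_scale)
  then show ?thesis by simp
qed

lemma fs_map_zero: "fs_map \<phi> 0 = 0"
  by (subst fs_map_eq[of "{}"]) auto

lemma fs_map_uminus:
  assumes "f \<in> fsums H" shows "fs_map \<phi> (- f) = - fs_map \<phi> f"
  using fs_map_diff[OF zsub_zero[OF fsums_zsub] assms] by (simp add: fs_map_zero)

lemma fs_map_single: "fs_map \<phi> (fs_single x y) = fs_single (\<phi> x) (\<phi> y)"
  by (subst fs_map_eq[of "{(x, y)}"]) (auto simp: fs_single_def split: if_splits)

lemma fs_map_sum:
  assumes "\<And>i. i \<in> I \<Longrightarrow> f i \<in> fsums H"
  shows "fs_map \<phi> (\<Sum>i\<in>I. f i) = (\<Sum>i\<in>I. fs_map \<phi> (f i))"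
  using assms
proof (induction I rule: infinite_finite_induct)
  case (insert i I)
  have "fs_map \<phi> (f i + sum f I) = fs_map \<phi> (f i) + fs_map \<phi> (sum f I)"
    by (rule fs_map_add[where H = H]) (use insert.prems in \<open>auto intro: zsub_sum[OF fsums_zsub]\<close>)
  moreover have "fs_map \<phi> (sum f I) = (\<Sum>i\<in>I. fs_map \<phi> (f i))"
    by (rule insert.IH) (use insert.prems in auto)
  ultimately show ?case unfolding sum.insert[OF insert(1,2)] by (simp only:)
next
  case (infinite I)
  show ?case unfolding sum.infinite[OF infinite(1)] by (rule fs_map_zero)
next
  case empty
  show ?case unfolding sum.empty by (rule fs_map_zero)
qed

lemma fs_map_tup_wedge:
  fixes H :: "('a, 'b) monoid_scheme"
  assumes "\<And>i. i < 2*g \<Longrightarrow> t i \<in> carrier H"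
  shows "fs_map \<phi> (tup_wedge g t) = tup_wedge g (\<lambda>i. \<phi> (t i))"
proof -
  have "fs_map \<phi> (tup_wedge g t) = (\<Sum>i<g. fs_map \<phi> (fs_single (t i) (t (g + i))))"
    by (rule fs_map_sum[where H = H]) (use assms in \<open>auto intro!: fs_single_fsums\<close>)
  then show ?thesis by (simp add: fs_map_single)
qed

lemma fs_map_fsums:
  fixes G :: "('a, 'b) monoid_scheme" and H :: "('c, 'd) monoid_scheme"
  assumes "f \<in> fsums G" "\<And>x. x \<in> carrier G \<Longrightarrow> \<phi> x \<in> carrier H"
  shows "fs_map \<phi> f \<in> fsums H"
proof -
  have "fs_map \<phi> f = (\<Sum>s\<in>{p. f p \<noteq> 0}. of_int (f s) * fs_single (\<phi> (fst s)) (\<phi> (snd s)))"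
    using assms(1) by (intro fs_map_eq) (auto simp: fsums_def)
  also have "\<dots> \<in> fsums H"
  proof (intro zsub_sum[OF fsums_zsub] zsub_of_int[OF fsums_zsub] fs_single_fsums assms(2))
    fix s assume "s \<in> {p. f p \<noteq> 0}"
    then have "s \<in> carrier G \<times> carrier G" using assms(1) unfolding fsums_def by blast
    then show "fst s \<in> carrier G" "snd s \<in> carrier G" by auto
  qed
  finally show ?thesis .
qed

lemma fs_map_inverse:
  fixes G :: "('a, 'b) monoid_scheme" and H :: "('c, 'd) monoid_scheme"
  assumes "f \<in> fsums G" "\<And>x. x \<in> carrier G \<Longrightarrow> \<phi> x \<in> carrier H" "\<And>x. x \<in> carrier G \<Longrightarrow> \<psi> (\<phi> x) = x"
  shows "fs_map \<psi> (fs_map \<phi> f) = f"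
proof -
  let ?A = "{p. f p \<noteq> 0}"
  have fin: "finite ?A" using assms(1) by (auto simp: fsums_def)
  have c: "fst s \<in> carrier G" "snd s \<in> carrier G" if "s \<in> ?A" for s
  proof -
    have "s \<in> carrier G \<times> carrier G" using assms(1) that unfolding fsums_def by blast
    then show "fst s \<in> carrier G" "snd s \<in> carrier G" by auto
  qed
  have "fs_map \<psi> (fs_map \<phi> f) = fs_map \<psi> (\<Sum>s\<in>?A. of_int (f s) * fs_single (\<phi> (fst s)) (\<phi> (snd s)))"
    using fin by (subst fs_map_eq[of ?A]) auto
  also have "\<dots> = (\<Sum>s\<in>?A. fs_map \<psi> (of_int (f s) * fs_single (\<phi> (fst s)) (\<phi> (snd s))))"
    by (rule fs_map_sum[where H = H]) (auto intro!: zsub_of_int fsums_zsub fs_single_fsums assms(2) c)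
  also have "\<dots> = (\<Sum>s\<in>?A. of_int (f s) * fs_single (fst s) (snd s))"
    by (rule sum.cong[OF refl], subst fs_map_scale[where H = H])
      (auto simp: fs_map_single assms(3) c intro!: fs_single_fsums assms(2) c)
  also have "\<dots> = fs_map (\<lambda>x. x) f" using fin by (subst fs_map_eq[of ?A]) auto
  also have "\<dots> = f"
  proof
    fix p
    have "{s. f s \<noteq> 0 \<and> (fst s, snd s) = p} = (if f p = 0 then {} else {p})" by auto
    then show "fs_map (\<lambda>x. x) f p = f p" by (simp add: fs_map_def)
  qed
  finally show ?thesis .
qed

text \<open>Membership in \<open>fsums\<close> is carried through the induction because additivity
  of \<open>fs_map\<close> is available only there. G is only assumed closed under multiplication,
  as the lemma also serves the cokernel, for which closure is what is established.\<close>

lemma fs_map_wedge_rel: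
  assumes f: "f \<in> wedge_rel G" and hom: "\<phi> \<in> hom G H"
    and cl: "\<And>x y. x \<in> carrier G \<Longrightarrow> y \<in> carrier G \<Longrightarrow> x \<otimes>\<^bsub>G\<^esub> y \<in> carrier G"
  shows "fs_map \<phi> f \<in> wedge_rel H"
proof -
  have c: "\<phi> x \<in> carrier H" if "x \<in> carrier G" for x using hom that by (auto simp: hom_def)
  have "f \<in> fsums G \<and> fs_map \<phi> f \<in> wedge_rel H"
    using f
  proof (induction rule: wedge_rel_induct)
    case zero then show ?case by (simp only: fs_map_zero zsub_zero[OF fsums_zsub] zsub_zero[OF wedge_rel_zsub])
  next
    case (left x y z)
    have s: "fs_single (x \<otimes>\<^bsub>G\<^esub> y) z \<in> fsums G" "fs_single x z \<in> fsums G" "fs_single y z \<in> fsums G"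
      using left cl by (auto intro!: fs_single_fsums)
    then have "fs_map \<phi> (fs_single (x \<otimes>\<^bsub>G\<^esub> y) z - fs_single x z - fs_single y z)
       = fs_single (\<phi> x \<otimes>\<^bsub>H\<^esub> \<phi> y) (\<phi> z) - fs_single (\<phi> x) (\<phi> z) - fs_single (\<phi> y) (\<phi> z)"
      using left by (simp add: fs_map_diff[where H = G] zsub_diff[OF fsums_zsub] fs_map_single hom_mult[OF hom])
    then show ?case
      using zsub_diff[OF fsums_zsub zsub_diff[OF fsums_zsub s(1,2)] s(3)] wedge_left[OF c c c, OF left] by (simp only:)
  next
    case (right x y z)
    have s: "fs_single x (y \<otimes>\<^bsub>G\<^esub> z) \<in> fsums G" "fs_single x z \<in> fsums G" "fs_single x y \<in> fsums G"
      using right cl by (auto intro!: fs_single_fsums)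
    then have "fs_map \<phi> (fs_single x (y \<otimes>\<^bsub>G\<^esub> z) - fs_single x y - fs_single x z)
       = fs_single (\<phi> x) (\<phi> y \<otimes>\<^bsub>H\<^esub> \<phi> z) - fs_single (\<phi> x) (\<phi> y) - fs_single (\<phi> x) (\<phi> z)"
      using right by (simp add: fs_map_diff[where H = G] zsub_diff[OF fsums_zsub] fs_map_single hom_mult[OF hom])
    then show ?case
      using zsub_diff[OF fsums_zsub zsub_diff[OF fsums_zsub s(1,3)] s(2)] wedge_right[OF c c c, OF right] by (simp only:)
  next
    case (alt x) then show ?case using c by (auto simp: fs_map_single intro!: fs_single_fsums wr_alt)
  next
    case (add f h) then show ?case
      using zsub_add[OF fsums_zsub, of f G h] zsub_add[OF wedge_rel_zsub, of "fs_map \<phi> f" H "fs_map \<phi> h"]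
        fs_map_add[of f G h \<phi>] by (simp only:)
  next
    case (neg f) then show ?case
      using zsub_uminus[OF fsums_zsub, of f G] zsub_uminus[OF wedge_rel_zsub, of "fs_map \<phi> f" H]
        fs_map_uminus[of f G \<phi>] by (simp only:)
  qed
  then show ?thesis by blast
qed

lemma wedge_class_self: "f \<in> fsums H \<Longrightarrow> f \<in> wedge_class H f"
  using zsub_zero[OF wedge_rel_zsub, of H] by (simp add: wedge_class_def zero_fun_def)

lemma wedge_class_mem: "f' \<in> wedge_class H f \<longleftrightarrow> f' \<in> fsums H \<and> f' - f \<in> wedge_rel H"
  by (simp add: wedge_class_def fun_diff_def)

lemma wedge_class_eq_iff:
  assumes "f \<in> fsums H"
  shows "wedge_class H f = wedge_class H h \<longleftrightarrow> f - h \<in> wedge_rel H"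
proof
  assume "wedge_class H f = wedge_class H h"
  then show "f - h \<in> wedge_rel H" using wedge_class_self[OF assms] wedge_class_mem by blast
next
  assume fh: "f - h \<in> wedge_rel H"
  have "x - f \<in> wedge_rel H \<longleftrightarrow> x - h \<in> wedge_rel H" for x
    using zsub_add[OF wedge_rel_zsub _ fh, of "x - f"] zsub_diff[OF wedge_rel_zsub _ fh, of "x - h"] by auto
  then show "wedge_class H f = wedge_class H h" by (auto simp: wedge_class_mem)
qed

text \<open>\<open>wedge_map\<close> picks its representative by SOME; as \<open>fs_map\<close>
  respects the relations, the resulting class does not depend on the choice.\<close>

lemma wedge_map_class:
  assumes hom: "\<phi> \<in> hom G H" and f: "f \<in> fsums G"
    and cl: "\<And>x y. x \<in> carrier G \<Longrightarrow> y \<in> carrier G \<Longrightarrow> x \<otimes>\<^bsub>G\<^esub> y \<in> carrier G"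
  shows "wedge_map G H \<phi> (wedge_class G f) = wedge_class H (fs_map \<phi> f)"
proof -
  define h where "h = (SOME h. h \<in> wedge_class G f)"
  have h: "h \<in> fsums G" "h - f \<in> wedge_rel G"
    using someI[of "\<lambda>h. h \<in> wedge_class G f", OF wedge_class_self[OF f]] by (auto simp: h_def wedge_class_mem)
  have c: "\<phi> x \<in> carrier H" if "x \<in> carrier G" for x using hom that by (auto simp: hom_def)
  have "fs_map \<phi> h - fs_map \<phi> f \<in> wedge_rel H"
    using fs_map_wedge_rel[OF h(2) hom cl] by (simp add: fs_map_diff[OF h(1) f])
  then show ?thesis
    unfolding wedge_map_def h_def[symmetric] by (subst wedge_class_eq_iff) (auto intro: fs_map_fsums h c)
qed

lemma wedge_scale_class:
  assumes f: "f \<in> fsums H"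
  shows "wedge_scale H c (wedge_class H f) = wedge_class H (of_int c * f)"
proof -
  define h where "h = (SOME h. h \<in> wedge_class H f)"
  have h: "h \<in> fsums H" "h - f \<in> wedge_rel H"
    using someI[of "\<lambda>h. h \<in> wedge_class H f", OF wedge_class_self[OF f]] by (auto simp: h_def wedge_class_mem)
  have e: "(\<lambda>p. c * h p) = of_int c * h" by auto
  have "of_int c * h - of_int c * f = of_int c * (h - f)" by (simp add: algebra_simps)
  then have "of_int c * h - of_int c * f \<in> wedge_rel H"
    using zsub_of_int[OF wedge_rel_zsub h(2)] by metis
  then show ?thesis
    unfolding wedge_scale_def h_def[symmetric] e
    by (subst wedge_class_eq_iff) (auto intro: zsub_of_int[OF fsums_zsub] h)
qed

definition intJ :: "nat \<Rightarrow> nat \<Rightarrow> nat \<Rightarrow> int" where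
  "intJ g = (\<lambda>i j. if i < g \<and> j = i + g then 1 else if j < g \<and> i = j + g then -1 else 0)"

section \<open>Wedge sums of tuples and their behaviour under symplectic similitudes\<close>

context comm_group
begin

lemma additive_mod_int_pow:
  fixes \<phi> :: "'a \<Rightarrow> 'm::comm_ring_1"
  assumes R: "zsub R" and add: "\<And>x y. x \<in> carrier G \<Longrightarrow> y \<in> carrier G \<Longrightarrow> \<phi> (x \<otimes> y) - \<phi> x - \<phi> y \<in> R"
    and x: "x \<in> carrier G"
  shows "\<phi> (x [^] (a::int)) - of_int a * \<phi> x \<in> R"
proof -
  have one: "\<phi> \<one> \<in> R"
    using zsub_uminus[OF R add[of \<one> \<one>]] by simp
  have nat: "\<phi> (x [^] n) - of_nat n * \<phi> x \<in> R" for n :: nat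
  proof (induction n)
    case (Suc n)
    have "\<phi> (x [^] Suc n) - of_nat (Suc n) * \<phi> x
       = (\<phi> (x [^] n \<otimes> x) - \<phi> (x [^] n) - \<phi> x) + (\<phi> (x [^] n) - of_nat n * \<phi> x)"
      by (simp add: algebra_simps)
    also have "\<dots> \<in> R" using zsub_add[OF R add[of "x [^] n" x] Suc] x by simp
    finally show ?case .
  qed (use one in simp)
  show ?thesis
  proof (cases a)
    case (nonneg n) then show ?thesis using nat[of n] by (simp add: int_pow_int)
  next
    case (neg n)
    let ?n = "Suc n"
    have "x [^] a = inv (x [^] ?n)" using neg x by (metis int_pow_neg_int)
    moreover have "\<phi> (inv (x [^] ?n) \<otimes> x [^] ?n) - \<phi> (inv (x [^] ?n)) - \<phi> (x [^] ?n) \<in> R"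
      using x by (intro add) auto
    moreover have "inv (x [^] ?n) \<otimes> x [^] ?n = \<one>" using x by (intro l_inv) auto
    ultimately have "\<phi> \<one> - \<phi> (x [^] a) - \<phi> (x [^] ?n) \<in> R" by simp
    from zsub_diff[OF R zsub_diff[OF R one this] nat[of ?n]]
    have "\<phi> (x [^] a) + of_nat ?n * \<phi> x \<in> R" by (simp del: of_nat_Suc nat_pow_Suc)
    moreover have "of_int a * \<phi> x = - (of_nat ?n * \<phi> x)"
      using neg by (metis minus_mult_left of_int_minus of_int_of_nat_eq)
    ultimately show ?thesis by simp
  qed
qed

lemma additive_mod_gcomb:
  fixes \<phi> :: "'a \<Rightarrow> 'm::comm_ring_1"
  assumes R: "zsub R" and add: "\<And>x y. x \<in> carrier G \<Longrightarrow> y \<in> carrier G \<Longrightarrow> \<phi> (x \<otimes> y) - \<phi> x - \<phi> y \<in> R"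
    and t: "\<And>i. i < n \<Longrightarrow> t i \<in> carrier G"
  shows "\<phi> (gcomb G n t v) - (\<Sum>i<n. of_int (v i) * \<phi> (t i)) \<in> R"
  using t
proof (induction n)
  case 0
  then show ?case using zsub_uminus[OF R add[of \<one> \<one>]] by simp
next
  case (Suc n)
  have c: "gcomb G n t v \<in> carrier G" "t n \<in> carrier G" using Suc.prems by (auto intro: gcomb_closed)
  have "\<phi> (gcomb G (Suc n) t v) - (\<Sum>i<Suc n. of_int (v i) * \<phi> (t i))
    = (\<phi> (gcomb G n t v \<otimes> t n [^] v n) - \<phi> (gcomb G n t v) - \<phi> (t n [^] v n))
      + (\<phi> (gcomb G n t v) - (\<Sum>i<n. of_int (v i) * \<phi> (t i))) + (\<phi> (t n [^] v n) - of_int (v n) * \<phi> (t n))"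
    by (simp add: algebra_simps)
  also have "\<dots> \<in> R"
    using c Suc by (intro zsub_add[OF R] add additive_mod_int_pow[OF R add]) auto
  finally show ?case .
qed

lemma wedge_gcomb:
  assumes t: "\<And>i. i < n \<Longrightarrow> t i \<in> carrier G"
  shows "fs_single (gcomb G n t v) (gcomb G n t w)
    - (\<Sum>a<n. \<Sum>b<n. of_int (v a * w b) * fs_single (t a) (t b)) \<in> wedge_rel G"
proof -
  note W = wedge_rel_zsub[of G]
  let ?y = "gcomb G n t w"
  have y: "?y \<in> carrier G" using t by (rule gcomb_closed)
  have l: "fs_single (gcomb G n t v) ?y - (\<Sum>a<n. of_int (v a) * fs_single (t a) ?y) \<in> wedge_rel G"
    by (rule additive_mod_gcomb[OF W]) (use y t wedge_left in auto)
  have r: "fs_single (t a) ?y - (\<Sum>b<n. of_int (w b) * fs_single (t a) (t b)) \<in> wedge_rel G" if "a < n" for a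
    by (rule additive_mod_gcomb[OF W wedge_right[OF t[OF that]] t])
  have "(\<Sum>a<n. of_int (v a) * (fs_single (t a) ?y - (\<Sum>b<n. of_int (w b) * fs_single (t a) (t b)))) \<in> wedge_rel G"
    by (rule zsub_sum[OF W], rule zsub_of_int[OF W], rule r) simp
  from zsub_add[OF W l this] show ?thesis
    by (simp add: right_diff_distrib sum_subtractf sum_distrib_left mult.assoc)
qed

lemma wedge_antisym:
  assumes "x \<in> carrier G" "y \<in> carrier G"
  shows "fs_single x y + fs_single y x \<in> wedge_rel G"
proof -
  note W = wedge_rel_zsub[of G]
  have a: "fs_single (x \<otimes> y) (x \<otimes> y) - fs_single x (x \<otimes> y) - fs_single y (x \<otimes> y) \<in> wedge_rel G"
    and b: "fs_single x (x \<otimes> y) - fs_single x x - fs_single x y \<in> wedge_rel G"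
    and c: "fs_single y (x \<otimes> y) - fs_single y x - fs_single y y \<in> wedge_rel G"
    using assms by (auto intro: wedge_left wedge_right)
  have d: "fs_single (x \<otimes> y) (x \<otimes> y) \<in> wedge_rel G" "fs_single x x \<in> wedge_rel G" "fs_single y y \<in> wedge_rel G"
    using assms by (auto intro: wr_alt)
  have "fs_single x y + fs_single y x = fs_single (x \<otimes> y) (x \<otimes> y)
     - (fs_single (x \<otimes> y) (x \<otimes> y) - fs_single x (x \<otimes> y) - fs_single y (x \<otimes> y))
     - (fs_single x (x \<otimes> y) - fs_single x x - fs_single x y)
     - (fs_single y (x \<otimes> y) - fs_single y x - fs_single y y) - fs_single x x - fs_single y y"
    by (simp add: algebra_simps)
  also have "\<dots> \<in> wedge_rel G"
    by (rule zsub_diff[OF W zsub_diff[OF W zsub_diff[OF W zsub_diff[OF W zsub_diff[OF W d(1) a] b] c] d(2)] d(3)])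
  finally show ?thesis .
qed

lemma wedge_torsion:
  assumes x: "x \<in> carrier G" "x [^] (N::int) = \<one>" and y: "y \<in> carrier G"
  shows "of_int (N * k) * fs_single x y \<in> wedge_rel G"
proof -
  note W = wedge_rel_zsub[of G]
  have one: "fs_single \<one> y \<in> wedge_rel G"
    using zsub_uminus[OF W wedge_left[of \<one> G \<one> y]] y by simp
  have "fs_single (x [^] (N * k)) y - of_int (N * k) * fs_single x y \<in> wedge_rel G"
    by (rule additive_mod_int_pow[OF W]) (use wedge_left x y in auto)
  moreover have "x [^] (N * k) = \<one>" using x by (metis int_pow_pow int_pow_one)
  ultimately have "fs_single \<one> y - of_int (N * k) * fs_single x y \<in> wedge_rel G" by simp
  from zsub_diff[OF W one this] show ?thesis by simp
qed

lemma wedge_sum_symmetric: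
  fixes n :: nat
  assumes N: "\<And>x. x \<in> carrier G \<Longrightarrow> x [^] (N::int) = \<one>"
    and t: "\<And>i. i < n \<Longrightarrow> t i \<in> carrier G"
    and X: "\<And>a b. a < n \<Longrightarrow> b < n \<Longrightarrow> N dvd X a b - X b a"
  shows "(\<Sum>a<n. \<Sum>b<n. of_int (X a b) * fs_single (t a) (t b)) \<in> wedge_rel G"
  using t X
proof (induction n)
  case 0 then show ?case by (simp only: lessThan_0 sum.empty zsub_zero[OF wedge_rel_zsub])
next
  case (Suc n)
  note W = wedge_rel_zsub[of G]
  let ?S = "\<lambda>a b. fs_single (t a) (t b)"
  have e: "of_int (X a n) * ?S a n + of_int (X n a) * ?S n a \<in> wedge_rel G" if "a < n" for a
  proof -
    obtain k where k: "X a n - X n a = N * k" using Suc.prems(2)[of a n] \<open>a < n\<close> by auto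
    have "of_int (X a n) * ?S a n + of_int (X n a) * ?S n a
      = of_int (X n a) * (?S a n + ?S n a) + of_int (X a n - X n a) * ?S a n"
      by (simp add: algebra_simps)
    also have "\<dots> \<in> wedge_rel G"
      unfolding k using Suc.prems(1) that
      by (intro zsub_add[OF W] zsub_of_int[OF W wedge_antisym] wedge_torsion N) auto
    finally show ?thesis .
  qed
  have d: "of_int (X n n) * ?S n n \<in> wedge_rel G"
    by (intro zsub_of_int[OF W] wr_alt) (use Suc.prems in auto)
  have s: "(\<Sum>a<n. of_int (X a n) * ?S a n + of_int (X n a) * ?S n a) \<in> wedge_rel G"
    by (rule zsub_sum[OF W]) (use e in auto)
  have i: "(\<Sum>a<n. \<Sum>b<n. of_int (X a b) * ?S a b) \<in> wedge_rel G"
    by (rule Suc.IH) (use Suc.prems in simp_all)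
  have "(\<Sum>a<Suc n. \<Sum>b<Suc n. of_int (X a b) * ?S a b) = (\<Sum>a<n. \<Sum>b<n. of_int (X a b) * ?S a b)
     + (\<Sum>a<n. of_int (X a n) * ?S a n + of_int (X n a) * ?S n a) + of_int (X n n) * ?S n n"
    by (simp add: sum.distrib algebra_simps)
  then show ?case using zsub_add[OF W zsub_add[OF W i s] d] by (simp only:)
qed

lemma tup_wedge_gsp:
  assumes N: "\<And>x. x \<in> carrier G \<Longrightarrow> x [^] (N::int) = \<one>"
    and t: "\<And>i. i < 2*g \<Longrightarrow> t i \<in> carrier G"
    and M: "\<And>a b. a < 2*g \<Longrightarrow> b < 2*g \<Longrightarrow> [sympl g (M a) (M b) = q * intJ g a b] (mod N)"
  shows "tup_wedge g (\<lambda>j. gcomb G (2*g) t (\<lambda>i. M i j)) - of_int q * tup_wedge g t \<in> wedge_rel G"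
proof -
  note W = wedge_rel_zsub[of G]
  let ?S = "\<lambda>a b. fs_single (t a) (t b)"
  let ?c = "\<lambda>j. gcomb G (2*g) t (\<lambda>i. M i j)"
  let ?E = "\<lambda>a b. if a < g \<and> b = a + g then 1 else 0 :: int"
  let ?X = "\<lambda>a b. (\<Sum>i<g. M a i * M b (g + i)) - q * ?E a b"
  have A: "(\<Sum>i<g. fs_single (?c i) (?c (g + i))
     - (\<Sum>a<2*g. \<Sum>b<2*g. of_int (M a i * M b (g + i)) * ?S a b)) \<in> wedge_rel G"
    by (rule zsub_sum[OF W], rule wedge_gcomb, rule t)
  have A1: "(\<Sum>i<g. \<Sum>a<2*g. \<Sum>b<2*g. of_int (M a i * M b (g + i)) * ?S a b)
     = (\<Sum>a<2*g. \<Sum>b<2*g. of_int (\<Sum>i<g. M a i * M b (g + i)) * ?S a b)"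
    unfolding of_int_sum sum_distrib_right
    by (subst sum.swap, rule sum.cong[OF refl], rule sum.swap)
  have B: "(\<Sum>a<2*g. \<Sum>b<2*g. of_int (q * ?E a b) * ?S a b) = of_int q * tup_wedge g t"
  proof -
    have "(\<Sum>b<2*g. of_int (q * ?E a b) * ?S a b) = (if a < g then of_int q * ?S a (g + a) else 0)" for a
    proof -
      have "(\<Sum>b<2*g. of_int (q * ?E a b) * ?S a b)
         = (\<Sum>b<2*g. if b = g + a then (if a < g then of_int q * ?S a (g + a) else 0) else 0)"
        by (rule sum.cong) (auto simp: add.commute)
      then show ?thesis by (subst (asm) sum.delta) auto
    qed
    then have "(\<Sum>a<2*g. \<Sum>b<2*g. of_int (q * ?E a b) * ?S a b)
      = (\<Sum>a<2*g. if a < g then of_int q * ?S a (g + a) else 0)" by (simp only:)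
    also have "\<dots> = (\<Sum>a<g. of_int q * ?S a (g + a))"
      unfolding sum_halves by (rule sum.cong) auto
    finally show ?thesis by (simp only: sum_distrib_left)
  qed
  have C: "(\<Sum>a<2*g. \<Sum>b<2*g. of_int (?X a b) * ?S a b) \<in> wedge_rel G"
  proof (rule wedge_sum_symmetric[OF N t])
    fix a b assume ab: "a < 2*g" "b < 2*g"
    have "?X a b - ?X b a = sympl g (M a) (M b) - q * intJ g a b"
      by (auto simp: sympl_def intJ_def sum_subtractf algebra_simps)
    then show "N dvd ?X a b - ?X b a" using M[OF ab] by (simp only: cong_iff_dvd_diff)
  qed
  have "tup_wedge g ?c - of_int q * tup_wedge g t
    = (\<Sum>i<g. fs_single (?c i) (?c (g + i)) - (\<Sum>a<2*g. \<Sum>b<2*g. of_int (M a i * M b (g + i)) * ?S a b))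
      + (\<Sum>a<2*g. \<Sum>b<2*g. of_int (?X a b) * ?S a b)"
    unfolding sum_subtractf A1 B[symmetric] of_int_diff left_diff_distrib by (simp only: diff_add_cancel add_diff_eq)
  then show ?thesis using zsub_add[OF W A C] by (simp only:)
qed

abbreviation pairing :: "('a \<Rightarrow> 'a \<Rightarrow> int) \<Rightarrow> ('a \<times> 'a \<Rightarrow> int) \<Rightarrow> int" where
  "pairing \<beta> f \<equiv> \<Sum>p\<in>carrier G \<times> carrier G. f p * \<beta> (fst p) (snd p)"

lemma pairing_single:
  assumes "finite (carrier G)" "x \<in> carrier G" "y \<in> carrier G"
  shows "pairing \<beta> (fs_single x y) = \<beta> x y"
proof -
  have "pairing \<beta> (fs_single x y)
      = (\<Sum>p\<in>carrier G \<times> carrier G. if p = (x, y) then \<beta> x y else 0)"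
    by (rule sum.cong) (auto simp: fs_single_def)
  then show ?thesis using assms by simp
qed

lemma wedge_rel_pairing:
  assumes fin: "finite (carrier G)" and f: "f \<in> wedge_rel G"
    and l: "\<And>x y z. x \<in> carrier G \<Longrightarrow> y \<in> carrier G \<Longrightarrow> z \<in> carrier G \<Longrightarrow> N dvd \<beta> (x \<otimes> y) z - \<beta> x z - \<beta> y z"
    and r: "\<And>x y z. x \<in> carrier G \<Longrightarrow> y \<in> carrier G \<Longrightarrow> z \<in> carrier G \<Longrightarrow> N dvd \<beta> x (y \<otimes> z) - \<beta> x y - \<beta> x z"
    and a: "\<And>x. x \<in> carrier G \<Longrightarrow> N dvd \<beta> x x"
  shows "N dvd pairing \<beta> f"
proof -
  note s = pairing_single[OF fin, where \<beta> = \<beta>]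
  have d: "pairing \<beta> (f - h) = pairing \<beta> f - pairing \<beta> h" for f h by (simp add: sum_subtractf algebra_simps)
  show ?thesis
    using f
  proof (induction rule: wedge_rel_induct)
    case zero then show ?case by simp
  next
    case (left x y z) then show ?case unfolding d using s l by simp
  next
    case (right x y z) then show ?case unfolding d using s r by simp
  next
    case (alt x) then show ?case using s a by simp
  next
    case (add f h)
    have "pairing \<beta> (f + h) = pairing \<beta> f + pairing \<beta> h" by (simp add: sum.distrib algebra_simps)
    then show ?case using add by simp
  next
    case (neg f)
    have "pairing \<beta> (- f) = - pairing \<beta> f" by (simp add: sum_negf)
    then show ?case using neg by simp
  qed
qed

lemma tup_wedge_pairing:
  assumes fin: "finite (carrier G)" and t: "\<And>i. i < 2*g \<Longrightarrow> t i \<in> carrier G"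
  shows "pairing \<beta> (tup_wedge g t) = (\<Sum>i<g. \<beta> (t i) (t (g + i)))"
proof -
  let ?C = "carrier G \<times> carrier G"
  have "pairing \<beta> (tup_wedge g t)
     = (\<Sum>i<g. \<Sum>p\<in>?C. fs_single (t i) (t (g + i)) p * \<beta> (fst p) (snd p))"
    unfolding sum_fun_apply sum_distrib_right by (rule sum.swap)
  also have "\<dots> = (\<Sum>i<g. \<beta> (t i) (t (g + i)))"
    by (rule sum.cong) (use pairing_single[OF fin] t in auto)
  finally show ?thesis .
qed

section \<open>Transitivity on generating tuples of a finite abelian l-group\<close>

definition gen_tuple :: "nat \<Rightarrow> (nat \<Rightarrow> 'a) \<Rightarrow> bool" where
  "gen_tuple n t \<longleftrightarrow> (\<forall>h\<in>carrier G. \<exists>u. h = gcomb G n t u)"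

lemma gcomb_lincomb:
  assumes e: "\<And>i. i < M \<Longrightarrow> e i \<in> carrier G"
  shows "gcomb G M e (lincomb n u \<tau>) = gcomb G n (\<lambda>j. gcomb G M e (\<tau> j)) u"
proof -
  have "lincomb n u \<tau> = (\<lambda>i. \<Sum>r<n. \<tau> r i * u r)"
    by (rule ext) (simp add: lincomb_def sum_fun_apply mult.commute)
  then show ?thesis using gcomb_compose[OF e, where n = M and m = n and A = "\<lambda>i r. \<tau> r i" and v = u] by simp
qed

text \<open>The group is presented as a quotient of the ring of integer-valued functions on the natural numbers.\<close>
theorem gtransv_transitive:
  assumes l: "prime l" and fin: "finite (carrier G)" and card: "card (carrier G) = l ^ m"
    and t: "\<And>i. i < 2*g \<Longrightarrow> t i \<in> carrier G" and t': "\<And>i. i < 2*g \<Longrightarrow> t' i \<in> carrier G"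
    and gen: "gen_tuple (2*g) t" and gen': "gen_tuple (2*g) t'"
    and W: "tup_wedge g t - tup_wedge g t' \<in> wedge_rel G"
    and inv: "\<And>c u s. (\<And>i. s i \<in> carrier G) \<Longrightarrow> Q (gtransv G g c u s) = Q s"
    and Qcong: "\<And>s s'. (\<And>j. j < 2*g \<Longrightarrow> s j = s' j) \<Longrightarrow> Q s = Q s'"
  shows "Q t = Q t'"
proof -
  define M where "M = card (carrier G)"
  obtain e where e: "bij_betw e {0..<M} (carrier G)"
    using ex_bij_betw_nat_finite[OF fin] unfolding M_def by blast
  have ec: "e i \<in> carrier G" if "i < M" for i using e that by (auto simp: bij_betw_def)
  have "\<exists>i<M. e i = x" if "x \<in> carrier G" for x
    using e that unfolding bij_betw_def by (metis atLeastLessThan_iff imageE)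
  then obtain idx where idx: "idx x < M" "e (idx x) = x" if "x \<in> carrier G" for x by metis
  \<comment> \<open>All group elements serve as generators, so \<delta> is a section of \<pi>. It is
    additive only modulo the kernel L of \<pi>.\<close>
  define \<pi> where "\<pi> a = gcomb G M e a" for a :: "nat \<Rightarrow> int"
  define \<delta> where "\<delta> x = (\<lambda>i. if i = idx x then 1 else 0 :: int)" for x
  have pc: "\<pi> a \<in> carrier G" for a unfolding \<pi>_def by (rule gcomb_closed) (rule ec)
  have pd: "\<pi> (\<delta> x) = x" if "x \<in> carrier G" for x
    unfolding \<pi>_def \<delta>_def using gcomb_delta[OF ec, where n = M and j = "idx x" and a = 1] idx[OF that] that by simp
  have padd: "\<pi> (a + b) = \<pi> a \<otimes> \<pi> b" for a b
    unfolding \<pi>_def plus_fun_def by (rule gcomb_add) (rule ec)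
  have pscale: "\<pi> (of_int c * a) = \<pi> a [^] c" for c a
  proof -
    have "of_int c * a = (\<lambda>i. c * a i)" by (rule ext) simp
    then show ?thesis unfolding \<pi>_def using gcomb_scale[OF ec] by simp
  qed
  have pdiff: "\<pi> (a - b) = \<pi> a \<otimes> inv (\<pi> b)" for a b
  proof -
    have "a - b = a + of_int (-1) * b" by simp
    then have "\<pi> (a - b) = \<pi> a \<otimes> \<pi> b [^] (-1 :: int)" by (simp only: padd pscale)
    then show ?thesis using pc by (simp add: int_pow_neg)
  qed
  have p0: "\<pi> 0 = \<one>" unfolding \<pi>_def zero_fun_def by (rule gcomb_zero)
  define L where "L = {a. \<pi> a = \<one>}"
  have L: "zsub L" using p0 pdiff by (auto simp: L_def zsub_def)
  have Leq: "a - b \<in> L \<longleftrightarrow> \<pi> a = \<pi> b" for a b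
    unfolding L_def using pdiff pc by (metis (mono_tags, lifting) inv_closed inv_inv inv_equality mem_Collect_eq r_inv)
  let ?R = "\<delta> ` carrier G"
  have R: "\<exists>r\<in>?R. a - r \<in> L" for a using pc pd by (auto simp: Leq)
  have tors: "\<exists>b. \<forall>a. of_int (int l ^ b) * a \<in> L"
  proof (intro exI allI)
    fix a
    have "\<pi> a [^] (int (l ^ m)) = \<one>"
      using pow_order_eq_1[OF pc, of a] card by (simp add: int_pow_int order_def del: of_nat_power)
    then show "of_int (int l ^ m) * a \<in> L" by (simp add: L_def pscale del: of_int_power)
  qed
  have plin: "\<pi> (lincomb n u \<tau>) = gcomb G n (\<lambda>j. \<pi> (\<tau> j)) u" for n u \<tau>
    unfolding \<pi>_def using ec by (rule gcomb_lincomb)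
  have generates: "generates (2*g) L (\<lambda>j. \<delta> (s j))"
    if s: "\<And>i. i < 2*g \<Longrightarrow> s i \<in> carrier G" and gs: "gen_tuple (2*g) s" for s
    unfolding generates_def
  proof
    fix a
    obtain u where "\<pi> a = gcomb G (2*g) s u" using gs pc by (auto simp: gen_tuple_def)
    also have "\<dots> = \<pi> (lincomb (2*g) u (\<lambda>j. \<delta> (s j)))"
      unfolding plin using s pd by (intro gcomb_cong) auto
    finally show "\<exists>u. a - lincomb (2*g) u (\<lambda>j. \<delta> (s j)) \<in> L" using Leq by blast
  qed
  have eqv: "sympl_equiv g L (\<lambda>j. \<delta> (t j)) (\<lambda>j. \<delta> (t' j))"
    unfolding sympl_equiv_def
  proof (intro allI impI)
    fix N \<psi>1 \<psi>2 assume c1: "zchar N L \<psi>1" and c2: "zchar N L \<psi>2"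
    have add: "N dvd \<psi> (\<delta> (x \<otimes> y)) - \<psi> (\<delta> x) - \<psi> (\<delta> y)"
      if ch: "zchar N L \<psi>" and xy: "x \<in> carrier G" "y \<in> carrier G" for \<psi> x y
    proof -
      have "\<delta> (x \<otimes> y) - (\<delta> x + \<delta> y) \<in> L" using xy pd by (simp add: Leq padd)
      then have "[\<psi> (\<delta> (x \<otimes> y) - (\<delta> x + \<delta> y)) = 0] (mod N)" by (rule zchar_on_vanish[OF ch])
      then have h1: "[\<psi> (\<delta> (x \<otimes> y) - (\<delta> x + \<delta> y)) + \<psi> (\<delta> x + \<delta> y) = 0 + (\<psi> (\<delta> x) + \<psi> (\<delta> y))] (mod N)"
        by (intro cong_add zchar_add[OF ch])
      have h2: "[\<psi> (\<delta> (x \<otimes> y)) = \<psi> (\<delta> (x \<otimes> y) - (\<delta> x + \<delta> y)) + \<psi> (\<delta> x + \<delta> y)] (mod N)"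
        using zchar_add[OF ch, of "\<delta> (x \<otimes> y) - (\<delta> x + \<delta> y)" "\<delta> x + \<delta> y"] by (simp only: diff_add_cancel)
      from cong_trans[OF h2 h1] show ?thesis by (simp add: cong_iff_dvd_diff algebra_simps)
    qed
    define \<beta> where "\<beta> x y = \<psi>1 (\<delta> x) * \<psi>2 (\<delta> y) - \<psi>2 (\<delta> x) * \<psi>1 (\<delta> y)" for x y
    have "N dvd pairing \<beta> (tup_wedge g t - tup_wedge g t')"
    proof (rule wedge_rel_pairing[OF fin W])
      fix x y z assume xyz: "x \<in> carrier G" "y \<in> carrier G" "z \<in> carrier G"
      have "\<beta> (x \<otimes> y) z - \<beta> x z - \<beta> y z = (\<psi>1 (\<delta> (x \<otimes> y)) - \<psi>1 (\<delta> x) - \<psi>1 (\<delta> y)) * \<psi>2 (\<delta> z)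
         - (\<psi>2 (\<delta> (x \<otimes> y)) - \<psi>2 (\<delta> x) - \<psi>2 (\<delta> y)) * \<psi>1 (\<delta> z)"
        by (simp add: \<beta>_def algebra_simps)
      then show "N dvd \<beta> (x \<otimes> y) z - \<beta> x z - \<beta> y z"
        using add[OF c1 xyz(1,2)] add[OF c2 xyz(1,2)] by (simp only: dvd_diff dvd_mult2)
      have "\<beta> x (y \<otimes> z) - \<beta> x y - \<beta> x z = (\<psi>2 (\<delta> (y \<otimes> z)) - \<psi>2 (\<delta> y) - \<psi>2 (\<delta> z)) * \<psi>1 (\<delta> x)
         - (\<psi>1 (\<delta> (y \<otimes> z)) - \<psi>1 (\<delta> y) - \<psi>1 (\<delta> z)) * \<psi>2 (\<delta> x)"
        by (simp add: \<beta>_def algebra_simps)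
      then show "N dvd \<beta> x (y \<otimes> z) - \<beta> x y - \<beta> x z"
        using add[OF c1 xyz(2,3)] add[OF c2 xyz(2,3)] by (simp only: dvd_diff dvd_mult2)
    qed (simp add: \<beta>_def)
    also have "pairing \<beta> (tup_wedge g t - tup_wedge g t')
      = pairing \<beta> (tup_wedge g t)
        - pairing \<beta> (tup_wedge g t')"
      by (simp add: sum_subtractf left_diff_distrib)
    also have "\<dots> = (\<Sum>i<g. \<beta> (t i) (t (g + i))) - (\<Sum>i<g. \<beta> (t' i) (t' (g + i)))"
      using tup_wedge_pairing[OF fin, where g = g and t = t and \<beta> = \<beta>, OF t]
        tup_wedge_pairing[OF fin, where g = g and t = t' and \<beta> = \<beta>, OF t'] by simp
    also have "\<dots> = sympl g (\<lambda>i. \<psi>1 (\<delta> (t i))) (\<lambda>i. \<psi>2 (\<delta> (t i)))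
       - sympl g (\<lambda>i. \<psi>1 (\<delta> (t' i))) (\<lambda>i. \<psi>2 (\<delta> (t' i)))"
      unfolding sympl_def \<beta>_def by (simp only: mult.commute)
    finally show "[sympl g (\<lambda>i. \<psi>1 (\<delta> (t i))) (\<lambda>i. \<psi>2 (\<delta> (t i)))
       = sympl g (\<lambda>i. \<psi>1 (\<delta> (t' i))) (\<lambda>i. \<psi>2 (\<delta> (t' i)))] (mod N)"
      by (simp only: cong_iff_dvd_diff)
  qed
  obtain t'' where t'': "transv_reach g (\<lambda>j. \<delta> (t j)) t''" "\<forall>j<2*g. t'' j - \<delta> (t' j) \<in> L"
    using transv_transitive[OF l finite_imageI[OF fin] L R tors generates[OF t gen] generates[OF t' gen'] eqv]
    by blast
  \<comment> \<open>\<pi> carries transvections of integer tuples to \<open>gtransv\<close>, so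
    every step of the chain leaves Q fixed.\<close>
  have ptransv: "(\<lambda>j. \<pi> (transv g c u \<tau> j)) = gtransv G g c u (\<lambda>j. \<pi> (\<tau> j))" for c u \<tau>
    by (rule ext) (simp only: transv_def gtransv_def padd pscale plin)
  have "Q (\<lambda>j. \<pi> (\<delta> (t j))) = Q (\<lambda>j. \<pi> (t'' j))"
    using t''(1) unfolding transv_reach_def
  proof (induction rule: rtranclp_induct)
    case (step y z)
    then obtain c u where z: "z = transv g c u y" by blast
    have "Q (\<lambda>j. \<pi> (z j)) = Q (\<lambda>j. \<pi> (y j))"
      unfolding z ptransv by (rule inv) (rule pc)
    then show ?case using step by simp
  qed simp
  moreover have "Q (\<lambda>j. \<pi> (\<delta> (t j))) = Q t" using t pd by (intro Qcong) auto
  moreover have "Q (\<lambda>j. \<pi> (t'' j)) = Q t'" using t' pd t''(2) Leq by (intro Qcong) auto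
  ultimately show ?thesis by simp
qed

text \<open>The set S of the overview, for a representative f of the wedge class. Tuples are
  extensional, so that S is finite for finite G and can be counted.\<close>

definition sympl_tuples :: "nat \<Rightarrow> ('a \<times> 'a \<Rightarrow> int) \<Rightarrow> (nat \<Rightarrow> 'a) set" where
  "sympl_tuples g f = {t \<in> {..<2*g} \<rightarrow>\<^sub>E carrier G. gen_tuple (2*g) t \<and> tup_wedge g t - f \<in> wedge_rel G}"

section \<open>Existence of generating tuples with a given wedge class, and padding\<close>

lemma gcomb_append: "(\<And>i. i < m + n \<Longrightarrow> t i \<in> carrier G) \<Longrightarrow>
  gcomb G (m + n) t u = gcomb G m t u \<otimes> gcomb G n (\<lambda>i. t (m + i)) (\<lambda>i. u (m + i))"
proof (induction n)
  case 0 then show ?case using gcomb_closed[of m t u] by simp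
next
  case (Suc n)
  have "gcomb G m t u \<in> carrier G" "gcomb G n (\<lambda>i. t (m + i)) (\<lambda>i. u (m + i)) \<in> carrier G"
    "t (m + n) [^] u (m + n) \<in> carrier G"
    using Suc.prems by (auto intro: gcomb_closed)
  then show ?case using Suc by (simp add: m_assoc)
qed

text \<open>The two halves of a tuple are kept as separate families: raising g shifts the second
  half of a tuple indexed by 2g, whereas each separate family only gains a last entry.\<close>

definition sympl_pairs :: "nat \<Rightarrow> ('a \<times> 'a \<Rightarrow> int) \<Rightarrow> bool" where
  "sympl_pairs g f \<longleftrightarrow> (\<exists>a b. (\<forall>i<g. a i \<in> carrier G) \<and> (\<forall>i<g. b i \<in> carrier G) \<and>
     (\<Sum>i<g. fs_single (a i) (b i)) - f \<in> wedge_rel G \<and>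
     (\<forall>h\<in>carrier G. \<exists>u w. h = gcomb G g a u \<otimes> gcomb G g b w))"

lemma sympl_pairs_iff: "sympl_pairs g f \<longleftrightarrow> sympl_tuples g f \<noteq> {}"
proof
  assume "sympl_pairs g f"
  then obtain a b where ab: "\<And>i. i < g \<Longrightarrow> a i \<in> carrier G" "\<And>i. i < g \<Longrightarrow> b i \<in> carrier G"
    and W: "(\<Sum>i<g. fs_single (a i) (b i)) - f \<in> wedge_rel G"
    and gen: "\<And>h. h \<in> carrier G \<Longrightarrow> \<exists>u w. h = gcomb G g a u \<otimes> gcomb G g b w"
    unfolding sympl_pairs_def by blast
  define t where "t = (\<lambda>i\<in>{..<2*g}. if i < g then a i else b (i - g))"
  have tc: "t i \<in> carrier G" if "i < g + g" for i using that ab by (auto simp: t_def)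
  have "tup_wedge g t = (\<Sum>i<g. fs_single (a i) (b i))"
    by (rule sum.cong) (auto simp: t_def)
  moreover have "gen_tuple (2*g) t"
    unfolding gen_tuple_def
  proof
    fix h assume "h \<in> carrier G"
    then obtain u w where h: "h = gcomb G g a u \<otimes> gcomb G g b w" using gen by blast
    let ?u = "\<lambda>i. if i < g then u i else w (i - g)"
    have "gcomb G (g + g) t ?u = gcomb G g t ?u \<otimes> gcomb G g (\<lambda>i. t (g + i)) (\<lambda>i. ?u (g + i))"
      by (rule gcomb_append) (rule tc)
    also have "gcomb G g t ?u = gcomb G g a u" by (rule gcomb_cong) (auto simp: t_def)
    also have "gcomb G g (\<lambda>i. t (g + i)) (\<lambda>i. ?u (g + i)) = gcomb G g b w"
      by (rule gcomb_cong) (auto simp: t_def)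
    finally have "h = gcomb G (g + g) t ?u" using h by simp
    then show "\<exists>u. h = gcomb G (2*g) t u" unfolding mult_2 by blast
  qed
  moreover have "t \<in> {..<2*g} \<rightarrow>\<^sub>E carrier G" using tc by (auto simp: t_def)
  ultimately show "sympl_tuples g f \<noteq> {}" using W by (auto simp: sympl_tuples_def simp del: sum_fun_apply)
next
  assume "sympl_tuples g f \<noteq> {}"
  then obtain t where t: "t \<in> {..<2*g} \<rightarrow>\<^sub>E carrier G" "gen_tuple (2*g) t" "tup_wedge g t - f \<in> wedge_rel G"
    unfolding sympl_tuples_def by blast
  have tc: "t i \<in> carrier G" if "i < g + g" for i using that t(1) by (auto simp: PiE_iff)
  have gen: "\<exists>u w. h = gcomb G g t u \<otimes> gcomb G g (\<lambda>i. t (g + i)) w" if h: "h \<in> carrier G" for h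
  proof -
    obtain u where "h = gcomb G (g + g) t u" using t(2) h unfolding gen_tuple_def mult_2 by blast
    then show ?thesis using gcomb_append[OF tc, where m = g and n = g and u = u] by auto
  qed
  show "sympl_pairs g f"
    unfolding sympl_pairs_def
    by (rule exI[of _ t], rule exI[of _ "\<lambda>i. t (g + i)"]) (intro conjI ballI allI impI gen t(3); simp add: tc)
qed

lemma wedge_one_right:
  assumes "x \<in> carrier G" shows "fs_single x \<one> \<in> wedge_rel G"
  using zsub_uminus[OF wedge_rel_zsub wedge_right[of x G \<one> \<one>]] assms by simp

lemma sympl_pairs_Suc:
  assumes "sympl_pairs g f" shows "sympl_pairs (Suc g) f"
proof -
  obtain a b where ab: "\<And>i. i < g \<Longrightarrow> a i \<in> carrier G" "\<And>i. i < g \<Longrightarrow> b i \<in> carrier G"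
    and W: "(\<Sum>i<g. fs_single (a i) (b i)) - f \<in> wedge_rel G"
    and gen: "\<And>h. h \<in> carrier G \<Longrightarrow> \<exists>u w. h = gcomb G g a u \<otimes> gcomb G g b w"
    using assms unfolding sympl_pairs_def by blast
  let ?a = "a(g := \<one>)" and ?b = "b(g := \<one>)"
  have "(\<Sum>i<Suc g. fs_single (?a i) (?b i)) - f = ((\<Sum>i<g. fs_single (?a i) (?b i)) - f) + fs_single \<one> \<one>"
    by (simp add: algebra_simps)
  also have "(\<Sum>i<g. fs_single (?a i) (?b i)) = (\<Sum>i<g. fs_single (a i) (b i))"
    by (rule sum.cong) auto
  also have "\<dots> - f + fs_single \<one> \<one> \<in> wedge_rel G"
    by (rule zsub_add[OF wedge_rel_zsub W wr_alt]) simp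
  finally have W': "(\<Sum>i<Suc g. fs_single (?a i) (?b i)) - f \<in> wedge_rel G" .
  have gen': "\<exists>u w. h = gcomb G (Suc g) ?a u \<otimes> gcomb G (Suc g) ?b w" if h: "h \<in> carrier G" for h
  proof -
    obtain u w where uw: "h = gcomb G g a u \<otimes> gcomb G g b w" using gen[OF h] by blast
    have "gcomb G g ?a u = gcomb G g a u" "gcomb G g ?b w = gcomb G g b w"
      by (auto intro: gcomb_cong)
    moreover have "gcomb G g a u \<in> carrier G" "gcomb G g b w \<in> carrier G"
      using ab by (auto intro: gcomb_closed)
    ultimately show ?thesis using uw by - (rule exI[of _ u], rule exI[of _ w], simp)
  qed
  show ?thesis unfolding sympl_pairs_def
    by (rule exI[of _ ?a], rule exI[of _ ?b], intro conjI ballI gen' W') (use ab in \<open>auto simp: less_Suc_eq\<close>)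
qed

lemma sympl_pairs_mono: "sympl_pairs g f \<Longrightarrow> g \<le> g' \<Longrightarrow> sympl_pairs g' f"
  by (rotate_tac 1, induction rule: dec_induct) (auto intro: sympl_pairs_Suc)

lemma sympl_pairs_exists:
  assumes fin: "finite (carrier G)" and f: "f \<in> fsums G"
  shows "\<exists>g. sympl_pairs g f"
proof -
  let ?C = "carrier G \<times> carrier G"
  define M where "M = card (carrier G)"
  obtain e where e: "bij_betw e {0..<M} (carrier G)"
    using ex_bij_betw_nat_finite[OF fin] unfolding M_def by blast
  define K where "K = card ?C"
  obtain p where p: "bij_betw p {0..<K} ?C"
    using ex_bij_betw_nat_finite[of ?C] fin unfolding K_def by blast
  have ec: "e i \<in> carrier G" if "i < M" for i using e that by (auto simp: bij_betw_def)
  have pc: "p i \<in> ?C" if "i < K" for i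
    using bij_betwE[OF p, rule_format, of i] that by simp
  have pf: "fst (p i) \<in> carrier G" "snd (p i) \<in> carrier G" if "i < K" for i using pc[OF that] by auto
  define a where "a i = (if i < K then fst (p i) [^] f (p i) else e (i - K))" for i
  define b where "b i = (if i < K then snd (p i) else \<one>)" for i
  note W = wedge_rel_zsub[of G]
  have ac: "a i \<in> carrier G" if "i < K + M" for i using that pf ec by (auto simp: a_def)
  have bc: "b i \<in> carrier G" if "i < K + M" for i using that pf by (auto simp: b_def)
  have fe: "f = (\<Sum>i<K. of_int (f (p i)) * fs_single (fst (p i)) (snd (p i)))"
  proof
    fix s
    have "(\<Sum>i<K. of_int (f (p i)) * fs_single (fst (p i)) (snd (p i))) s
       = (\<Sum>i\<in>{0..<K}. (\<lambda>r. if r = s then f r else 0) (p i))"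
      unfolding sum_fun_apply by (rule sum.cong) (auto simp: fs_single_def)
    also have "\<dots> = (\<Sum>r\<in>?C. if r = s then f r else 0)"
      by (rule sum.reindex_bij_betw[OF p])
    also have "\<dots> = f s"
    proof -
      have "f s = 0" if "s \<notin> ?C" using f that unfolding fsums_def by blast
      then show ?thesis using fin by (auto simp: mem_Times_iff)
    qed
    finally show "f s = (\<Sum>i<K. of_int (f (p i)) * fs_single (fst (p i)) (snd (p i))) s" by simp
  qed
  have "(\<Sum>i<K. fs_single (a i) (b i) - of_int (f (p i)) * fs_single (fst (p i)) (snd (p i))) \<in> wedge_rel G"
  proof (rule zsub_sum[OF W])
    fix i assume "i \<in> {..<K}"
    then have i: "i < K" by simp
    have "fs_single (fst (p i) [^] f (p i)) (snd (p i)) - of_int (f (p i)) * fs_single (fst (p i)) (snd (p i)) \<in> wedge_rel G"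
      by (rule additive_mod_int_pow[OF W, of "\<lambda>x. fs_single x (snd (p i))"]) (use pf[OF i] wedge_left in auto)
    then show "fs_single (a i) (b i) - of_int (f (p i)) * fs_single (fst (p i)) (snd (p i)) \<in> wedge_rel G"
      using i by (simp only: a_def b_def if_True)
  qed
  then have 1: "(\<Sum>i<K. fs_single (a i) (b i)) - f \<in> wedge_rel G"
    unfolding sum_subtractf fe[symmetric] .
  have 2: "(\<Sum>i=K..<K+M. fs_single (a i) (b i)) \<in> wedge_rel G"
  proof (rule zsub_sum[OF W])
    fix i assume "i \<in> {K..<K+M}"
    then show "fs_single (a i) (b i) \<in> wedge_rel G"
      using wedge_one_right[OF ac[of i]] by (simp add: b_def)
  qed
  have "(\<Sum>i<K+M. fs_single (a i) (b i)) = (\<Sum>i<K. fs_single (a i) (b i)) + (\<Sum>i=K..<K+M. fs_single (a i) (b i))"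
    unfolding lessThan_atLeast0 by (rule sum.atLeastLessThan_concat[symmetric]) auto
  then have "(\<Sum>i<K+M. fs_single (a i) (b i)) - f = ((\<Sum>i<K. fs_single (a i) (b i)) - f) + (\<Sum>i=K..<K+M. fs_single (a i) (b i))"
    by (simp only: diff_add_eq)
  then have W': "(\<Sum>i<K+M. fs_single (a i) (b i)) - f \<in> wedge_rel G"
    using zsub_add[OF W 1 2] by (simp only:)
  have gen: "\<exists>u w. h = gcomb G (K+M) a u \<otimes> gcomb G (K+M) b w" if h: "h \<in> carrier G" for h
  proof -
    obtain j where j: "j < M" "h = e j" using e h unfolding bij_betw_def by (metis atLeastLessThan_iff imageE)
    have "gcomb G (K+M) a (\<lambda>i. if i = K + j then 1 else 0) = a (K + j) [^] (1::int)"
      by (rule gcomb_delta[OF ac]) (use j in auto)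
    moreover have "a (K + j) [^] (1::int) = h" using j h by (simp add: a_def)
    ultimately have "h = gcomb G (K+M) a (\<lambda>i. if i = K + j then 1 else 0) \<otimes> gcomb G (K+M) b (\<lambda>_. 0)"
      using h by (simp add: gcomb_zero)
    then show ?thesis by blast
  qed
  show ?thesis unfolding sympl_pairs_def
    by (rule exI[of _ "K + M"], rule exI[of _ a], rule exI[of _ b]) (use ac bc W' gen in blast)
qed

end

section \<open>Matrices over the l-adic integers\<close>

text \<open>The image of an integer matrix among the l-adic ones. Identities for transvections are
  proved over the integers and transported by it.\<close>

definition zl_red :: "nat \<Rightarrow> nat \<Rightarrow> (nat \<Rightarrow> nat \<Rightarrow> int) \<Rightarrow> nat \<Rightarrow> nat \<Rightarrow> nat \<Rightarrow> int" where
  "zl_red l n A = (\<lambda>k i j. if i < n \<and> j < n then A i j mod int l ^ k else 0)"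

lemma mod_power_Suc: "(x mod int l ^ Suc k) mod int l ^ k = x mod int l ^ k"
  by (rule mod_mod_cancel) (simp add: le_imp_power_dvd)

lemma padic_mod: "l > 0 \<Longrightarrow> (\<And>k. x (Suc k) mod int l ^ k = x k mod int l ^ k) \<Longrightarrow>
    (\<lambda>k. x k mod int l ^ k) \<in> padic l"
  unfolding padic_def using mod_power_Suc by auto

lemma padic_Suc_mod: "x \<in> padic l \<Longrightarrow> x (Suc k) mod int l ^ k = x k"
  unfolding padic_def by (metis (mono_tags, lifting) mem_Collect_eq)

lemma padic_range:
  assumes "x \<in> padic l" shows "0 \<le> x k" "x k < int l ^ k"
  using assms unfolding padic_def by blast+

lemma padic_mod_self: "x \<in> padic l \<Longrightarrow> x k mod int l ^ k = x k"
  using padic_range[of x l k] by simp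

lemma padic_mod_le:
  assumes x: "x \<in> padic l" shows "x (k + j) mod int l ^ k = x k"
proof (induction j)
  case 0 then show ?case using padic_mod_self[OF x] by simp
next
  case (Suc j)
  have "x (k + j) mod int l ^ k = (x (Suc (k + j)) mod int l ^ (k + j)) mod int l ^ k"
    using padic_Suc_mod[OF x] by simp
  also have "\<dots> = x (Suc (k + j)) mod int l ^ k"
    by (rule mod_mod_cancel) (simp add: le_imp_power_dvd)
  finally show ?case using Suc by simp
qed

lemma padic_Suc_cong: "x \<in> padic l \<Longrightarrow> [x (Suc k) = x k] (mod int l ^ k)"
  using padic_Suc_mod[of x l k] padic_mod_self[of x l k] by (simp add: cong_def)

lemma padic_sum_mult:
  assumes "l > 0" "\<And>r. r < n \<Longrightarrow> a r \<in> padic l" "\<And>r. r < n \<Longrightarrow> b r \<in> padic l"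
  shows "(\<lambda>k. (\<Sum>r<n. a r k * b r k) mod int l ^ k) \<in> padic l"
proof (rule padic_mod[OF assms(1)])
  fix k
  have "[(\<Sum>r<n. a r (Suc k) * b r (Suc k)) = (\<Sum>r<n. a r k * b r k)] (mod int l ^ k)"
    by (intro cong_sum cong_mult padic_Suc_cong assms) auto
  then show "(\<Sum>r<n. a r (Suc k) * b r (Suc k)) mod int l ^ k = (\<Sum>r<n. a r k * b r k) mod int l ^ k"
    by (simp add: cong_def)
qed

lemma zl_red_mat: "l > 0 \<Longrightarrow> zl_red l n A \<in> zl_mat l n"
  unfolding zl_mat_def zl_red_def by (auto intro: padic_mod)

lemma zl_mmul_mat:
  assumes "l > 0" "A \<in> zl_mat l n" "B \<in> zl_mat l n" shows "zl_mmul l n A B \<in> zl_mat l n"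
proof -
  have "(\<lambda>k. (\<Sum>r<n. A k i r * B k r j) mod int l ^ k) \<in> padic l" if "i < n" "j < n" for i j
    using padic_sum_mult[OF assms(1), of n "\<lambda>r k. A k i r" "\<lambda>r k. B k r j"] assms(2,3) that
    by (auto simp: zl_mat_def)
  then show ?thesis by (auto simp: zl_mat_def zl_mmul_def)
qed

lemma sum_mult_mod_left: "(\<Sum>r\<in>I. (f r mod m) * h r) mod m = (\<Sum>r\<in>I. f r * h r) mod m" for m :: int
  by (rule cong_sum[unfolded cong_def]) (simp add: mod_mult_left_eq)

lemma sum_mult_mod_right: "(\<Sum>r\<in>I. h r * (f r mod m)) mod m = (\<Sum>r\<in>I. h r * f r) mod m" for m :: int
  by (rule cong_sum[unfolded cong_def]) (simp add: mod_mult_right_eq)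

lemma zl_mmul_red: "zl_mmul l n (zl_red l n A) (zl_red l n B) = zl_red l n (\<lambda>i j. \<Sum>r<n. A i r * B r j)"
proof -
  have "(\<Sum>r<n. zl_red l n A k i r * zl_red l n B k r j) mod int l ^ k = (\<Sum>r<n. A i r * B r j) mod int l ^ k"
    if "i < n" "j < n" for i j k
  proof -
    have "(\<Sum>r<n. zl_red l n A k i r * zl_red l n B k r j) = (\<Sum>r<n. (A i r mod int l ^ k) * (B r j mod int l ^ k))"
      by (rule sum.cong) (use that in \<open>auto simp: zl_red_def\<close>)
    then show ?thesis by (simp add: sum_mult_mod_left sum_mult_mod_right)
  qed
  then show ?thesis by (intro ext) (simp add: zl_mmul_def, auto simp: zl_red_def)
qed

lemma zl_red_cong: "(\<And>i j. i < n \<Longrightarrow> j < n \<Longrightarrow> A i j = B i j) \<Longrightarrow> zl_red l n A = zl_red l n B"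
  unfolding zl_red_def by (intro ext) auto

lemma zl_J_red: "zl_J l g = zl_red l (2*g) (intJ g)"
  unfolding zl_J_def zl_red_def intJ_def by (intro ext) auto

lemma zl_idmat_red: "zl_idmat l n = zl_red l n (\<lambda>i j. if i = j then 1 else 0)"
  unfolding zl_idmat_def zl_red_def by (intro ext) auto

lemma zl_transpose_red: "zl_transpose (zl_red l n A) = zl_red l n (\<lambda>i j. A j i)"
  unfolding zl_transpose_def zl_red_def by (intro ext) auto

lemma zl_msmul_one_red: "zl_msmul l 1 (zl_red l n A) = zl_red l n A"
  unfolding zl_msmul_def zl_red_def by (intro ext) auto

lemma zl_mmul_entry: "i < n \<and> j < n \<Longrightarrow> zl_mmul l n A B k i j = (\<Sum>r<n. A k i r * B k r j) mod int l ^ k"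
  by (simp add: zl_mmul_def)

lemma zl_mmul_outside: "\<not> (i < n \<and> j < n) \<Longrightarrow> zl_mmul l n A B k i j = 0"
  by (auto simp: zl_mmul_def)

lemma zl_mmul_assoc: "zl_mmul l n (zl_mmul l n A B) C = zl_mmul l n A (zl_mmul l n B C)"
proof -
  have *: "(\<Sum>r<n. zl_mmul l n A B k i r * C k r j) mod int l ^ k = (\<Sum>s<n. A k i s * zl_mmul l n B C k s j) mod int l ^ k"
    if "i < n" "j < n" for i j k
  proof -
    have "(\<Sum>r<n. zl_mmul l n A B k i r * C k r j) mod int l ^ k
      = (\<Sum>r<n. ((\<Sum>s<n. A k i s * B k s r) mod int l ^ k) * C k r j) mod int l ^ k"
      using that by (simp add: zl_mmul_def)
    also have "\<dots> = (\<Sum>r<n. \<Sum>s<n. A k i s * (B k s r * C k r j)) mod int l ^ k"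
      by (simp add: sum_mult_mod_left sum_distrib_right mult.assoc)
    also have "\<dots> = (\<Sum>s<n. A k i s * (\<Sum>r<n. B k s r * C k r j)) mod int l ^ k"
      by (subst sum.swap) (simp add: sum_distrib_left)
    also have "\<dots> = (\<Sum>s<n. A k i s * zl_mmul l n B C k s j) mod int l ^ k"
      using that by (simp add: zl_mmul_def sum_mult_mod_right)
    finally show ?thesis .
  qed
  then have "zl_mmul l n (zl_mmul l n A B) C k i j = zl_mmul l n A (zl_mmul l n B C) k i j" for k i j
  proof (cases "i < n \<and> j < n")
    case True
    then show ?thesis using * by (simp only: zl_mmul_entry)
  next
    case False
    then show ?thesis by (simp add: zl_mmul_outside del: de_Morgan_conj)
  qed
  then show ?thesis by (intro ext)
qed

lemma zl_transpose_mmul: "zl_transpose (zl_mmul l n A B) = zl_mmul l n (zl_transpose B) (zl_transpose A)"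
  unfolding zl_transpose_def zl_mmul_def by (intro ext) (auto simp: mult.commute)

lemma zl_mmul_msmul_right: "zl_mmul l n A (zl_msmul l c B) = zl_msmul l c (zl_mmul l n A B)"
  unfolding zl_mmul_def zl_msmul_def
  by (intro ext) (auto simp: sum_mult_mod_right mod_mult_right_eq sum_distrib_left mult.left_commute)

lemma zl_mmul_msmul_left: "zl_mmul l n (zl_msmul l c A) B = zl_msmul l c (zl_mmul l n A B)"
  unfolding zl_mmul_def zl_msmul_def
  by (intro ext) (auto simp: sum_mult_mod_left mod_mult_right_eq sum_distrib_left mult.assoc)

lemma zl_mmul_idmat:
  assumes "A \<in> zl_mat l n" shows "zl_mmul l n A (zl_idmat l n) = A"
proof (intro ext)
  fix k i j
  show "zl_mmul l n A (zl_idmat l n) k i j = A k i j"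
  proof (cases "i < n \<and> j < n")
    case True
    have "(\<Sum>r<n. A k i r * zl_idmat l n k r j) = (\<Sum>r<n. if r = j then A k i j * (1 mod int l ^ k) else 0)"
      by (rule sum.cong) (use True in \<open>auto simp: zl_idmat_def\<close>)
    also have "\<dots> = A k i j * (1 mod int l ^ k)" using True by simp
    finally have "zl_mmul l n A (zl_idmat l n) k i j = (A k i j * (1 mod int l ^ k)) mod int l ^ k"
      using True by (simp add: zl_mmul_def)
    also have "\<dots> = A k i j" unfolding mod_mult_right_eq
      using padic_mod_self[of "\<lambda>k. A k i j" l k] assms True by (simp add: zl_mat_def)
    finally show ?thesis .
  next
    case False
    then show ?thesis using assms by (auto simp: zl_mmul_def zl_mat_def)
  qed
qed

text \<open>With multiplier 1 the set \<open>gsp_coset\<close> plays the part of Sp, and this says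
  that Sp acts by left multiplication on the space of the measure.\<close>

lemma gsp_coset_mult:
  assumes l: "l > 0" and S: "S \<in> gsp_coset l g 1" and F: "F \<in> gsp_coset l g q"
  shows "zl_mmul l (2*g) S F \<in> gsp_coset l g q"
proof -
  let ?n = "2*g"
  let ?m = "zl_mmul l ?n"
  obtain N where N: "N \<in> zl_mat l ?n" "?m F N = zl_idmat l ?n" using F by (auto simp: gsp_coset_def)
  obtain N' where N': "N' \<in> zl_mat l ?n" "?m S N' = zl_idmat l ?n" using S by (auto simp: gsp_coset_def)
  have Sm: "S \<in> zl_mat l ?n" and Fm: "F \<in> zl_mat l ?n" using S F by (auto simp: gsp_coset_def)
  have "?m (?m S F) (?m N N') = ?m S (?m (?m F N) N')" by (simp only: zl_mmul_assoc)
  also have "\<dots> = ?m (?m S (zl_idmat l ?n)) N'" by (simp only: zl_mmul_assoc N)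
  also have "\<dots> = zl_idmat l ?n" by (simp only: zl_mmul_idmat[OF Sm] N')
  finally have 1: "?m (?m S F) (?m N N') = zl_idmat l ?n" .
  have "?m (?m (?m S F) (zl_J l g)) (zl_transpose (?m S F))
     = ?m (?m S (?m (?m F (zl_J l g)) (zl_transpose F))) (zl_transpose S)"
    by (simp only: zl_mmul_assoc zl_transpose_mmul)
  also have "?m (?m F (zl_J l g)) (zl_transpose F) = zl_msmul l (int q) (zl_J l g)"
    using F by (simp add: gsp_coset_def)
  also have "?m (?m S (zl_msmul l (int q) (zl_J l g))) (zl_transpose S)
     = zl_msmul l (int q) (?m (?m S (zl_J l g)) (zl_transpose S))"
    by (simp only: zl_mmul_msmul_left zl_mmul_msmul_right)
  also have "?m (?m S (zl_J l g)) (zl_transpose S) = zl_J l g"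
    using S by (simp add: gsp_coset_def zl_J_red zl_msmul_one_red)
  finally have 2: "?m (?m (?m S F) (zl_J l g)) (zl_transpose (?m S F)) = zl_msmul l (int q) (zl_J l g)" .
  show ?thesis unfolding gsp_coset_def
    using 1 2 zl_mmul_mat[OF l Sm Fm] zl_mmul_mat[OF l N(1) N'(1)] by blast
qed

section \<open>The symplectic form on rows and the matrices of transvections\<close>

lemma sum_intJ_right: assumes "s < 2*g" shows "(\<Sum>r<2*g. intJ g s r * v r) = sympl_dual g v s"
proof (cases "s < g")
  case True
  have "(\<Sum>r<2*g. intJ g s r * v r) = (\<Sum>r<2*g. if r = g + s then v r else 0)"
    by (rule sum.cong) (use True in \<open>auto simp: intJ_def\<close>)
  then show ?thesis using True by (simp add: sympl_dual_def)
next
  case False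
  have "(\<Sum>r<2*g. intJ g s r * v r) = (\<Sum>r<2*g. if r = s - g then - v r else 0)"
    by (rule sum.cong) (use False assms in \<open>auto simp: intJ_def\<close>)
  then show ?thesis using False assms by (simp add: sympl_dual_def)
qed

lemma sympl_gram: "(\<Sum>r<2*g. (\<Sum>s<2*g. v s * intJ g s r) * w r) = sympl g v w"
proof -
  have "(\<Sum>r<2*g. (\<Sum>s<2*g. v s * intJ g s r) * w r) = (\<Sum>s<2*g. v s * (\<Sum>r<2*g. intJ g s r * w r))"
    unfolding sum_distrib_right sum_distrib_left by (subst sum.swap) (simp add: mult.assoc)
  also have "\<dots> = (\<Sum>s<2*g. v s * sympl_dual g w s)"
    by (rule sum.cong) (simp_all add: sum_intJ_right)
  also have "\<dots> = sympl g v w"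
    unfolding sum_halves sympl_def by (rule sum.cong) (auto simp: sympl_dual_def algebra_simps)
  finally show ?thesis .
qed

text \<open>Reads the matrix identity F J F^T = q J at one level as symplectic products of rows, the
  form that \<open>tup_wedge_gsp\<close> takes.\<close>

lemma sympl_gram_cong:
  assumes "F \<in> gsp_coset l g q" "a < 2*g" "b < 2*g"
  shows "[sympl g (F k a) (F k b) = int q * intJ g a b] (mod int l ^ k)"
proof -
  let ?n = "2*g"
  have "zl_mmul l ?n (zl_mmul l ?n F (zl_J l g)) (zl_transpose F) k a b = zl_msmul l (int q) (zl_J l g) k a b"
    using assms(1) by (simp add: gsp_coset_def)
  moreover have "zl_mmul l ?n (zl_mmul l ?n F (zl_J l g)) (zl_transpose F) k a b
     = (\<Sum>r<?n. ((\<Sum>s<?n. F k a s * (intJ g s r mod int l ^ k)) mod int l ^ k) * F k b r) mod int l ^ k"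
    using assms(2,3) by (simp add: zl_mmul_def zl_transpose_def zl_J_red zl_red_def)
  moreover have "\<dots> = (\<Sum>r<?n. (\<Sum>s<?n. F k a s * intJ g s r) * F k b r) mod int l ^ k"
    by (simp only: sum_mult_mod_right sum_mult_mod_left)
  moreover have "\<dots> = sympl g (F k a) (F k b) mod int l ^ k" by (simp only: sympl_gram)
  moreover have "zl_msmul l (int q) (zl_J l g) k a b = (int q * intJ g a b) mod int l ^ k"
    using assms(2,3) by (simp add: zl_msmul_def zl_J_red zl_red_def mod_mult_right_eq)
  ultimately show ?thesis by (simp add: cong_def)
qed

lemma gsp_coset_inverse:
  assumes "F \<in> gsp_coset l g q"
  obtains N where "\<And>i j. i < 2*g \<Longrightarrow> j < 2*g \<Longrightarrow>
    [(\<Sum>r<2*g. F k i r * N r j) = (if i = j then 1 else 0)] (mod int l ^ k)"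
proof -
  obtain N where N: "zl_mmul l (2*g) F N = zl_idmat l (2*g)" using assms by (auto simp: gsp_coset_def)
  have "[(\<Sum>r<2*g. F k i r * N k r j) = (if i = j then 1 else 0)] (mod int l ^ k)" if "i < 2*g" "j < 2*g" for i j
    using fun_cong[OF fun_cong[OF fun_cong[OF N, of k], of i], of j] that
    by (simp add: zl_mmul_def zl_idmat_def cong_def split: if_splits)
  then show thesis by (rule that)
qed

definition transv_mat :: "nat \<Rightarrow> int \<Rightarrow> (nat \<Rightarrow> int) \<Rightarrow> nat \<Rightarrow> nat \<Rightarrow> int" where
  "transv_mat g c u = (\<lambda>i r. (if r = i then 1 else 0) + (c * u i) * sympl_dual g u r)"

lemma sympl_basis: "i < 2*g \<Longrightarrow> j < 2*g \<Longrightarrow>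
    sympl g (\<lambda>r. if r = i then 1 else 0) (\<lambda>r. if r = j then 1 else 0) = intJ g i j"
proof -
  assume ij: "i < 2*g" "j < 2*g"
  have "sympl g (\<lambda>r. if r = i then 1 else 0) w = sympl_dual g w i" for w
  proof -
    have "sympl g (\<lambda>r. if r = i then 1 else 0) w = (\<Sum>s<2*g. (if s = i then 1 else 0) * sympl_dual g w s)"
      unfolding sum_halves sympl_def by (rule sum.cong) (auto simp: sympl_dual_def)
    also have "\<dots> = (\<Sum>s<2*g. if s = i then sympl_dual g w s else 0)"
      by (rule sum.cong) auto
    finally show ?thesis using ij by simp
  qed
  then show ?thesis using ij by (auto simp: sympl_dual_def intJ_def)
qed

lemma lincomb_basis: "i < n \<Longrightarrow> lincomb n u (\<lambda>r. if r = i then 1 else 0) = u i" for u :: "nat \<Rightarrow> int"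
proof -
  assume "i < n"
  have "lincomb n u (\<lambda>r. if r = i then 1 else 0 :: int) = (\<Sum>r<n. if r = i then u r else 0)"
    unfolding lincomb_int by (rule sum.cong) auto
  then show ?thesis using \<open>i < n\<close> by simp
qed

lemma transv_mat_sympl:
  assumes "i < 2*g" "j < 2*g"
  shows "sympl g (transv_mat g c u i) (transv_mat g c u j) = intJ g i j"
  unfolding transv_mat_def sympl_add_left sympl_add_right sympl_scale_left sympl_scale_right
    sympl_dual_left sympl_dual_right lincomb_basis[OF assms(1)] lincomb_basis[OF assms(2)]
    sympl_basis[OF assms] lincomb_dual_self
  by simp

text \<open>The product of the two rank one parts contains the factor u.Ju = 0, so changing the sign
  of c inverts the matrix.\<close>

lemma transv_mat_inverse:
  assumes "i < 2*g" "j < 2*g"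
  shows "(\<Sum>r<2*g. transv_mat g c u i r * transv_mat g (- c) u r j) = (if i = j then 1 else 0)"
proof -
  let ?J = "sympl_dual g u"
  have "(\<Sum>r<2*g. transv_mat g c u i r * transv_mat g (- c) u r j)
    = (\<Sum>r<2*g. (if r = i then (if r = j then 1 else 0) - c * u r * ?J j else 0)
        + (if r = j then c * u i * ?J r else 0) - (c * c * u i * ?J j) * (u r * ?J r))"
    by (rule sum.cong) (auto simp: transv_mat_def algebra_simps)
  also have "\<dots> = (if i = j then 1 else 0) - (c * c * u i * ?J j) * (\<Sum>r<2*g. u r * ?J r)"
    using assms by (simp add: sum.distrib sum_subtractf sum_distrib_left)
  also have "(\<Sum>r<2*g. u r * ?J r) = 0" using lincomb_dual_self[of g u] by (simp only: lincomb_int)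
  finally show ?thesis by simp
qed

lemma transv_mat_gsp:
  assumes "l > 0" shows "zl_red l (2*g) (transv_mat g c u) \<in> gsp_coset l g 1"
proof -
  let ?n = "2*g"
  let ?T = "zl_red l ?n (transv_mat g c u)"
  have "zl_mmul l ?n ?T (zl_red l ?n (transv_mat g (- c) u)) = zl_idmat l ?n"
    unfolding zl_mmul_red zl_idmat_red by (rule zl_red_cong) (simp add: transv_mat_inverse)
  moreover have "zl_mmul l ?n (zl_mmul l ?n ?T (zl_J l g)) (zl_transpose ?T) = zl_msmul l (int 1) (zl_J l g)"
    unfolding zl_J_red zl_transpose_red zl_mmul_red of_nat_1 zl_msmul_one_red
    by (rule zl_red_cong) (simp add: sympl_gram transv_mat_sympl)
  ultimately show ?thesis unfolding gsp_coset_def using zl_red_mat[OF assms] by blast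
qed

lemma zl_mmul_red_level:
  assumes "r < n" "j < n"
  shows "zl_mmul l n (zl_red l n A) F k r j = (\<Sum>s<n. A r s * F k s j) mod int l ^ k"
proof -
  have "zl_mmul l n (zl_red l n A) F k r j = (\<Sum>s<n. (A r s mod int l ^ k) * F k s j) mod int l ^ k"
    using assms by (simp add: zl_mmul_def zl_red_def)
  then show ?thesis by (simp only: sum_mult_mod_left)
qed

lemma finite_zl_mat_level: "l > 0 \<Longrightarrow> finite ((\<lambda>F. F k) ` zl_mat l n)"
proof -
  assume l: "l > 0"
  let ?f = "\<lambda>M :: nat \<times> nat \<Rightarrow> int. \<lambda>i j. if i < n \<and> j < n then M (i, j) else 0"
  have "F k \<in> ?f ` (({..<n} \<times> {..<n}) \<rightarrow>\<^sub>E {0..<int l ^ k})" if F: "F \<in> zl_mat l n" for F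
  proof
    show "F k = ?f (\<lambda>p\<in>{..<n} \<times> {..<n}. F k (fst p) (snd p))"
      using F by (intro ext) (auto simp: zl_mat_def)
    have "0 \<le> F k i j \<and> F k i j < int l ^ k" if "i < n" "j < n" for i j
      using padic_range[of "\<lambda>k. F k i j" l k] F that by (auto simp: zl_mat_def)
    then show "(\<lambda>p\<in>{..<n} \<times> {..<n}. F k (fst p) (snd p)) \<in> ({..<n} \<times> {..<n}) \<rightarrow>\<^sub>E {0..<int l ^ k}"
      by auto
  qed
  then have "(\<lambda>F. F k) ` zl_mat l n \<subseteq> ?f ` (({..<n} \<times> {..<n}) \<rightarrow>\<^sub>E {0..<int l ^ k})" by blast
  moreover have "finite (?f ` (({..<n} \<times> {..<n}) \<rightarrow>\<^sub>E {0..<int l ^ k}))"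
    by (intro finite_imageI finite_PiE) auto
  ultimately show ?thesis by (rule finite_subset)
qed

section \<open>The cokernel of P(F)\<close>

lemma zl_vec_padic: "v \<in> zl_vec l n \<Longrightarrow> i < n \<Longrightarrow> (\<lambda>k. v k i) \<in> padic l"
  by (simp add: zl_vec_def)

lemma zl_vecI: "(\<And>i. i < n \<Longrightarrow> (\<lambda>k. v k i) \<in> padic l) \<Longrightarrow> (\<And>k i. n \<le> i \<Longrightarrow> v k i = 0) \<Longrightarrow> v \<in> zl_vec l n"
  by (simp add: zl_vec_def)

lemma zl_vec_eqI:
  assumes "v \<in> zl_vec l n" "w \<in> zl_vec l n" "\<And>k i. i < n \<Longrightarrow> [v k i = w k i] (mod int l ^ k)"
  shows "v = w"
proof (intro ext)
  fix k i show "v k i = w k i"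
  proof (cases "i < n")
    case True
    then show ?thesis
      using assms(3)[of i k] padic_mod_self[OF zl_vec_padic[OF assms(1)], of i k]
        padic_mod_self[OF zl_vec_padic[OF assms(2)], of i k] by (simp add: cong_def)
  qed (use assms in \<open>auto simp: zl_vec_def\<close>)
qed

lemma zl_vec_redI:
  assumes "l > 0" "\<And>k i. i < n \<Longrightarrow> [x (Suc k) i = x k i] (mod int l ^ k)"
  shows "(\<lambda>k i. if i < n then x k i mod int l ^ k else 0) \<in> zl_vec l n"
  using assms by (intro zl_vecI) (auto intro!: padic_mod simp: cong_def)

lemma zl_vec_Suc_cong: "v \<in> zl_vec l n \<Longrightarrow> i < n \<Longrightarrow> [v (Suc k) i = v k i] (mod int l ^ k)"
  using padic_Suc_cong[OF zl_vec_padic] by auto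

lemma zl_vadd_vec: "l > 0 \<Longrightarrow> v \<in> zl_vec l n \<Longrightarrow> w \<in> zl_vec l n \<Longrightarrow> zl_vadd l n v w \<in> zl_vec l n"
  unfolding zl_vadd_def by (intro zl_vec_redI cong_add zl_vec_Suc_cong) auto

lemma zl_vadd_cong: "i < n \<Longrightarrow> [zl_vadd l n v w k i = v k i + w k i] (mod int l ^ k)"
  by (simp add: zl_vadd_def cong_def)

lemma zl_mvec_cong: "i < n \<Longrightarrow> [zl_mvec l n A v k i = (\<Sum>r<n. A k i r * v k r)] (mod int l ^ k)"
  by (simp add: zl_mvec_def cong_def)

lemma zl_mvec_vec:
  assumes "l > 0" "A \<in> zl_mat l n" "v \<in> zl_vec l n" shows "zl_mvec l n A v \<in> zl_vec l n"
  unfolding zl_mvec_def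
proof (intro zl_vec_redI assms(1) cong_sum cong_mult)
  fix k i r assume "i < n" "r \<in> {..<n}"
  then show "[A (Suc k) i r = A k i r] (mod int l ^ k)" "[v (Suc k) r = v k r] (mod int l ^ k)"
    using padic_Suc_cong[of "\<lambda>k. A k i r" l k] assms(2) zl_vec_Suc_cong[OF assms(3)] by (auto simp: zl_mat_def)
qed

lemma zl_vzero_vec: "l > 0 \<Longrightarrow> zl_vzero \<in> zl_vec l n"
  by (auto simp: zl_vzero_def zl_vec_def padic_def)

lemma zl_basis_vec: "l > 0 \<Longrightarrow> zl_basis l n j \<in> zl_vec l n"
proof -
  assume "l > 0"
  then have "(\<lambda>k i. if i < n then (if i = j \<and> j < n then 1 else 0) mod int l ^ k else 0) \<in> zl_vec l n"
    by (rule zl_vec_redI) simp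
  also have "(\<lambda>k i. if i < n then (if i = j \<and> j < n then 1 else 0) mod int l ^ k else 0) = zl_basis l n j"
    by (intro ext) (auto simp: zl_basis_def)
  finally show ?thesis .
qed

definition zl_vscale :: "nat \<Rightarrow> nat \<Rightarrow> int \<Rightarrow> (nat \<Rightarrow> nat \<Rightarrow> int) \<Rightarrow> (nat \<Rightarrow> nat \<Rightarrow> int)" where
  "zl_vscale l n a v = (\<lambda>k i. if i < n then (a * v k i) mod int l ^ k else 0)"

lemma zl_vscale_vec: "l > 0 \<Longrightarrow> v \<in> zl_vec l n \<Longrightarrow> zl_vscale l n a v \<in> zl_vec l n"
  unfolding zl_vscale_def by (rule zl_vec_redI) (auto intro: cong_mult[OF cong_refl zl_vec_Suc_cong])

lemma zl_vscale_cong: "i < n \<Longrightarrow> [zl_vscale l n a v k i = a * v k i] (mod int l ^ k)"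
  by (simp add: zl_vscale_def cong_def)

text \<open>w is (v - v_K) / l^K. Level k of w is computed from level k + K of v, so that dividing
  by l^K still leaves k digits.\<close>

lemma zl_vec_divide:
  assumes l: "l > 0" and v: "v \<in> zl_vec l n"
  obtains w where "w \<in> zl_vec l n" "\<And>k i. i < n \<Longrightarrow> [v k i = v K i + int l ^ K * w k i] (mod int l ^ k)"
proof -
  define w where "w k i = v (k + K) i div int l ^ K" for k i
  have lK: "int l ^ K > 0" using l by simp
  have iter: "v (k + j) i mod int l ^ k = v k i" if "i < n" for k j i
    using padic_mod_le[OF zl_vec_padic[OF v that]] .
  have "w \<in> zl_vec l n"
  proof (rule zl_vecI)
    fix i assume i: "i < n"
    show "(\<lambda>k. w k i) \<in> padic l"
      unfolding padic_def
    proof (intro CollectI allI conjI)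
      fix k
      note r = padic_range[OF zl_vec_padic[OF v i], of "k + K"]
      show "0 \<le> w k i" using r lK by (simp add: w_def pos_imp_zdiv_nonneg_iff)
      have "int l ^ K * w k i \<le> v (k + K) i"
        using lK mult_div_mod_eq[of "int l ^ K" "v (k + K) i"] pos_mod_sign[OF lK, of "v (k + K) i"]
        unfolding w_def by linarith
      also have "\<dots> < int l ^ K * int l ^ k" using r(2) by (simp add: power_add mult.commute)
      finally show "w k i < int l ^ k" using lK by (simp only: mult_less_cancel_left_pos)
      have "v (k + K) i = v (Suc k + K) i mod (int l ^ K * int l ^ k)"
        using padic_Suc_mod[OF zl_vec_padic[OF v i], of "k + K"] by (simp add: power_add mult.commute)
      then show "w k i = w (Suc k) i mod int l ^ k"
        unfolding w_def using lK by (simp add: zmod_zmult2_eq)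
    qed
  next
    fix k i assume "n \<le> i" then show "w k i = 0" using v by (simp add: w_def zl_vec_def)
  qed
  moreover have "[v k i = v K i + int l ^ K * w k i] (mod int l ^ k)" if i: "i < n" for k i
  proof -
    have "v K i = v (k + K) i mod int l ^ K" using iter[OF i, of K k] by (simp add: add.commute)
    then have "v K i + int l ^ K * w k i = v (k + K) i" by (simp add: w_def)
    moreover have "v k i = v (k + K) i mod int l ^ k" using iter[OF i, of k K] by simp
    ultimately show ?thesis by (simp add: cong_def)
  qed
  ultimately show thesis by (rule that)
qed

text \<open>Continuity is automatic: in v = v_K + l^K w the second summand is sent to the identity,
  because l^K kills the group. The first summand is a vector of nonnegative integers and is
  assembled one coordinate at a time by the truncations \<open>P j\<close>.\<close>

lemma (in comm_group) zl_vec_hom: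
  assumes l: "l > 0" and tors: "\<And>x. x \<in> carrier G \<Longrightarrow> x [^] (int l ^ K) = \<one>"
    and c: "\<And>v. v \<in> zl_vec l n \<Longrightarrow> \<phi> v \<in> carrier G"
    and add: "\<And>v w. v \<in> zl_vec l n \<Longrightarrow> w \<in> zl_vec l n \<Longrightarrow> \<phi> (zl_vadd l n v w) = \<phi> v \<otimes> \<phi> w"
    and v: "v \<in> zl_vec l n"
  shows "\<phi> v = gcomb G n (\<lambda>i. \<phi> (zl_basis l n i)) (v K)"
proof -
  have zero: "\<phi> zl_vzero = \<one>"
  proof -
    have z: "zl_vzero \<in> zl_vec l n" using l by (rule zl_vzero_vec)
    have "zl_vadd l n zl_vzero zl_vzero = zl_vzero" by (intro ext) (simp add: zl_vadd_def zl_vzero_def)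
    then have "\<phi> zl_vzero \<otimes> \<phi> zl_vzero = \<phi> zl_vzero" using add[OF z z] by simp
    then show ?thesis using c[OF z] by simp
  qed
  have scale: "\<phi> (zl_vscale l n (int a) w) = \<phi> w [^] int a" if w: "w \<in> zl_vec l n" for a w
  proof (induction a)
    case 0
    have "zl_vscale l n (int 0) w = zl_vzero" by (intro ext) (simp add: zl_vscale_def zl_vzero_def)
    then show ?case using zero by simp
  next
    case (Suc a)
    have "zl_vscale l n (int (Suc a)) w = zl_vadd l n (zl_vscale l n (int a) w) w"
    proof (rule zl_vec_eqI[OF zl_vscale_vec zl_vadd_vec[OF _ zl_vscale_vec]])
      fix k i assume i: "i < n"
      have "[int (Suc a) * w k i = int a * w k i + w k i] (mod int l ^ k)" by (simp add: algebra_simps)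
      then show "[zl_vscale l n (int (Suc a)) w k i = zl_vadd l n (zl_vscale l n (int a) w) w k i] (mod int l ^ k)"
        by (meson cong_add cong_refl cong_sym cong_trans i zl_vadd_cong zl_vscale_cong)
    qed (use l w in auto)
    then have "\<phi> (zl_vscale l n (int (Suc a)) w) = \<phi> w [^] int a \<otimes> \<phi> w"
      using add[OF zl_vscale_vec[OF l w] w] Suc by simp
    also have "\<dots> = \<phi> w [^] (int a + 1)" using c[OF w] by (simp add: int_pow_mult)
    also have "int a + 1 = int (Suc a)" by simp
    finally show ?case .
  qed
  define P where "P j = (\<lambda>k i. if i < n then (if i < j then v K i else 0) mod int l ^ k else 0)" for j
  have P: "P j \<in> zl_vec l n" for j unfolding P_def by (rule zl_vec_redI[OF l]) simp
  have "\<phi> (P j) = gcomb G j (\<lambda>i. \<phi> (zl_basis l n i)) (v K)" if "j \<le> n" for j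
    using that
  proof (induction j)
    case 0
    have "P 0 = zl_vzero" by (intro ext) (simp add: P_def zl_vzero_def)
    then show ?case using zero by simp
  next
    case (Suc j)
    then have j: "j < n" by simp
    define a where "a = nat (v K j)"
    have a: "v K j = int a" using padic_range(1)[OF zl_vec_padic[OF v j]] by (simp add: a_def)
    note b = zl_basis_vec[OF l, of n j]
    have "P (Suc j) = zl_vadd l n (P j) (zl_vscale l n (int a) (zl_basis l n j))"
    proof (rule zl_vec_eqI[OF P zl_vadd_vec[OF l P zl_vscale_vec[OF l b]]])
      fix k i assume i: "i < n"
      have "[zl_vadd l n (P j) (zl_vscale l n (int a) (zl_basis l n j)) k i
        = (if i < j then v K i else 0) + int a * (if i = j then 1 else 0)] (mod int l ^ k)"
      proof (rule cong_trans[OF zl_vadd_cong[OF i]], rule cong_add)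
        show "[P j k i = (if i < j then v K i else 0)] (mod int l ^ k)" using i by (simp add: P_def cong_def)
        have "[int a * zl_basis l n j k i = int a * (if i = j then 1 else 0)] (mod int l ^ k)"
          by (rule cong_mult[OF cong_refl]) (use i in \<open>auto simp: zl_basis_def cong_def\<close>)
        then show "[zl_vscale l n (int a) (zl_basis l n j) k i = int a * (if i = j then 1 else 0)] (mod int l ^ k)"
          by (rule cong_trans[OF zl_vscale_cong[OF i]])
      qed
      moreover have "[P (Suc j) k i = (if i < Suc j then v K i else 0)] (mod int l ^ k)"
        using i by (simp add: P_def cong_def)
      moreover have "(if i < j then v K i else 0) + int a * (if i = j then 1 else 0) = (if i < Suc j then v K i else 0)"
        using a by (auto simp: less_Suc_eq)
      ultimately show "[P (Suc j) k i = zl_vadd l n (P j) (zl_vscale l n (int a) (zl_basis l n j)) k i] (mod int l ^ k)"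
        by (simp only: cong_def)
    qed
    then have "\<phi> (P (Suc j)) = \<phi> (P j) \<otimes> \<phi> (zl_basis l n j) [^] int a"
      using add[OF P zl_vscale_vec[OF l b]] scale[OF b] by simp
    then show ?case using Suc a by simp
  qed
  then have Pn: "\<phi> (P n) = gcomb G n (\<lambda>i. \<phi> (zl_basis l n i)) (v K)" by simp
  obtain w where w: "w \<in> zl_vec l n" "\<And>k i. i < n \<Longrightarrow> [v k i = v K i + int l ^ K * w k i] (mod int l ^ k)"
    using zl_vec_divide[OF l v] by blast
  have "v = zl_vadd l n (P n) (zl_vscale l n (int (l ^ K)) w)"
  proof (rule zl_vec_eqI[OF v zl_vadd_vec[OF l P zl_vscale_vec[OF l w(1)]]])
    fix k i assume i: "i < n"
    have "[zl_vadd l n (P n) (zl_vscale l n (int (l ^ K)) w) k i = v K i + int l ^ K * w k i] (mod int l ^ k)"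
    proof (rule cong_trans[OF zl_vadd_cong[OF i]], rule cong_add)
      show "[P n k i = v K i] (mod int l ^ k)" using i by (simp add: P_def cong_def)
      show "[zl_vscale l n (int (l ^ K)) w k i = int l ^ K * w k i] (mod int l ^ k)"
        using zl_vscale_cong[OF i, of l "int (l ^ K)" w k] by simp
    qed
    then show "[v k i = zl_vadd l n (P n) (zl_vscale l n (int (l ^ K)) w) k i] (mod int l ^ k)"
      using w(2)[OF i, of k] cong_sym cong_trans by blast
  qed
  then have "\<phi> v = \<phi> (P n) \<otimes> \<phi> w [^] int (l ^ K)"
    using add[OF P zl_vscale_vec[OF l w(1)]] scale[OF w(1)] by metis
  also have "\<phi> w [^] int (l ^ K) = \<one>" using tors[OF c[OF w(1)]] by simp
  finally have "\<phi> v = \<phi> (P n) \<otimes> \<one>" .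
  then have "\<phi> v = \<phi> (P n)" using c[OF P] by simp
  then show ?thesis using Pn by simp
qed

text \<open>Replaces equality of normalised residues by congruences at every level, with one witness
  u for all levels, so that the following proofs become congruence calculations.\<close>

lemma coker_rel_iff:
  assumes l: "l > 0"
  shows "(v, w) \<in> coker_rel l n B \<longleftrightarrow> v \<in> zl_vec l n \<and> w \<in> zl_vec l n \<and>
    (\<exists>u\<in>zl_vec l n. \<forall>k. \<forall>i<n. [v k i = w k i + (\<Sum>r<n. B k i r * u k r)] (mod int l ^ k))"
proof -
  have "v = zl_vadd l n w (zl_mvec l n B u) \<longleftrightarrow>
      (\<forall>k. \<forall>i<n. [v k i = w k i + (\<Sum>r<n. B k i r * u k r)] (mod int l ^ k))"
    if v: "v \<in> zl_vec l n" for u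
  proof
    assume e: "v = zl_vadd l n w (zl_mvec l n B u)"
    show "\<forall>k. \<forall>i<n. [v k i = w k i + (\<Sum>r<n. B k i r * u k r)] (mod int l ^ k)"
    proof (intro allI impI)
      fix k i assume i: "i < n"
      show "[v k i = w k i + (\<Sum>r<n. B k i r * u k r)] (mod int l ^ k)"
        unfolding e by (rule cong_trans[OF zl_vadd_cong[OF i]], rule cong_add[OF cong_refl], rule zl_mvec_cong[OF i])
    qed
  next
    assume c: "\<forall>k. \<forall>i<n. [v k i = w k i + (\<Sum>r<n. B k i r * u k r)] (mod int l ^ k)"
    show "v = zl_vadd l n w (zl_mvec l n B u)"
    proof (intro ext)
      fix k i show "v k i = zl_vadd l n w (zl_mvec l n B u) k i"
      proof (cases "i < n")
        case True
        have "v k i = v k i mod int l ^ k" using padic_mod_self[OF zl_vec_padic[OF v True], of k] by simp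
        also have "\<dots> = (w k i + (\<Sum>r<n. B k i r * u k r)) mod int l ^ k" using c True by (simp add: cong_def)
        also have "\<dots> = zl_vadd l n w (zl_mvec l n B u) k i"
          using True by (simp add: zl_vadd_def zl_mvec_def mod_add_right_eq)
        finally show ?thesis .
      next
        case False then show ?thesis using v by (simp add: zl_vec_def zl_vadd_def)
      qed
    qed
  qed
  then show ?thesis unfolding coker_rel_def by blast
qed

section \<open>The cokernel as a quotient and its operations\<close>

lemma coker_rel_refl: "l > 0 \<Longrightarrow> v \<in> zl_vec l n \<Longrightarrow> (v, v) \<in> coker_rel l n B"
  unfolding coker_rel_iff using zl_vzero_vec[of l n] by (auto simp: zl_vzero_def intro!: bexI[of _ zl_vzero])

lemma coker_rel_sym:
  assumes l: "l > 0" and vw: "(v, w) \<in> coker_rel l n B" shows "(w, v) \<in> coker_rel l n B"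
proof -
  obtain u where u: "u \<in> zl_vec l n" "\<And>k i. i < n \<Longrightarrow> [v k i = w k i + (\<Sum>r<n. B k i r * u k r)] (mod int l ^ k)"
    and m: "v \<in> zl_vec l n" "w \<in> zl_vec l n"
    using vw unfolding coker_rel_iff[OF l] by blast
  let ?u = "zl_vscale l n (-1) u"
  have "[w k i = v k i + (\<Sum>r<n. B k i r * ?u k r)] (mod int l ^ k)" if i: "i < n" for k i
  proof -
    have "[(\<Sum>r<n. B k i r * ?u k r) = (\<Sum>r<n. B k i r * (-1 * u k r))] (mod int l ^ k)"
      by (intro cong_sum cong_mult cong_refl zl_vscale_cong) auto
    then have "[v k i + (\<Sum>r<n. B k i r * ?u k r) = (w k i + (\<Sum>r<n. B k i r * u k r)) + (\<Sum>r<n. B k i r * (-1 * u k r))] (mod int l ^ k)"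
      by (intro cong_add u(2) i)
    then show ?thesis by (simp add: sum_negf cong_sym)
  qed
  then show ?thesis unfolding coker_rel_iff[OF l] using m zl_vscale_vec[OF l u(1)] by blast
qed

lemma coker_rel_add:
  assumes l: "l > 0" and vw: "(v, w) \<in> coker_rel l n B" and vw': "(v', w') \<in> coker_rel l n B"
  shows "(zl_vadd l n v v', zl_vadd l n w w') \<in> coker_rel l n B"
proof -
  obtain u where u: "u \<in> zl_vec l n" "\<And>k i. i < n \<Longrightarrow> [v k i = w k i + (\<Sum>r<n. B k i r * u k r)] (mod int l ^ k)"
    and m: "v \<in> zl_vec l n" "w \<in> zl_vec l n"
    using vw unfolding coker_rel_iff[OF l] by blast
  obtain u' where u': "u' \<in> zl_vec l n" "\<And>k i. i < n \<Longrightarrow> [v' k i = w' k i + (\<Sum>r<n. B k i r * u' k r)] (mod int l ^ k)"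
    and m': "v' \<in> zl_vec l n" "w' \<in> zl_vec l n"
    using vw' unfolding coker_rel_iff[OF l] by blast
  have "[zl_vadd l n v v' k i = zl_vadd l n w w' k i + (\<Sum>r<n. B k i r * zl_vadd l n u u' k r)] (mod int l ^ k)"
    if i: "i < n" for k i
  proof -
    have "[(\<Sum>r<n. B k i r * zl_vadd l n u u' k r) = (\<Sum>r<n. B k i r * (u k r + u' k r))] (mod int l ^ k)"
      by (intro cong_sum cong_mult cong_refl zl_vadd_cong) auto
    then have "[zl_vadd l n w w' k i + (\<Sum>r<n. B k i r * zl_vadd l n u u' k r)
       = (w k i + w' k i) + (\<Sum>r<n. B k i r * (u k r + u' k r))] (mod int l ^ k)"
      by (intro cong_add zl_vadd_cong i)
    also have "(w k i + w' k i) + (\<Sum>r<n. B k i r * (u k r + u' k r))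
      = (w k i + (\<Sum>r<n. B k i r * u k r)) + (w' k i + (\<Sum>r<n. B k i r * u' k r))"
      by (simp add: sum.distrib distrib_left)
    also have "[\<dots> = v k i + v' k i] (mod int l ^ k)"
      by (rule cong_add[OF cong_sym[OF u(2)[OF i]] cong_sym[OF u'(2)[OF i]]])
    also have "[v k i + v' k i = zl_vadd l n v v' k i] (mod int l ^ k)"
      by (rule cong_sym[OF zl_vadd_cong[OF i]])
    finally show ?thesis by (rule cong_sym)
  qed
  then show ?thesis unfolding coker_rel_iff[OF l] using m m' zl_vadd_vec[OF l] u(1) u'(1) by blast
qed

text \<open>Adding the two relations relates v + w to w + z, and w cancels.\<close>

lemma coker_rel_trans:
  assumes l: "l > 0" and vw: "(v, w) \<in> coker_rel l n B" and wz: "(w, z) \<in> coker_rel l n B"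
  shows "(v, z) \<in> coker_rel l n B"
proof -
  obtain u where u: "u \<in> zl_vec l n" "\<And>k i. i < n \<Longrightarrow>
      [zl_vadd l n v w k i = zl_vadd l n w z k i + (\<Sum>r<n. B k i r * u k r)] (mod int l ^ k)"
    using coker_rel_add[OF l vw wz] unfolding coker_rel_iff[OF l] by blast
  have "[v k i = z k i + (\<Sum>r<n. B k i r * u k r)] (mod int l ^ k)" if i: "i < n" for k i
  proof -
    have "[w k i + v k i = zl_vadd l n v w k i] (mod int l ^ k)"
      using zl_vadd_cong[OF i, of l v w k] by (simp add: cong_sym add.commute)
    also note u(2)[OF i]
    also have "[zl_vadd l n w z k i + (\<Sum>r<n. B k i r * u k r)
        = w k i + z k i + (\<Sum>r<n. B k i r * u k r)] (mod int l ^ k)"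
      by (intro cong_add zl_vadd_cong[OF i] cong_refl)
    finally show ?thesis by (simp only: add.assoc cong_add_lcancel)
  qed
  moreover have "v \<in> zl_vec l n" "z \<in> zl_vec l n" using vw wz by (auto simp: coker_rel_def)
  ultimately show ?thesis unfolding coker_rel_iff[OF l] using u(1) by blast
qed

lemma coker_rel_vec: "(v, w) \<in> coker_rel l n B \<Longrightarrow> v \<in> zl_vec l n \<and> w \<in> zl_vec l n"
  by (simp add: coker_rel_def)

lemma coker_proj_eq: "l > 0 \<Longrightarrow> (v, w) \<in> coker_rel l n B \<Longrightarrow> coker_proj l n B v = coker_proj l n B w"
  unfolding coker_proj_def by (auto intro: coker_rel_trans coker_rel_sym)

lemma coker_rep:
  assumes "l > 0" "v \<in> zl_vec l n"
  shows "(v, SOME x. x \<in> coker_proj l n B v) \<in> coker_rel l n B"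
proof -
  have "v \<in> coker_proj l n B v" using coker_rel_refl[OF assms] by (simp add: coker_proj_def)
  then have "(SOME x. x \<in> coker_proj l n B v) \<in> coker_proj l n B v"
    by (rule someI[of "\<lambda>x. x \<in> coker_proj l n B v"])
  then show ?thesis by (simp add: coker_proj_def)
qed

lemma coker_carrier: "carrier (coker l n B) = coker_proj l n B ` zl_vec l n"
  by (auto simp: coker_def quotient_def coker_proj_def)

lemma coker_mult:
  assumes l: "l > 0" and v: "v \<in> zl_vec l n" and w: "w \<in> zl_vec l n"
  shows "coker_proj l n B v \<otimes>\<^bsub>coker l n B\<^esub> coker_proj l n B w = coker_proj l n B (zl_vadd l n v w)"
proof -
  have "coker_proj l n B v \<otimes>\<^bsub>coker l n B\<^esub> coker_proj l n B w
    = coker_proj l n B (zl_vadd l n (SOME x. x \<in> coker_proj l n B v) (SOME x. x \<in> coker_proj l n B w))"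
    by (simp add: coker_def)
  also have "\<dots> = coker_proj l n B (zl_vadd l n v w)"
    by (rule coker_proj_eq[OF l, symmetric]) (intro coker_rel_add[OF l] coker_rep[OF l] v w)
  finally show ?thesis .
qed

lemma coker_mult_closed:
  assumes "l > 0" "X \<in> carrier (coker l n B)" "Y \<in> carrier (coker l n B)"
  shows "X \<otimes>\<^bsub>coker l n B\<^esub> Y \<in> carrier (coker l n B)"
  using assms coker_mult[OF assms(1)] zl_vadd_vec[OF assms(1)] by (auto simp: coker_carrier)

definition imat_vec :: "nat \<Rightarrow> (nat \<Rightarrow> nat \<Rightarrow> int) \<Rightarrow> (nat \<Rightarrow> int) \<Rightarrow> nat \<Rightarrow> int" where
  "imat_vec n A v = (\<lambda>i. \<Sum>r<n. A i r * v r)"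

text \<open>Iterated application replaces matrix powers, so that P(F) v becomes a polynomial in an
  operator. The bound on i matters at e = 0: for i >= n the left side is 0 while the right side is v
  i.\<close>

lemma imat_pow_vec: "i < n \<Longrightarrow> (\<Sum>r<n. imat_pow n A e i r * v r) = ((imat_vec n A) ^^ e) v i"
proof (induction e arbitrary: i)
  case 0
  have "(\<Sum>r<n. imat_pow n A 0 i r * v r) = (\<Sum>r<n. if r = i then v r else 0)"
    by (rule sum.cong) auto
  then show ?case using 0 by simp
next
  case (Suc e)
  have "(\<Sum>r<n. imat_pow n A (Suc e) i r * v r) = (\<Sum>s<n. A i s * (\<Sum>r<n. imat_pow n A e s r * v r))"
    unfolding imat_pow.simps imat_mul_def sum_distrib_right sum_distrib_left
    by (subst sum.swap) (simp add: mult.assoc)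
  also have "\<dots> = (\<Sum>s<n. A i s * ((imat_vec n A) ^^ e) v s)"
    by (rule sum.cong) (use Suc.IH in auto)
  finally show ?case by (simp add: imat_vec_def[of n A "(imat_vec n A ^^ e) v"])
qed

lemma zl_poly_mat_vec:
  assumes i: "i < n"
  shows "[(\<Sum>r<n. zl_poly_mat l n c d F k i r * v r) = (\<Sum>e\<le>d. c e k * ((imat_vec n (F k)) ^^ e) v i)] (mod int l ^ k)"
proof -
  have "(\<Sum>r<n. zl_poly_mat l n c d F k i r * v r)
     = (\<Sum>r<n. ((\<Sum>e\<le>d. c e k * imat_pow n (F k) e i r) mod int l ^ k) * v r)"
    using i by (simp add: zl_poly_mat_def)
  then have "[(\<Sum>r<n. zl_poly_mat l n c d F k i r * v r)
     = (\<Sum>r<n. (\<Sum>e\<le>d. c e k * imat_pow n (F k) e i r) * v r)] (mod int l ^ k)"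
    by (simp add: cong_def sum_mult_mod_left)
  also have "(\<Sum>r<n. (\<Sum>e\<le>d. c e k * imat_pow n (F k) e i r) * v r)
     = (\<Sum>e\<le>d. c e k * (\<Sum>r<n. imat_pow n (F k) e i r * v r))"
    unfolding sum_distrib_right sum_distrib_left by (subst sum.swap) (simp add: mult.assoc)
  also have "\<dots> = (\<Sum>e\<le>d. c e k * ((imat_vec n (F k)) ^^ e) v i)"
    by (simp add: imat_pow_vec[OF i])
  finally show ?thesis .
qed

lemma imat_vec_poly_comm:
  "imat_vec n A (\<lambda>i. \<Sum>e\<le>d. c e * ((imat_vec n A) ^^ e) v i) i = (\<Sum>e\<le>d. c e * ((imat_vec n A) ^^ e) (imat_vec n A v) i)"
proof -
  have "imat_vec n A (\<lambda>i. \<Sum>e\<le>d. c e * ((imat_vec n A) ^^ e) v i) i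
    = (\<Sum>e\<le>d. c e * (imat_vec n A (((imat_vec n A) ^^ e) v) i))"
    unfolding imat_vec_def sum_distrib_left by (subst sum.swap) (simp add: mult.left_commute)
  then show ?thesis by (simp add: funpow_swap1)
qed

text \<open>F commutes with P(F): from v = w + P(F) u follows F v = F w + P(F) (F u). Hence
  \<open>coker_endo\<close> does not depend on its chosen representative.\<close>

lemma coker_rel_mvec:
  assumes l: "l > 0" and F: "F \<in> zl_mat l n"
    and vw: "(v, w) \<in> coker_rel l n (zl_poly_mat l n c d F)"
  shows "(zl_mvec l n F v, zl_mvec l n F w) \<in> coker_rel l n (zl_poly_mat l n c d F)"
proof -
  let ?B = "zl_poly_mat l n c d F"
  obtain u where u: "u \<in> zl_vec l n" "\<And>k i. i < n \<Longrightarrow> [v k i = w k i + (\<Sum>r<n. ?B k i r * u k r)] (mod int l ^ k)"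
    and m: "v \<in> zl_vec l n" "w \<in> zl_vec l n"
    using vw unfolding coker_rel_iff[OF l] by blast
  have "[zl_mvec l n F v k i = zl_mvec l n F w k i + (\<Sum>r<n. ?B k i r * zl_mvec l n F u k r)] (mod int l ^ k)"
    if i: "i < n" for k i
  proof -
    let ?A = "imat_vec n (F k)"
    have vs: "[v k s = w k s + (\<Sum>e\<le>d. c e k * (?A ^^ e) (u k) s)] (mod int l ^ k)" if "s < n" for s
      by (rule cong_trans[OF u(2)[OF that]]) (intro cong_add cong_refl zl_poly_mat_vec that)
    have "[(\<Sum>r<n. ?B k i r * zl_mvec l n F u k r) = (\<Sum>r<n. ?B k i r * ?A (u k) r)] (mod int l ^ k)"
      unfolding imat_vec_def by (intro cong_sum cong_mult cong_refl zl_mvec_cong) auto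
    also have "[(\<Sum>r<n. ?B k i r * ?A (u k) r) = (\<Sum>e\<le>d. c e k * (?A ^^ e) (?A (u k)) i)] (mod int l ^ k)"
      by (rule zl_poly_mat_vec[OF i])
    finally have r: "[(\<Sum>r<n. ?B k i r * zl_mvec l n F u k r) = (\<Sum>e\<le>d. c e k * (?A ^^ e) (?A (u k)) i)] (mod int l ^ k)" .
    have "[zl_mvec l n F v k i = (\<Sum>s<n. F k i s * v k s)] (mod int l ^ k)" by (rule zl_mvec_cong[OF i])
    also have "[(\<Sum>s<n. F k i s * v k s) = (\<Sum>s<n. F k i s * (w k s + (\<Sum>e\<le>d. c e k * (?A ^^ e) (u k) s)))] (mod int l ^ k)"
      by (intro cong_sum cong_mult cong_refl vs) auto
    also have "(\<Sum>s<n. F k i s * (w k s + (\<Sum>e\<le>d. c e k * (?A ^^ e) (u k) s)))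
      = (\<Sum>s<n. F k i s * w k s) + ?A (\<lambda>s. \<Sum>e\<le>d. c e k * (?A ^^ e) (u k) s) i"
      unfolding imat_vec_def[of n "F k" "\<lambda>s. \<Sum>e\<le>d. c e k * (?A ^^ e) (u k) s"] by (simp only: distrib_left sum.distrib)
    also have "?A (\<lambda>s. \<Sum>e\<le>d. c e k * (?A ^^ e) (u k) s) i = (\<Sum>e\<le>d. c e k * (?A ^^ e) (?A (u k)) i)"
      by (rule imat_vec_poly_comm)
    also have "[(\<Sum>s<n. F k i s * w k s) + (\<Sum>e\<le>d. c e k * (?A ^^ e) (?A (u k)) i)
      = zl_mvec l n F w k i + (\<Sum>r<n. ?B k i r * zl_mvec l n F u k r)] (mod int l ^ k)"
      by (intro cong_add cong_sym[OF r] cong_sym[OF zl_mvec_cong[OF i]])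
    finally show ?thesis .
  qed
  then show ?thesis unfolding coker_rel_iff[OF l] using m u(1) zl_mvec_vec[OF l F] by blast
qed

lemma coker_endo_proj:
  assumes l: "l > 0" and F: "F \<in> zl_mat l n" and v: "v \<in> zl_vec l n"
  shows "coker_endo l n (zl_poly_mat l n c d F) F (coker_proj l n (zl_poly_mat l n c d F) v)
    = coker_proj l n (zl_poly_mat l n c d F) (zl_mvec l n F v)"
  unfolding coker_endo_def
  by (rule coker_proj_eq[OF l, symmetric]) (rule coker_rel_mvec[OF l F coker_rep[OF l v]])

section \<open>Homomorphisms from the cokernel as tuples\<close>

context comm_group
begin

lemma gcomb_finprod:
  "(\<And>i. i < n \<Longrightarrow> t i \<in> carrier G) \<Longrightarrow> gcomb G n t v = finprod G (\<lambda>i. t i [^] v i) {..<n}"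
proof (induction n)
  case (Suc n)
  have "finprod G (\<lambda>i. t i [^] v i) (insert n {..<n}) = t n [^] v n \<otimes> finprod G (\<lambda>i. t i [^] v i) {..<n}"
    by (rule finprod_insert) (use Suc.prems in auto)
  then show ?case using Suc by (simp add: lessThan_Suc m_comm)
qed simp

text \<open>From t F = \<phi> t follows t F^e v = \<phi>^e (t v) for all e, hence t P(F) v =
  P(\<phi>)(t v), which is trivial. So t descends to the cokernel. The level is |G| in order to
  agree with \<open>zl_act\<close>.\<close>

lemma gcomb_poly_vanish:
  assumes tors: "\<And>x. x \<in> carrier G \<Longrightarrow> x [^] (int l ^ card (carrier G)) = \<one>"
    and t: "\<And>i. i < n \<Longrightarrow> t i \<in> carrier G"
    and eq: "\<And>j. j < n \<Longrightarrow> gcomb G n t (\<lambda>i. F (card (carrier G)) i j) = \<phi> (t j)"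
    and hom: "\<phi> \<in> hom G G" and pz: "poly_endo_zero G c d \<phi>" and c: "\<And>e. e \<le> d \<Longrightarrow> c e \<in> padic l"
  shows "gcomb G n t (\<lambda>i. \<Sum>r<n. zl_poly_mat l n c d F (card (carrier G)) i r * v r) = \<one>"
proof -
  let ?K = "card (carrier G)"
  let ?A = "imat_vec n (F ?K)"
  let ?h = "gcomb G n t v"
  have h: "?h \<in> carrier G" using t by (rule gcomb_closed)
  have pc: "(\<phi> ^^ e) ?h \<in> carrier G" for e
    by (induction e) (use h hom in \<open>auto simp: hom_def\<close>)
  have step: "gcomb G n t (?A w) = \<phi> (gcomb G n t w)" for w
  proof -
    have "gcomb G n t (?A w) = gcomb G n (\<lambda>r. gcomb G n t (\<lambda>i. F ?K i r)) w"
      unfolding imat_vec_def using t by (rule gcomb_compose)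
    also have "\<dots> = gcomb G n (\<lambda>r. \<phi> (t r)) w" using eq by (intro gcomb_cong) auto
    also have "\<dots> = \<phi> (gcomb G n t w)" using gcomb_hom[OF hom is_group t, where v = w and n = n] by simp
    finally show ?thesis .
  qed
  have pow: "gcomb G n t ((?A ^^ e) v) = (\<phi> ^^ e) ?h" for e
    by (induction e) (simp_all add: step)
  have "gcomb G n t (\<lambda>i. \<Sum>r<n. zl_poly_mat l n c d F ?K i r * v r)
     = gcomb G n t (\<lambda>i. \<Sum>e<Suc d. (?A ^^ e) v i * c e ?K)"
    by (rule gcomb_cong_mod[OF tors t])
      (use zl_poly_mat_vec[where n = n and l = l and c = c and d = d and F = F and k = ?K and v = v]
        in \<open>simp_all only: lessThan_Suc_atMost mult.commute\<close>)
  also have "\<dots> = gcomb G (Suc d) (\<lambda>e. gcomb G n t ((?A ^^ e) v)) (\<lambda>e. c e ?K)"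
    using t by (rule gcomb_compose)
  also have "\<dots> = finprod G (\<lambda>e. (\<phi> ^^ e) ?h [^] c e ?K) {..<Suc d}"
    unfolding pow using pc by (rule gcomb_finprod)
  also have "\<dots> = finprod G (\<lambda>e. zl_act G (c e) ((\<phi> ^^ e) ?h)) {..d}"
  proof (rule finprod_cong')
    show "(\<lambda>e. zl_act G (c e) ((\<phi> ^^ e) ?h)) \<in> {..d} \<rightarrow> carrier G"
      using pc by (simp add: zl_act_def)
    show "(\<phi> ^^ e) ?h [^] c e ?K = zl_act G (c e) ((\<phi> ^^ e) ?h)" if "e \<in> {..d}" for e
      using padic_range(1)[OF c, of e ?K] that by (simp add: zl_act_def pow_nat)
  qed auto
  also have "\<dots> = \<one>" using pz h by (simp add: poly_endo_zero_def)
  finally show ?thesis .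
qed

text \<open>Evaluating T at the classes of the basis vectors and sending v to t v at level |G| are
  inverse to each other: \<open>zl_vec_hom\<close> recovers T from t, and
  \<open>gcomb_poly_vanish\<close> lets t descend. Both T and t are extensional, so the
  correspondence is an exact bijection.\<close>

lemma sur_count_eq:
  assumes l: "l > 0" and tors: "\<And>x. x \<in> carrier G \<Longrightarrow> x [^] (int l ^ card (carrier G)) = \<one>"
    and hom: "\<phi> \<in> hom G G" and pz: "poly_endo_zero G c d \<phi>" and c: "\<And>e. e \<le> d \<Longrightarrow> c e \<in> padic l"
    and F: "F \<in> zl_mat l (2*g)" and f: "f \<in> fsums G"
  shows "sur_count l g c d G \<phi> (wedge_class G f) F =
    card {t \<in> sympl_tuples g f. \<forall>j<2*g. gcomb G (2*g) t (\<lambda>i. F (card (carrier G)) i j) = \<phi> (t j)}"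
proof -
  let ?n = "2*g"
  let ?K = "card (carrier G)"
  define B where "B = zl_poly_mat l ?n c d F"
  let ?C = "coker l ?n B"
  let ?p = "coker_proj l ?n B"
  let ?e = "zl_basis l ?n"
  define TT where "TT = {T. T \<in> epi ?C G \<and> T \<in> extensional (carrier ?C) \<and>
     (\<forall>X \<in> carrier ?C. T (coker_endo l ?n B F X) = \<phi> (T X)) \<and>
     wedge_map ?C G T (wedge_class ?C (omega_bar_rep l g B)) = wedge_class G f}"
  define tt where "tt = {t \<in> sympl_tuples g f. \<forall>j<?n. gcomb G ?n t (\<lambda>i. F ?K i j) = \<phi> (t j)}"
  define \<Phi> where "\<Phi> T = (\<lambda>j\<in>{..<?n}. T (?p (?e j)))" for T :: "(nat \<Rightarrow> nat \<Rightarrow> int) set \<Rightarrow> 'a"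
  \<comment> \<open>The value is read off a representative chosen by SOME; the fact
    \<open>rel\<close> below shows that the choice is immaterial.\<close>
  define \<Psi> where "\<Psi> t = (\<lambda>X\<in>carrier ?C. gcomb G ?n t ((SOME x. x \<in> X) ?K))" for t
  have e: "?e j \<in> zl_vec l ?n" for j using l by (rule zl_basis_vec)
  have pc: "?p v \<in> carrier ?C" if "v \<in> zl_vec l ?n" for v using that by (simp add: coker_carrier)
  have endo: "coker_endo l ?n B F (?p v) = ?p (zl_mvec l ?n F v)" if "v \<in> zl_vec l ?n" for v
    unfolding B_def using coker_endo_proj[OF l F that] .
  have cl: "X \<otimes>\<^bsub>?C\<^esub> Y \<in> carrier ?C" if "X \<in> carrier ?C" "Y \<in> carrier ?C" for X Y
    using coker_mult_closed[OF l that] .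
  have Fe: "zl_mvec l ?n F (?e j) ?K i = F ?K i j mod int l ^ ?K" if "i < ?n" "j < ?n" for i j
  proof -
    have "(\<Sum>r<?n. F ?K i r * ?e j ?K r) = (\<Sum>r<?n. if r = j then F ?K i j * (1 mod int l ^ ?K) else 0)"
      by (rule sum.cong) (use that in \<open>auto simp: zl_basis_def\<close>)
    then show ?thesis using that by (simp add: zl_mvec_def mod_mult_right_eq)
  qed
  have rep: "omega_bar_rep l g B = tup_wedge g (\<lambda>j. ?p (?e j))"
    by (rule ext) (simp add: omega_bar_rep_def sum_fun_apply)
  have repc: "tup_wedge g (\<lambda>j. ?p (?e j)) \<in> fsums ?C"
    by (rule tup_wedge_fsums) (rule pc[OF e])
  have hom_val: "T (?p v) = gcomb G ?n (\<Phi> T) (v ?K)" if T: "T \<in> hom ?C G" and v: "v \<in> zl_vec l ?n" for T v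
  proof -
    have "T (?p v) = gcomb G ?n (\<lambda>i. T (?p (?e i))) (v ?K)"
    proof (rule zl_vec_hom[OF l tors, where \<phi> = "\<lambda>v. T (?p v)"])
      fix v w assume vw: "v \<in> zl_vec l ?n" "w \<in> zl_vec l ?n"
      show "T (?p v) \<in> carrier G" using T pc[OF vw(1)] by (auto simp: hom_def)
      show "T (?p (zl_vadd l ?n v w)) = T (?p v) \<otimes> T (?p w)"
        using hom_mult[OF T pc[OF vw(1)] pc[OF vw(2)]] coker_mult[OF l vw] by simp
    qed (use v in auto)
    also have "\<dots> = gcomb G ?n (\<Phi> T) (v ?K)" by (rule gcomb_cong) (auto simp: \<Phi>_def)
    finally show ?thesis .
  qed
  have wedge: "wedge_map ?C G T (wedge_class ?C (omega_bar_rep l g B)) = wedge_class G f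
     \<longleftrightarrow> tup_wedge g (\<Phi> T) - f \<in> wedge_rel G" if T: "T \<in> hom ?C G" for T
  proof -
    have "wedge_map ?C G T (wedge_class ?C (omega_bar_rep l g B)) = wedge_class G (fs_map T (tup_wedge g (\<lambda>j. ?p (?e j))))"
      unfolding rep by (rule wedge_map_class[OF T repc cl])
    also have "fs_map T (tup_wedge g (\<lambda>j. ?p (?e j))) = tup_wedge g (\<lambda>j. T (?p (?e j)))"
      by (rule fs_map_tup_wedge[where H = ?C]) (rule pc[OF e])
    also have "\<dots> = tup_wedge g (\<Phi> T)" by (rule sum.cong) (auto simp: \<Phi>_def)
    finally have "wedge_map ?C G T (wedge_class ?C (omega_bar_rep l g B)) = wedge_class G (tup_wedge g (\<Phi> T))" .
    moreover have "tup_wedge g (\<Phi> T) \<in> fsums G"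
      by (rule tup_wedge_fsums) (use T pc[OF e] in \<open>auto simp: \<Phi>_def hom_def Pi_iff\<close>)
    ultimately show ?thesis by (simp only: wedge_class_eq_iff)
  qed
  have fwd: "\<Phi> T \<in> tt \<and> \<Psi> (\<Phi> T) = T" if TT: "T \<in> TT" for T
  proof -
    have T: "T \<in> hom ?C G" and sur: "T ` carrier ?C = carrier G" and ext: "T \<in> extensional (carrier ?C)"
      and eqv: "\<And>X. X \<in> carrier ?C \<Longrightarrow> T (coker_endo l ?n B F X) = \<phi> (T X)"
      and w: "tup_wedge g (\<Phi> T) - f \<in> wedge_rel G"
      using TT wedge unfolding TT_def epi_def by blast+
    have tc: "\<Phi> T \<in> {..<?n} \<rightarrow>\<^sub>E carrier G" using T pc[OF e] by (auto simp: \<Phi>_def hom_def Pi_iff)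
    have tci: "\<Phi> T i \<in> carrier G" if "i < ?n" for i using tc that by (auto simp: PiE_iff)
    have "gen_tuple ?n (\<Phi> T)"
      unfolding gen_tuple_def
    proof
      fix h assume "h \<in> carrier G"
      then obtain v where "v \<in> zl_vec l ?n" "h = T (?p v)" using sur by (auto simp: coker_carrier)
      then show "\<exists>u. h = gcomb G ?n (\<Phi> T) u" using hom_val[OF T] by blast
    qed
    moreover have "gcomb G ?n (\<Phi> T) (\<lambda>i. F ?K i j) = \<phi> (\<Phi> T j)" if j: "j < ?n" for j
    proof -
      have "\<phi> (\<Phi> T j) = T (?p (zl_mvec l ?n F (?e j)))"
        using eqv[OF pc[OF e[of j]]] endo[OF e[of j]] j by (simp add: \<Phi>_def)
      also have "\<dots> = gcomb G ?n (\<Phi> T) (zl_mvec l ?n F (?e j) ?K)"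
        by (rule hom_val[OF T zl_mvec_vec[OF l F e]])
      also have "\<dots> = gcomb G ?n (\<Phi> T) (\<lambda>i. F ?K i j)"
        by (rule gcomb_cong_mod[OF tors tci]) (use Fe j in \<open>auto simp: cong_def\<close>)
      finally show ?thesis by simp
    qed
    ultimately have "\<Phi> T \<in> tt" using tc w by (auto simp: tt_def sympl_tuples_def)
    moreover have "\<Psi> (\<Phi> T) X = T X" for X
    proof (cases "X \<in> carrier ?C")
      case True
      then obtain v where v: "v \<in> zl_vec l ?n" "X = ?p v" by (auto simp: coker_carrier)
      let ?x = "SOME x. x \<in> X"
      have r: "(v, ?x) \<in> coker_rel l ?n B" using coker_rep[OF l v(1)] v(2) by simp
      have "T X = T (?p ?x)" using coker_proj_eq[OF l r] v(2) by simp
      also have "\<dots> = gcomb G ?n (\<Phi> T) (?x ?K)" using hom_val[OF T] coker_rel_vec[OF r] by blast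
      finally show ?thesis using True by (simp add: \<Psi>_def)
    qed (use ext in \<open>simp add: \<Psi>_def extensional_def\<close>)
    ultimately show ?thesis by blast
  qed
  have bwd: "\<Psi> t \<in> TT \<and> \<Phi> (\<Psi> t) = t" if "t \<in> tt" for t
  proof -
    have t: "t \<in> {..<?n} \<rightarrow>\<^sub>E carrier G" and gen: "gen_tuple ?n t" and w: "tup_wedge g t - f \<in> wedge_rel G"
      and eq: "\<And>j. j < ?n \<Longrightarrow> gcomb G ?n t (\<lambda>i. F ?K i j) = \<phi> (t j)"
      using that by (auto simp: tt_def sympl_tuples_def)
    have tc: "t i \<in> carrier G" if "i < ?n" for i using t that by (auto simp: PiE_iff)
    have gc: "gcomb G ?n t v \<in> carrier G" for v using tc by (rule gcomb_closed)
    have rel: "gcomb G ?n t (v ?K) = gcomb G ?n t (w ?K)" if vw: "(v, w) \<in> coker_rel l ?n B" for v w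
    proof -
      obtain u where u: "\<And>i. i < ?n \<Longrightarrow> [v ?K i = w ?K i + (\<Sum>r<?n. B ?K i r * u ?K r)] (mod int l ^ ?K)"
        using vw unfolding coker_rel_iff[OF l] by blast
      have "gcomb G ?n t (v ?K) = gcomb G ?n t (\<lambda>i. w ?K i + (\<Sum>r<?n. B ?K i r * u ?K r))"
        by (rule gcomb_cong_mod[OF tors tc]) (use u in auto)
      also have "\<dots> = gcomb G ?n t (w ?K) \<otimes> gcomb G ?n t (\<lambda>i. \<Sum>r<?n. B ?K i r * u ?K r)"
        using tc by (rule gcomb_add)
      also have "gcomb G ?n t (\<lambda>i. \<Sum>r<?n. B ?K i r * u ?K r) = \<one>"
        unfolding B_def by (rule gcomb_poly_vanish[OF tors _ _ hom pz c]) (simp_all add: tc eq)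
      finally show ?thesis using gc by simp
    qed
    have val: "\<Psi> t (?p v) = gcomb G ?n t (v ?K)" if "v \<in> zl_vec l ?n" for v
      using pc[OF that] rel[OF coker_rep[OF l that]] by (simp add: \<Psi>_def)
    have psi_hom: "\<Psi> t \<in> hom ?C G"
    proof (rule homI)
      fix X assume "X \<in> carrier ?C"
      then show "\<Psi> t X \<in> carrier G" using gc by (simp add: \<Psi>_def)
    next
      fix X Y assume "X \<in> carrier ?C" "Y \<in> carrier ?C"
      then obtain v w where v: "v \<in> zl_vec l ?n" "X = ?p v" and w: "w \<in> zl_vec l ?n" "Y = ?p w"
        by (auto simp: coker_carrier)
      have "\<Psi> t (X \<otimes>\<^bsub>?C\<^esub> Y) = gcomb G ?n t (zl_vadd l ?n v w ?K)"
        using coker_mult[OF l v(1) w(1)] val[OF zl_vadd_vec[OF l v(1) w(1)]] v(2) w(2) by simp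
      also have "\<dots> = gcomb G ?n t (\<lambda>i. v ?K i + w ?K i)"
        by (rule gcomb_cong_mod[OF tors tc]) (auto intro: zl_vadd_cong)
      also have "\<dots> = \<Psi> t X \<otimes> \<Psi> t Y"
        using gcomb_add[OF tc] val v w by simp
      finally show "\<Psi> t (X \<otimes>\<^bsub>?C\<^esub> Y) = \<Psi> t X \<otimes> \<Psi> t Y" .
    qed
    have basis: "gcomb G ?n t (?e j ?K) = t j" if j: "j < ?n" for j
    proof -
      have "gcomb G ?n t (?e j ?K) = gcomb G ?n t (\<lambda>i. if i = j then 1 else 0)"
        by (rule gcomb_cong_mod[OF tors tc]) (use j in \<open>auto simp: zl_basis_def cong_def\<close>)
      then show ?thesis using gcomb_delta[where n = ?n and t = t and j = j and a = 1, OF tc j] tc[OF j] by simp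
    qed
    have Pt: "\<Phi> (\<Psi> t) = t"
    proof
      fix j show "\<Phi> (\<Psi> t) j = t j"
        using basis val[OF e] t by (cases "j < ?n") (auto simp: \<Phi>_def PiE_iff extensional_def)
    qed
    have sur: "\<Psi> t ` carrier ?C = carrier G"
    proof
      show "\<Psi> t ` carrier ?C \<subseteq> carrier G" using gc by (auto simp: \<Psi>_def)
      show "carrier G \<subseteq> \<Psi> t ` carrier ?C"
      proof
        fix h assume "h \<in> carrier G"
        then obtain u where u: "h = gcomb G ?n t u" using gen by (auto simp: gen_tuple_def)
        define v where "v = (\<lambda>k i. if i < ?n then u i mod int l ^ k else 0)"
        have v: "v \<in> zl_vec l ?n" unfolding v_def by (rule zl_vec_redI[OF l]) simp
        have "gcomb G ?n t (v ?K) = gcomb G ?n t u"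
          by (rule gcomb_cong_mod[OF tors tc]) (auto simp: v_def cong_def)
        then have "h = \<Psi> t (?p v)" using val[OF v] u by simp
        then show "h \<in> \<Psi> t ` carrier ?C" using pc[OF v] by blast
      qed
    qed
    have eqv: "\<Psi> t (coker_endo l ?n B F X) = \<phi> (\<Psi> t X)" if X: "X \<in> carrier ?C" for X
    proof -
      obtain v where v: "v \<in> zl_vec l ?n" "X = ?p v" using X by (auto simp: coker_carrier)
      have "\<Psi> t (coker_endo l ?n B F X) = gcomb G ?n t (zl_mvec l ?n F v ?K)"
        using endo[OF v(1)] val[OF zl_mvec_vec[OF l F v(1)]] v(2) by simp
      also have "\<dots> = gcomb G ?n t (\<lambda>i. \<Sum>r<?n. F ?K i r * v ?K r)"
        by (rule gcomb_cong_mod[OF tors tc]) (auto intro: zl_mvec_cong)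
      also have "\<dots> = gcomb G ?n (\<lambda>r. gcomb G ?n t (\<lambda>i. F ?K i r)) (v ?K)"
        using tc by (rule gcomb_compose)
      also have "\<dots> = gcomb G ?n (\<lambda>r. \<phi> (t r)) (v ?K)" using eq by (intro gcomb_cong) auto
      also have "\<dots> = \<phi> (gcomb G ?n t (v ?K))" using gcomb_hom[OF hom is_group tc, where v = "v ?K" and n = ?n] by simp
      finally show ?thesis using val[OF v(1)] v(2) by simp
    qed
    have "\<Psi> t \<in> extensional (carrier ?C)" by (simp add: \<Psi>_def)
    then have "\<Psi> t \<in> TT" unfolding TT_def epi_def
      using psi_hom sur eqv wedge[OF psi_hom] w Pt by simp
    then show ?thesis using Pt by blast
  qed
  have "bij_betw \<Phi> TT tt"
    by (rule bij_betw_byWitness[where f' = \<Psi>]) (use fwd bwd in auto)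
  then have "card TT = card tt" by (rule bij_betw_same_card)
  then show ?thesis by (simp add: sur_count_def Let_def TT_def tt_def B_def)
qed

end

section \<open>Invariance of the Haar measure\<close>

text \<open>If the image of M under f were not a measure, distr would be the zero measure, which is not M.\<close>
lemma measure_vimage_of_distr_eq:
  assumes "prob_space M" and d: "distr M M f = M" and X: "X \<in> sets M"
  shows "measure M (f -` X \<inter> space M) = measure M X"
proof -
  interpret prob_space M by fact
  let ?\<mu> = "\<lambda>A. emeasure M (f -` A \<inter> space M)"
  have sig: "sigma_sets (space M) (sets M) = sets M" by (rule sets.sigma_sets_eq)
  have e: "emeasure M A = (if A \<in> sets M \<and> measure_space (space M) (sets M) ?\<mu> then ?\<mu> A else 0)" for A
  proof -
    have "emeasure M A = emeasure (distr M M f) A" by (simp only: d)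
    also have "\<dots> = (if A \<in> sigma_sets (space M) (sets M) \<and> measure_space (space M) (sigma_sets (space M) (sets M)) ?\<mu> then ?\<mu> A else 0)"
      by (simp only: distr_def emeasure_measure_of_conv)
    finally show ?thesis unfolding sig .
  qed
  have "measure_space (space M) (sets M) ?\<mu>"
    using e[of "space M"] emeasure_space_1 by (auto split: if_splits)
  then have "emeasure M X = ?\<mu> X" using e[of X] X by simp
  then show ?thesis by (simp add: measure_def)
qed

text \<open>There are finitely many residue matrices mod l^k, so any condition on level k defines a
  finite union of cylinders.\<close>

lemma zl_level_sets:
  assumes l: "l > 0" and \<mu>: "space \<mu> = C" "sets \<mu> = zl_cyl_sets C" and C: "C \<subseteq> zl_mat l n"
  shows "{F \<in> C. Q (F k)} \<in> sets \<mu>"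
proof -
  let ?S = "{M \<in> (\<lambda>F. F k) ` C. Q M}"
  have "finite ?S"
    by (rule finite_subset[OF _ finite_zl_mat_level[OF l, of k n]]) (use C in auto)
  moreover have "{F \<in> C. F k = M} \<in> sets \<mu>" for M
    unfolding \<mu>(2) zl_cyl_sets_def by (rule sigma_sets.Basic) blast
  ultimately have "(\<Union>M\<in>?S. {F \<in> C. F k = M}) \<in> sets \<mu>" by (intro sets.finite_UN) auto
  also have "(\<Union>M\<in>?S. {F \<in> C. F k = M}) = {F \<in> C. Q (F k)}" by auto
  finally show ?thesis .
qed

section \<open>Action of the endomorphism and of the coset on tuples\<close>

context comm_group
begin

text \<open>On the kernel of \<phi> the endomorphism P(\<phi>) is multiplication by P(0), a unit
  since its residue \<open>c 0 1\<close> mod l is nonzero. So the kernel is trivial, and an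
  injective endomorphism of a finite group is bijective.\<close>

lemma poly_endo_bij:
  assumes l: "prime l" and fin: "finite (carrier G)" and card: "card (carrier G) = l ^ m"
    and hom: "\<phi> \<in> hom G G" and pz: "poly_endo_zero G c d \<phi>"
    and c: "\<And>e. e \<le> d \<Longrightarrow> c e \<in> padic l" and c0: "\<not> int l dvd c 0 1"
  shows "bij_betw \<phi> (carrier G) (carrier G)"
proof -
  let ?K = "card (carrier G)"
  have pc: "\<phi> x \<in> carrier G" if "x \<in> carrier G" for x using hom that by (auto simp: hom_def)
  have K: "?K > 0" using l card prime_gt_0_nat[OF l] by simp
  have cK: "coprime (c 0 ?K) (int l)"
  proof -
    have "c 0 ?K mod int l = c 0 1" using padic_mod_le[OF c[of 0], of 1 "?K - 1"] K by simp
    then have "\<not> int l dvd c 0 ?K" using c0 by (auto simp: dvd_eq_mod_eq_0)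
    then show ?thesis using l by (metis coprime_commute prime_imp_coprime prime_nat_int_transfer)
  qed
  have ker: "h = \<one>" if h: "h \<in> carrier G" and p1: "\<phi> h = \<one>" for h
  proof -
    have one: "(\<phi> ^^ Suc e) h = \<one>" for e
      by (induction e) (use p1 hom_one[OF hom is_group is_group] in auto)
    have "\<one> = finprod G (\<lambda>e. zl_act G (c e) ((\<phi> ^^ e) h)) {..d}"
      using pz h by (simp add: poly_endo_zero_def)
    also have "\<dots> = finprod G (\<lambda>e. if 0 = e then h [^] (nat (c 0 ?K)) else \<one>) {..d}"
    proof (rule finprod_cong')
      show "zl_act G (c e) ((\<phi> ^^ e) h) = (if 0 = e then h [^] nat (c 0 ?K) else \<one>)" for e
        using one by (cases e) (auto simp: zl_act_def simp del: funpow.simps(2))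
    qed (use h in auto)
    also have "\<dots> = h [^] (nat (c 0 ?K))"
      by (subst finprod_singleton) (use h in auto)
    also have "\<dots> = h [^] (c 0 ?K)" using padic_range(1)[OF c[of 0]] by (simp add: pow_nat)
    finally have hc: "h [^] (c 0 ?K) = \<one>" by simp
    have hl: "h [^] (int l ^ m) = \<one>"
      using pow_order_eq_1[OF h] card by (metis int_pow_int of_nat_power order_def)
    have "coprime (c 0 ?K) (int l ^ m)" using cK by simp
    then obtain x where x: "[c 0 ?K * x = 1] (mod int l ^ m)" using cong_solve_coprime_int by blast
    have "h = h [^] (1::int)" using h by simp
    also have "\<dots> = h [^] (c 0 ?K * x)" using int_pow_cong_mod[OF h hl cong_sym[OF x]] .
    also have "\<dots> = (h [^] (c 0 ?K)) [^] x" using h by (simp add: int_pow_pow)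
    finally show ?thesis using hc by simp
  qed
  have "inj_on \<phi> (carrier G)"
  proof (rule inj_onI)
    fix x y assume xy: "x \<in> carrier G" "y \<in> carrier G" "\<phi> x = \<phi> y"
    have "\<phi> (x \<otimes> inv y) = \<phi> x \<otimes> \<phi> (inv y)" using hom_mult[OF hom] xy by simp
    also have "\<phi> (inv y) = inv (\<phi> y)"
      using group_hom.hom_inv[of G G \<phi> y] hom xy is_group by (simp add: group_hom_def group_hom_axioms_def)
    finally have "\<phi> (x \<otimes> inv y) = \<one>" using xy pc by simp
    then have "x \<otimes> inv y = \<one>" using ker[of "x \<otimes> inv y"] xy by simp
    then show "x = y" using xy by (metis inv_equality inv_inv inv_closed)
  qed
  moreover have "\<phi> ` carrier G \<subseteq> carrier G" using pc by blast
  ultimately show ?thesis using fin by (simp add: bij_betw_def endo_inj_surj)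
qed

text \<open>Formulated for two formal sums f and f', so that it applies to \<phi> and to its inverse
  alike.\<close>

lemma sympl_tuples_map:
  assumes hom: "\<phi> \<in> hom G G" and bij: "bij_betw \<phi> (carrier G) (carrier G)"
    and f: "f \<in> fsums G" and ff': "fs_map \<phi> f - f' \<in> wedge_rel G" and t: "t \<in> sympl_tuples g f"
  shows "(\<lambda>j\<in>{..<2*g}. \<phi> (t j)) \<in> sympl_tuples g f'"
proof -
  let ?r = "\<lambda>j\<in>{..<2*g}. \<phi> (t j)"
  have tE: "t \<in> {..<2*g} \<rightarrow>\<^sub>E carrier G" and gen: "gen_tuple (2*g) t" and w: "tup_wedge g t - f \<in> wedge_rel G"
    using t unfolding sympl_tuples_def by blast+
  have tc: "t i \<in> carrier G" if "i < 2*g" for i using tE that by (auto simp: PiE_iff)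
  have pc: "\<phi> x \<in> carrier G" if "x \<in> carrier G" for x using hom that by (auto simp: hom_def)
  have "gen_tuple (2*g) ?r"
    unfolding gen_tuple_def
  proof
    fix h assume "h \<in> carrier G"
    then obtain h' where h': "h' \<in> carrier G" "h = \<phi> h'" using bij by (auto simp: bij_betw_def)
    then obtain u where "h' = gcomb G (2*g) t u" using gen by (auto simp: gen_tuple_def)
    then have "h = gcomb G (2*g) (\<lambda>j. \<phi> (t j)) u"
      using h'(2) gcomb_hom[OF hom is_group tc, where n = "2*g" and v = u] by simp
    also have "\<dots> = gcomb G (2*g) ?r u" by (rule gcomb_cong) auto
    finally show "\<exists>u. h = gcomb G (2*g) ?r u" by blast
  qed
  moreover have "tup_wedge g ?r - f' \<in> wedge_rel G"
  proof -
    have tw: "tup_wedge g t \<in> fsums G" using tc by (rule tup_wedge_fsums)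
    have "tup_wedge g ?r = tup_wedge g (\<lambda>j. \<phi> (t j))" by (rule sum.cong) auto
    also have "\<dots> = fs_map \<phi> (tup_wedge g t)"
      by (rule fs_map_tup_wedge[symmetric, where H = G]) (rule tc)
    finally have "tup_wedge g ?r - f' = fs_map \<phi> (tup_wedge g t - f) + (fs_map \<phi> f - f')"
      by (simp add: fs_map_diff[OF tw f])
    also have "\<dots> \<in> wedge_rel G"
      by (rule zsub_add[OF wedge_rel_zsub fs_map_wedge_rel[OF w hom] ff']) simp
    finally show ?thesis .
  qed
  moreover have "?r \<in> {..<2*g} \<rightarrow>\<^sub>E carrier G" using tc pc by auto
  ultimately show ?thesis unfolding sympl_tuples_def by blast
qed

lemma sympl_tuples_endo_bij:
  assumes hom: "\<phi> \<in> hom G G" and bij: "bij_betw \<phi> (carrier G) (carrier G)"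
    and f: "f \<in> fsums G" and f': "f' \<in> fsums G" and ff': "fs_map \<phi> f - f' \<in> wedge_rel G"
  shows "bij_betw (\<lambda>t. \<lambda>j\<in>{..<2*g}. \<phi> (t j)) (sympl_tuples g f) (sympl_tuples g f')"
proof -
  let ?\<psi> = "inv_into (carrier G) \<phi>"
  have iso: "\<phi> \<in> iso G G" using hom bij by (simp add: iso_def)
  have hom': "?\<psi> \<in> hom G G" using iso_set_sym[OF iso] by (simp add: iso_def)
  have bij': "bij_betw ?\<psi> (carrier G) (carrier G)" using bij by (rule bij_betw_inv_into)
  have pc: "\<phi> x \<in> carrier G" if "x \<in> carrier G" for x using hom that by (auto simp: hom_def)
  have l: "?\<psi> (\<phi> x) = x" and r: "\<phi> (?\<psi> x) = x" if "x \<in> carrier G" for x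
    using bij that by (auto simp: bij_betw_inv_into_left bij_betw_inv_into_right)
  have "fs_map ?\<psi> (fs_map \<phi> f - f') \<in> wedge_rel G"
    by (rule fs_map_wedge_rel[OF ff' hom']) simp
  moreover have "fs_map ?\<psi> (fs_map \<phi> f - f') = f - fs_map ?\<psi> f'"
    using fs_map_diff[OF fs_map_fsums[OF f pc] f', where \<phi> = ?\<psi>] fs_map_inverse[OF f pc l] by simp
  ultimately have "fs_map ?\<psi> f' - f \<in> wedge_rel G"
    using zsub_uminus[OF wedge_rel_zsub] by (metis minus_diff_eq)
  note bwd = sympl_tuples_map[OF hom' bij' f' this]
  note fwd = sympl_tuples_map[OF hom bij f ff']
  have E: "t \<in> extensional {..<2*g} \<and> (\<forall>j<2*g. t j \<in> carrier G)" if "t \<in> sympl_tuples g h" for t h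
    using that unfolding sympl_tuples_def by (auto simp: PiE_iff)
  show ?thesis
  proof (rule bij_betw_byWitness[where f' = "\<lambda>t. \<lambda>j\<in>{..<2*g}. ?\<psi> (t j)"])
    show "\<forall>t\<in>sympl_tuples g f. (\<lambda>j\<in>{..<2*g}. ?\<psi> ((\<lambda>j\<in>{..<2*g}. \<phi> (t j)) j)) = t"
      by (intro ballI, rule extensionalityI[of _ "{..<2*g}"]) (use l E in auto)
    show "\<forall>t\<in>sympl_tuples g f'. (\<lambda>j\<in>{..<2*g}. \<phi> ((\<lambda>j\<in>{..<2*g}. ?\<psi> (t j)) j)) = t"
      by (intro ballI, rule extensionalityI[of _ "{..<2*g}"]) (use r E in auto)
  qed (use fwd bwd in auto)
qed

text \<open>The wedge condition comes from F J F^T = q J. Generation survives because F has a right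
  inverse N mod l^k: h = t u = (t F)(N u).\<close>

lemma sympl_tuples_gsp:
  assumes tors: "\<And>x. x \<in> carrier G \<Longrightarrow> x [^] (int l ^ k) = \<one>"
    and F: "F \<in> gsp_coset l g q" and t: "t \<in> sympl_tuples g f"
  shows "(\<lambda>j\<in>{..<2*g}. gcomb G (2*g) t (\<lambda>i. F k i j)) \<in> sympl_tuples g (of_int (int q) * f)"
proof -
  let ?n = "2*g"
  let ?c = "\<lambda>j. gcomb G ?n t (\<lambda>i. F k i j)"
  let ?r = "\<lambda>j\<in>{..<?n}. ?c j"
  have tE: "t \<in> {..<?n} \<rightarrow>\<^sub>E carrier G" and gen: "gen_tuple ?n t" and w: "tup_wedge g t - f \<in> wedge_rel G"
    using t unfolding sympl_tuples_def by blast+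
  have tc: "t i \<in> carrier G" if "i < ?n" for i using tE that by (auto simp: PiE_iff)
  have cc: "?c j \<in> carrier G" for j using tc by (rule gcomb_closed)
  have "gen_tuple ?n ?r"
    unfolding gen_tuple_def
  proof
    fix h assume "h \<in> carrier G"
    then obtain u where u: "h = gcomb G ?n t u" using gen by (auto simp: gen_tuple_def)
    obtain N where N: "\<And>i j. i < ?n \<Longrightarrow> j < ?n \<Longrightarrow>
        [(\<Sum>r<?n. F k i r * N r j) = (if i = j then 1 else 0)] (mod int l ^ k)"
      using gsp_coset_inverse[OF F, where k = k] by blast
    have "gcomb G ?n ?r (\<lambda>r. \<Sum>j<?n. N r j * u j) = gcomb G ?n ?c (\<lambda>r. \<Sum>j<?n. N r j * u j)"
      by (rule gcomb_cong) auto
    also have "\<dots> = gcomb G ?n t (\<lambda>i. \<Sum>r<?n. F k i r * (\<Sum>j<?n. N r j * u j))"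
      using tc by (rule gcomb_compose[symmetric])
    also have "\<dots> = gcomb G ?n t u"
    proof (rule gcomb_cong_mod[OF tors tc])
      fix i assume i: "i < ?n"
      have "(\<Sum>r<?n. F k i r * (\<Sum>j<?n. N r j * u j)) = (\<Sum>j<?n. (\<Sum>r<?n. F k i r * N r j) * u j)"
        unfolding sum_distrib_left sum_distrib_right by (subst sum.swap) (simp add: mult.assoc)
      also have "[\<dots> = (\<Sum>j<?n. (if i = j then 1 else 0) * u j)] (mod int l ^ k)"
        by (intro cong_sum cong_mult cong_refl N i) auto
      also have "(\<Sum>j<?n. (if i = j then 1 else 0) * u j) = (\<Sum>j<?n. if j = i then u j else 0)"
        by (rule sum.cong) auto
      also have "\<dots> = u i" using i by simp
      finally show "[(\<Sum>r<?n. F k i r * (\<Sum>j<?n. N r j * u j)) = u i] (mod int l ^ k)" .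
    qed
    finally have "h = gcomb G ?n ?r (\<lambda>r. \<Sum>j<?n. N r j * u j)" using u by simp
    then show "\<exists>u. h = gcomb G ?n ?r u" by blast
  qed
  moreover have "tup_wedge g ?r - of_int (int q) * f \<in> wedge_rel G"
  proof -
    have "tup_wedge g ?r = tup_wedge g ?c" by (rule sum.cong) auto
    then have "tup_wedge g ?r - of_int (int q) * f
      = (tup_wedge g ?c - of_int (int q) * tup_wedge g t) + of_int (int q) * (tup_wedge g t - f)"
      by (simp add: algebra_simps)
    also have "\<dots> \<in> wedge_rel G"
      by (rule zsub_add[OF wedge_rel_zsub tup_wedge_gsp[OF tors tc] zsub_of_int[OF wedge_rel_zsub w]])
        (use sympl_gram_cong[OF F] in auto)
    finally show ?thesis .
  qed
  moreover have "?r \<in> {..<?n} \<rightarrow>\<^sub>E carrier G" using cc by auto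
  ultimately show ?thesis unfolding sympl_tuples_def by blast
qed

lemma gcomb_transv_mat:
  assumes t: "\<And>i. i < 2*g \<Longrightarrow> t i \<in> carrier G" and s: "s < 2*g"
  shows "gcomb G (2*g) t (\<lambda>i. transv_mat g c u i s) = gtransv G g c u t s"
proof -
  have "gcomb G (2*g) t (\<lambda>i. transv_mat g c u i s)
    = gcomb G (2*g) t (\<lambda>i. if i = s then 1 else 0) \<otimes> gcomb G (2*g) t (\<lambda>i. (c * sympl_dual g u s) * u i)"
    unfolding transv_mat_def
    by (subst gcomb_add[symmetric, OF t]) (auto intro!: gcomb_cong)
  then show ?thesis using gcomb_delta[where n = "2*g" and t = t and j = s and a = 1, OF t s]
    gcomb_scale[where n = "2*g" and t = t, OF t] t[OF s] by (simp add: gtransv_def)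
qed

text \<open>With T the matrix of the transvection, t (T F) = (t T) F. So the event for the
  transvected tuple is the preimage of the event for t under F -> T F, a map that preserves the
  measure.\<close>

lemma measure_gtransv:
  assumes l: "l > 0" and tors: "\<And>x. x \<in> carrier G \<Longrightarrow> x [^] (int l ^ k) = \<one>"
    and haar: "haar_coset l (2*g) \<mu> (gsp_coset l g q) (gsp_coset l g 1)"
    and t: "\<And>i. i < 2*g \<Longrightarrow> t i \<in> carrier G"
  shows "measure \<mu> {F \<in> gsp_coset l g q. \<forall>j<2*g. gcomb G (2*g) (gtransv G g c u t) (\<lambda>i. F k i j) = \<psi> j}
    = measure \<mu> {F \<in> gsp_coset l g q. \<forall>j<2*g. gcomb G (2*g) t (\<lambda>i. F k i j) = \<psi> j}"
proof -
  let ?n = "2*g" and ?C = "gsp_coset l g q"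
  let ?S = "zl_red l ?n (transv_mat g c u)"
  let ?X = "{F \<in> ?C. \<forall>j<?n. gcomb G ?n t (\<lambda>i. F k i j) = \<psi> j}"
  have \<mu>: "prob_space \<mu>" "space \<mu> = ?C" "sets \<mu> = zl_cyl_sets ?C"
    and inv: "\<And>S. S \<in> gsp_coset l g 1 \<Longrightarrow> distr \<mu> \<mu> (zl_mmul l ?n S) = \<mu>"
    using haar by (auto simp: haar_coset_def)
  have S: "?S \<in> gsp_coset l g 1" by (rule transv_mat_gsp[OF l])
  have CM: "?C \<subseteq> zl_mat l ?n" by (auto simp: gsp_coset_def)
  have "?X \<in> sets \<mu>"
    using zl_level_sets[OF l \<mu>(2,3) CM, where k = k and Q = "\<lambda>M. \<forall>j<?n. gcomb G ?n t (\<lambda>i. M i j) = \<psi> j"] .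
  then have "measure \<mu> (zl_mmul l ?n ?S -` ?X \<inter> space \<mu>) = measure \<mu> ?X"
    by (rule measure_vimage_of_distr_eq[OF \<mu>(1) inv[OF S]])
  moreover have "zl_mmul l ?n ?S -` ?X \<inter> space \<mu>
      = {F \<in> ?C. \<forall>j<?n. gcomb G ?n (gtransv G g c u t) (\<lambda>i. F k i j) = \<psi> j}"
  proof -
    have "gcomb G ?n t (\<lambda>i. zl_mmul l ?n ?S F k i j) = gcomb G ?n (gtransv G g c u t) (\<lambda>i. F k i j)"
      if j: "j < ?n" for F j
    proof -
      have "gcomb G ?n t (\<lambda>i. zl_mmul l ?n ?S F k i j)
        = gcomb G ?n t (\<lambda>i. \<Sum>s<?n. transv_mat g c u i s * F k s j)"
        by (rule gcomb_cong_mod[OF tors t]) (simp_all add: zl_mmul_red_level j cong_def)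
      also have "\<dots> = gcomb G ?n (\<lambda>s. gcomb G ?n t (\<lambda>i. transv_mat g c u i s)) (\<lambda>s. F k s j)"
        using t by (rule gcomb_compose)
      also have "\<dots> = gcomb G ?n (gtransv G g c u t) (\<lambda>s. F k s j)"
        by (rule gcomb_cong) (simp_all add: gcomb_transv_mat[OF t])
      finally show ?thesis .
    qed
    then show ?thesis using gsp_coset_mult[OF l S] by (auto simp: \<mu>(2))
  qed
  ultimately show ?thesis by simp
qed

end

lemma (in comm_group) expected_sur_count:
  assumes l: "prime l" and fin: "finite (carrier G)" and card: "card (carrier G) = l ^ m"
    and f: "f \<in> fsums G" and hom: "\<phi> \<in> hom G G" and pz: "poly_endo_zero G c d \<phi>"
    and c: "\<And>e. e \<le> d \<Longrightarrow> c e \<in> padic l" and c0: "\<not> int l dvd c 0 1"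
    and scale: "wedge_map G G \<phi> (wedge_class G f) = wedge_scale G (int q) (wedge_class G f)"
    and haar: "haar_coset l (2*g) \<mu> (gsp_coset l g q) (gsp_coset l g 1)"
  shows "(\<integral>F. real (sur_count l g c d G \<phi> (wedge_class G f) F) \<partial>\<mu>) = (if sympl_tuples g f = {} then 0 else 1)"
proof -
  let ?n = "2*g" and ?C = "gsp_coset l g q" and ?K = "card (carrier G)"
  have l0: "l > 0" using l by (rule prime_gt_0_nat)
  have \<mu>: "prob_space \<mu>" "space \<mu> = ?C" "sets \<mu> = zl_cyl_sets ?C"
    using haar by (auto simp: haar_coset_def)
  interpret prob_space \<mu> by fact
  have CM: "?C \<subseteq> zl_mat l ?n" by (auto simp: gsp_coset_def)
  have tors: "x [^] (int l ^ ?K) = \<one>" if x: "x \<in> carrier G" for x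
  proof -
    have "x [^] (int l ^ m) = \<one>"
      using pow_order_eq_1[OF x] card by (metis int_pow_int of_nat_power order_def)
    \<comment> \<open>The level |G| may replace the exponent m because |G| = l^m >= m.\<close>
    moreover have "m \<le> ?K"
      using power_gt_expt[of l m] prime_gt_1_nat[OF l] by (simp add: card)
    then have "int l ^ ?K = int l ^ m * int l ^ (?K - m)" by (simp add: power_add[symmetric])
    ultimately show ?thesis using x by (simp add: int_pow_pow[symmetric])
  qed
  define S where "S = sympl_tuples g f"
  define Sq where "Sq = sympl_tuples g (of_int (int q) * f)"
  define E where "E t \<psi> = {F \<in> ?C. \<forall>j<?n. gcomb G ?n t (\<lambda>i. F ?K i j) = \<psi> j}" for t \<psi>
  define r where "r t = (\<lambda>j\<in>{..<?n}. \<phi> (t j))" for t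
  have finS: "finite (sympl_tuples g h)" for h
    by (rule finite_subset[of _ "{..<?n} \<rightarrow>\<^sub>E carrier G"]) (auto simp: sympl_tuples_def intro!: finite_PiE fin)
  have E: "E t \<psi> \<in> sets \<mu>" for t \<psi>
    unfolding E_def
    using zl_level_sets[OF l0 \<mu>(2,3) CM, where k = ?K and Q = "\<lambda>M. \<forall>j<?n. gcomb G ?n t (\<lambda>i. M i j) = \<psi> j"] .
  have Er: "E t (r t) = {F \<in> ?C. \<forall>j<?n. gcomb G ?n t (\<lambda>i. F ?K i j) = \<phi> (t j)}" for t
    by (auto simp: E_def r_def)
  have count: "real (sur_count l g c d G \<phi> (wedge_class G f) F) = (\<Sum>t\<in>S. indicator (E t (r t)) F)"
    if F: "F \<in> space \<mu>" for F
  proof -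
    have FC: "F \<in> ?C" using F \<mu>(2) by simp
    then have "sur_count l g c d G \<phi> (wedge_class G f) F = card {t \<in> S. F \<in> E t (r t)}"
      unfolding S_def Er using CM by (subst sur_count_eq[OF l0 tors hom pz c _ f]) auto
    also have "real \<dots> = (\<Sum>t\<in>S. if F \<in> E t (r t) then 1 else 0)"
      using finS[of f] by (simp add: S_def sum.If_cases Int_def)
    also have "\<dots> = (\<Sum>t\<in>S. indicator (E t (r t)) F)"
      by (rule sum.cong) (auto simp: indicator_def)
    finally show ?thesis .
  qed
  have "(\<integral>F. real (sur_count l g c d G \<phi> (wedge_class G f) F) \<partial>\<mu>)
     = (\<integral>F. (\<Sum>t\<in>S. indicator (E t (r t)) F) \<partial>\<mu>)"
    by (rule Bochner_Integration.integral_cong) (use count in auto)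
  also have "\<dots> = (\<Sum>t\<in>S. \<integral>F. indicator (E t (r t)) F \<partial>\<mu>)"
    by (rule Bochner_Integration.integral_sum) (use E in \<open>auto intro!: integrable_real_indicator simp: less_top[symmetric]\<close>)
  also have "\<dots> = (\<Sum>t\<in>S. measure \<mu> (E t (r t)))"
    by (rule sum.cong) (use E sets.sets_into_space in \<open>auto simp: Int_absorb2\<close>)
  finally have integral: "(\<integral>F. real (sur_count l g c d G \<phi> (wedge_class G f) F) \<partial>\<mu>)
     = (\<Sum>t\<in>S. measure \<mu> (E t (r t)))" .
  show ?thesis
  proof (cases "S = {}")
    case True
    then show ?thesis using integral by (simp add: S_def)
  next
    case False
    then obtain t0 where t0: "t0 \<in> S" by blast
    have tc: "t i \<in> carrier G" if "t \<in> S" "i < ?n" for t i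
      using that by (auto simp: S_def sympl_tuples_def PiE_iff)
    have const: "measure \<mu> (E t \<psi>) = measure \<mu> (E t0 \<psi>)" if t: "t \<in> S" for t \<psi>
    proof (rule gtransv_transitive[OF l fin card, where g = g and Q = "\<lambda>s. measure \<mu> (E s \<psi>)"])
      show "gen_tuple ?n t" "gen_tuple ?n t0"
        using t t0 by (auto simp: S_def sympl_tuples_def)
      have w: "tup_wedge g t - f \<in> wedge_rel G" "tup_wedge g t0 - f \<in> wedge_rel G"
        using t t0 unfolding S_def sympl_tuples_def by blast+
      from zsub_diff[OF wedge_rel_zsub this] show "tup_wedge g t - tup_wedge g t0 \<in> wedge_rel G"
        by (simp only: diff_diff_eq2 diff_add_cancel)
      show "measure \<mu> (E (gtransv G g c' u s) \<psi>) = measure \<mu> (E s \<psi>)" if "\<And>i. s i \<in> carrier G" for c' u s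
        unfolding E_def by (rule measure_gtransv[OF l0 tors haar that])
      show "measure \<mu> (E s \<psi>) = measure \<mu> (E s' \<psi>)" if "\<And>j. j < ?n \<Longrightarrow> s j = s' j" for s s'
      proof -
        have "gcomb G ?n s v = gcomb G ?n s' v" for v using that by (intro gcomb_cong) auto
        then show ?thesis by (simp add: E_def)
      qed
    qed (use t t0 tc in auto)
    have fm: "fs_map \<phi> f - of_int (int q) * f \<in> wedge_rel G"
    proof -
      have pc: "\<phi> x \<in> carrier G" if "x \<in> carrier G" for x using hom that by (auto simp: hom_def)
      have "wedge_class G (fs_map \<phi> f) = wedge_class G (of_int (int q) * f)"
        using scale wedge_map_class[OF hom f] wedge_scale_class[OF f, of "int q"] by simp
      from iffD1[OF wedge_class_eq_iff[OF fs_map_fsums[OF f pc]] this] show ?thesis .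
    qed
    have "bij_betw r S Sq"
      unfolding r_def S_def Sq_def
      by (rule sympl_tuples_endo_bij[OF hom poly_endo_bij[OF l fin card hom pz c c0] f zsub_of_int[OF fsums_zsub f] fm])
    \<comment> \<open>Transitivity is applied with the target \<open>r t\<close> held fixed while
      the tuple moves from t to t0. All events then belong to the single tuple t0 and are disjoint
      for distinct targets.\<close>
    have "(\<Sum>t\<in>S. measure \<mu> (E t (r t))) = (\<Sum>t\<in>S. measure \<mu> (E t0 (r t)))"
      by (rule sum.cong) (use const in auto)
    also have "\<dots> = (\<Sum>\<psi>\<in>Sq. measure \<mu> (E t0 \<psi>))"
      by (rule sum.reindex_bij_betw) fact
    also have "\<dots> = measure \<mu> (\<Union>\<psi>\<in>Sq. E t0 \<psi>)"
    proof (rule finite_measure_finite_Union[symmetric])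
      show "disjoint_family_on (E t0) Sq"
        unfolding disjoint_family_on_def
      proof (intro ballI impI)
        fix \<psi> \<psi>' assume "\<psi> \<in> Sq" "\<psi>' \<in> Sq" "\<psi> \<noteq> \<psi>'"
        then have "\<exists>j<?n. \<psi> j \<noteq> \<psi>' j"
          unfolding Sq_def sympl_tuples_def by (metis (mono_tags, lifting) PiE_ext lessThan_iff mem_Collect_eq)
        then show "E t0 \<psi> \<inter> E t0 \<psi>' = {}" by (auto simp: E_def)
      qed
    qed (use E finS in \<open>auto simp: Sq_def\<close>)
    also have "(\<Union>\<psi>\<in>Sq. E t0 \<psi>) = space \<mu>"
    proof
      show "(\<Union>\<psi>\<in>Sq. E t0 \<psi>) \<subseteq> space \<mu>" by (auto simp: E_def \<mu>(2))
      show "space \<mu> \<subseteq> (\<Union>\<psi>\<in>Sq. E t0 \<psi>)"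
      proof
        fix F assume "F \<in> space \<mu>"
        then have F: "F \<in> ?C" by (simp add: \<mu>(2))
        let ?r = "\<lambda>j\<in>{..<?n}. gcomb G ?n t0 (\<lambda>i. F ?K i j)"
        have "?r \<in> Sq" unfolding Sq_def by (rule sympl_tuples_gsp[OF tors F]) (use t0 in \<open>auto simp: S_def\<close>)
        moreover have "F \<in> E t0 ?r" using F by (auto simp: E_def)
        ultimately show "F \<in> (\<Union>\<psi>\<in>Sq. E t0 \<psi>)" by blast
      qed
    qed
    finally show ?thesis using integral False prob_space by (simp add: S_def)
  qed
qed

theorem theorem3p1:
  fixes l :: nat and H :: "('a, 'b) monoid_scheme" and \<omega>H :: "('a \<times> 'a \<Rightarrow> int) set"
  assumes "prime l"
    and "comm_group H" and "finite (carrier H)" and "\<exists>m. card (carrier H) = l ^ m"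
    and "\<omega>H \<in> wedge2 H"
  shows "\<exists>g0 :: int. \<forall>(q :: nat) (c :: nat \<Rightarrow> nat \<Rightarrow> int) (d :: nat) (FH :: 'a \<Rightarrow> 'a).
    ((\<exists>p k. prime (p :: nat) \<and> k \<ge> 1 \<and> q = p ^ k) \<and> \<not> l dvd q \<and>
     (\<forall>e\<le>d. c e \<in> padic l) \<and> c d = zl_const l 1 \<and> \<not> int l dvd c 0 1 \<and>
     FH \<in> hom H H \<and> poly_endo_zero H c d FH \<and>
     wedge_map H H FH \<omega>H = wedge_scale H (int q) \<omega>H)
    \<longrightarrow> (\<forall>(g :: nat) \<mu>. haar_coset l (2 * g) \<mu> (gsp_coset l g q) (gsp_coset l g 1) \<longrightarrow>
          (int g \<le> g0 \<longrightarrow> (\<integral>F. real (sur_count l g c d H FH \<omega>H F) \<partial>\<mu>) = 0) \<and>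
          (int g > g0 \<longrightarrow> (\<integral>F. real (sur_count l g c d H FH \<omega>H F) \<partial>\<mu>) = 1))"
proof -
  interpret comm_group H by fact
  obtain f where f: "f \<in> fsums H" "\<omega>H = wedge_class H f" using assms(5) by (auto simp: wedge2_def)
  obtain m where m: "card (carrier H) = l ^ m" using assms(4) by blast
  \<comment> \<open>g1 is fixed from H and a representative f of \<open>\<omega>H\<close> alone,
    before q, P and FH are introduced.\<close>
  define g1 where "g1 = (LEAST g. sympl_pairs g f)"
  have g1: "sympl_pairs g1 f"
    unfolding g1_def using sympl_pairs_exists[OF assms(3) f(1)] by (rule LeastI_ex)
  have iff: "sympl_tuples g f \<noteq> {} \<longleftrightarrow> g1 \<le> g" for g
    unfolding sympl_pairs_iff[symmetric]
  proof
    show "sympl_pairs g f \<Longrightarrow> g1 \<le> g" unfolding g1_def by (rule Least_le)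
    show "g1 \<le> g \<Longrightarrow> sympl_pairs g f" by (rule sympl_pairs_mono[OF g1])
  qed
  show ?thesis
  \<comment> \<open>For trivial H the least value g1 is 0, so g0 = -1 must be allowed; this is why
    g0 is an integer.\<close>
  proof (intro exI[of _ "int g1 - 1"] allI impI, elim conjE)
    fix q c d FH g \<mu>
    assume "\<forall>e\<le>d. c e \<in> padic l" "\<not> int l dvd c 0 1" "FH \<in> hom H H" "poly_endo_zero H c d FH"
      "wedge_map H H FH \<omega>H = wedge_scale H (int q) \<omega>H"
      "haar_coset l (2 * g) \<mu> (gsp_coset l g q) (gsp_coset l g 1)"
    then have "(\<integral>F. real (sur_count l g c d H FH \<omega>H F) \<partial>\<mu>) = (if sympl_tuples g f = {} then 0 else 1)"
      unfolding f(2) by (intro expected_sur_count[OF assms(1,3) m f(1)]) auto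
    then show "(int g \<le> int g1 - 1 \<longrightarrow> (\<integral>F. real (sur_count l g c d H FH \<omega>H F) \<partial>\<mu>) = 0) \<and>
          (int g > int g1 - 1 \<longrightarrow> (\<integral>F. real (sur_count l g c d H FH \<omega>H F) \<partial>\<mu>) = 1)"
      using iff[of g] by auto
  qed
qed

end
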